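(* Let $K$ be an imaginary quadratic field with discriminant $\Delta$ and ring of integers $\mathcal{O}$, let $\Gamma=\mathrm{PSL}_2(\mathcal{O})$, and let $\delta\in\mathcal{O}$ have maximal magnitude among proper divisors of $\Delta$ in $\mathcal{O}$. Then $\mathcal{S}(\Gamma)>|\delta|/8$.
   Context: Hyperbolic 3-space is $\mathbb{H}=\{(\zeta,t):\zeta\in\mathbb{C},t>0\}$, with coordinates $\zeta(P),t(P)$; $\Gamma$ acts in the standard way, with $t(gP)=t(P)/(|\mu\zeta(P)-\lambda|^2+|\mu|^2t(P)^2)$ for $g=\begin{bmatrix}\beta&-\alpha\\-\mu&\lambda\end{bmatrix}$. For a fundamental parallelogram $F$ of the lattice $\mathcal{O}\subset\mathbb{C}$, the Bianchi polyhedron is $\mathcal{B}=\{P\in\mathbb{H}:\zeta(P)\in\overline{F},\ t(P)\geq t(gP)\ \forall g\in\Gamma\}$. For coprime $\lambda,\mu\in\mathcal{O}$ (i.e. $(\lambda,\mu)=\mathcal{O}$), $\mu\ne0$, $S_{\lambda/\mu}$ is the open Euclidean hemisphere in $\mathbb{H}$ centered at $(\lambda/\mu,0)$ of radius $1/|\mu|$. Swan's number $\mathcal{S}(\Gamma)$ is the maximum $|\mu|$ such that $S_{\lambda/\mu}\cap\mathcal{B}$ contains an open subset of $S_{\lambda/\mu}$ for some $\lambda$ coprime to $\mu$. *)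

theory Defs
  imports "HOL-Analysis.Analysis" "HOL-Algebra.Coset" "HOL-Computational_Algebra.Polynomial"
begin

section \<open>Imaginary quadratic fields\<close>

text \<open>
  An imaginary quadratic field is regarded as embedded in the complex numbers (this is the
  embedding that makes its ring of integers a lattice): a subfield of degree 2 over the
  rationals that is not real.
\<close>

definition imaginary_quadratic_field :: "complex set \<Rightarrow> bool" where
  "imaginary_quadratic_field K \<longleftrightarrow>
     1 \<in> K \<and> (\<forall>x\<in>K. \<forall>y\<in>K. x - y \<in> K) \<and> (\<forall>x\<in>K. \<forall>y\<in>K. x * y \<in> K) \<and> (\<forall>x\<in>K. inverse x \<in> K) \<and>
     vector_space.dim (\<lambda>(q::rat) (z::complex). of_rat q * z) K = 2 \<and>
     \<not> K \<subseteq> \<real>"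

lemma vector_space_rat_complex: "vector_space (\<lambda>(q::rat) (z::complex). of_rat q * z)"
  by unfold_locales (simp_all add: algebra_simps of_rat_add of_rat_mult)

definition ring_of_integers :: "complex set \<Rightarrow> complex set" where
  "ring_of_integers K = {x \<in> K. algebraic_int x}"

definition int_basis :: "complex set \<Rightarrow> complex \<Rightarrow> complex \<Rightarrow> bool" where
  "int_basis L w1 w2 \<longleftrightarrow>
     bij_betw (\<lambda>(m::int, n::int). of_int m * w1 + of_int n * w2) UNIV L"

text \<open>
  The discriminant is the squared determinant of the matrix of conjugates of an integral basis;
  the two embeddings of the field are the identity and complex conjugation. The value
  does not depend on the basis.
\<close>

definition discriminant :: "complex set \<Rightarrow> int" where
  "discriminant K = (THE D. \<exists>w1 w2. int_basis (ring_of_integers K) w1 w2 \<and>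
     of_int D = (w1 * cnj w2 - w2 * cnj w1)\<^sup>2)"

definition proper_divisor :: "complex set \<Rightarrow> complex \<Rightarrow> complex \<Rightarrow> bool" where
  "proper_divisor R d n \<longleftrightarrow> d \<in> R \<and> (\<exists>e\<in>R. n = d * e) \<and> \<not> (\<exists>e\<in>R. d = n * e)"

text \<open>The ideal generated by the two elements is the whole ring.\<close>

definition coprime_in :: "complex set \<Rightarrow> complex \<Rightarrow> complex \<Rightarrow> bool" where
  "coprime_in R l m \<longleftrightarrow> {a * l + b * m | a b. a \<in> R \<and> b \<in> R} = R"


section \<open>The group and its action on hyperbolic 3-space\<close>

definition SL2 :: "complex set \<Rightarrow> (complex^2^2) monoid" where
  "SL2 R = \<lparr>carrier = {A. (\<forall>i j. A $ i $ j \<in> R) \<and> det A = 1}, mult = (**), one = mat 1\<rparr>"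

definition PSL2 :: "complex set \<Rightarrow> (complex^2^2) set monoid" where
  "PSL2 R = SL2 R Mod {mat 1, - mat 1}"

text \<open>A point of hyperbolic space is a pair (zeta, t), with the Euclidean product metric.\<close>

definition hyp_space :: "(complex \<times> real) set" where
  "hyp_space = {P. snd P > 0}"

definition mat_act :: "complex^2^2 \<Rightarrow> complex \<times> real \<Rightarrow> complex \<times> real" where
  "mat_act A P =
     (let a = A $ 1 $ 1; b = A $ 1 $ 2; c = A $ 2 $ 1; d = A $ 2 $ 2; z = fst P; t = snd P;
          N = (cmod (c * z + d))\<^sup>2 + (cmod c)\<^sup>2 * t\<^sup>2
      in (((a * z + b) * cnj (c * z + d) + a * cnj c * of_real (t\<^sup>2)) / of_real N, t / N))"

lemma mat_act_minus: "mat_act (- A) P = mat_act A P"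
proof -
  have "- (A $ 2 $ 1 * fst P) - A $ 2 $ 2 = - (A $ 2 $ 1 * fst P + A $ 2 $ 2)"
    by simp
  then have "cmod (- (A $ 2 $ 1 * fst P) - A $ 2 $ 2) = cmod (A $ 2 $ 1 * fst P + A $ 2 $ 2)"
    by (metis norm_minus_cancel)
  then show ?thesis
    by (simp add: mat_act_def Let_def algebra_simps)
qed

text \<open>An element of PSL2 is a coset of the form {A, -A}, all of whose members act alike.\<close>

definition act :: "(complex^2^2) set \<Rightarrow> complex \<times> real \<Rightarrow> complex \<times> real" where
  "act g P = the_elem ((\<lambda>A. mat_act A P) ` g)"

lemma minus_mat_1_mult: "- mat 1 ** A = - (A :: complex^2^2)"
  by (simp add: matrix_matrix_mult_def mat_def vec_eq_iff sum_2 forall_2)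

lemma PSL2_coset:
  assumes "g \<in> carrier (PSL2 R)" "A \<in> g"
  shows "g = {A, - A}"
proof -
  from assms(1) obtain B where "g = {B, - B}"
    by (auto simp: PSL2_def SL2_def FactGroup_def RCOSETS_def r_coset_def
        minus_mat_1_mult)
  with assms(2) show ?thesis by auto
qed

lemma act_eq:
  assumes "g \<in> carrier (PSL2 R)" "A \<in> g"
  shows "act g P = mat_act A P"
  using PSL2_coset[OF assms] by (simp add: act_def mat_act_minus)


section \<open>The Bianchi polyhedron and Swan's number\<close>

definition fundamental_parallelogram :: "complex set \<Rightarrow> complex set \<Rightarrow> bool" where
  "fundamental_parallelogram L F \<longleftrightarrow>
     (\<exists>z0 w1 w2. int_basis L w1 w2 \<and>
        F = {z0 + of_real r * w1 + of_real s * w2 | r s. 0 \<le> r \<and> r < 1 \<and> 0 \<le> s \<and> s < 1})"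

definition bianchi_polyhedron :: "complex set \<Rightarrow> complex set \<Rightarrow> (complex \<times> real) set" where
  "bianchi_polyhedron R F =
     {P \<in> hyp_space. fst P \<in> closure F \<and> (\<forall>g \<in> carrier (PSL2 R). snd P \<ge> snd (act g P))}"

definition hemisphere :: "complex \<Rightarrow> complex \<Rightarrow> (complex \<times> real) set" where
  "hemisphere l m = sphere (l / m, 0) (1 / cmod m) \<inter> hyp_space"

text \<open>
  A subset of the hemisphere is open if it is open in the subspace topology. It is required to
  be nonempty, since otherwise every hemisphere would qualify.
\<close>

definition contributes :: "complex set \<Rightarrow> complex set \<Rightarrow> complex \<Rightarrow> complex \<Rightarrow> bool" where
  "contributes R F l m \<longleftrightarrow>
     (\<exists>U. openin (top_of_set (hemisphere l m)) U \<and> U \<noteq> {} \<and>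
          U \<subseteq> hemisphere l m \<inter> bianchi_polyhedron R F)"

definition swan_number :: "complex set \<Rightarrow> complex set \<Rightarrow> real" where
  "swan_number R F =
     Max {cmod m | m. m \<in> R \<and> m \<noteq> 0 \<and> (\<exists>l\<in>R. coprime_in R l m \<and> contributes R F l m)}"

end

theory Submission
  imports Defs "HOL-Computational_Algebra.Squarefree"
begin

text \<open>
  If a point \<open>z\<^sub>0\<close> of the plane lies outside every disc \<open>\<bar>\<mu> z - \<lambda>\<bar> < 1\<close> with \<open>\<lambda>, \<mu>\<close> coprime and
  \<open>\<bar>\<mu>\<bar> \<le> M\<close>, then near \<open>z\<^sub>0\<close> the floor of the Bianchi polyhedron consists of hemispheres with
  \<open>\<bar>\<mu>\<bar> > M\<close>; hence \<open>S(\<Gamma>) > M\<close>, once it is known that only finitely many \<open>\<bar>\<mu>\<bar>\<close> contribute.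

  Put \<open>D = \<bar>\<Delta>\<bar>\<close>. A nonreal cofactor \<open>\<Delta> / \<delta>\<close> has absolute value at least \<open>\<surd>D / 2\<close>, and then
  \<open>z\<^sub>0 = \<i> \<surd>D / (2 N)\<close> with \<open>N\<close> between \<open>\<surd>D / 4\<close> and \<open>\<surd>D / 2\<close> suffices, since all \<open>\<mu>\<close> below \<open>\<surd>D / 2\<close>
  are rational integers. Otherwise \<open>\<bar>\<delta>\<bar> \<le> q\<close> where \<open>D = p q\<close> with \<open>p\<close> prime. If \<open>q \<le> 12 p\<close>, the previous
  choice of \<open>z\<^sub>0\<close>, with another \<open>N\<close>, still does. If not, and \<open>D\<close> is odd, take
  \<open>z\<^sub>0 = \<surd>\<Delta> (k / p + 2 / D)\<close> with \<open>k q \<equiv> -2 (mod p)\<close>. Closeness of \<open>z\<^sub>0\<close> to \<open>k \<surd>\<Delta> / p\<close> forces \<open>\<mu>\<close> into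
  the ramified prime \<open>P\<close> above \<open>p\<close> unless \<open>\<bar>\<mu>\<bar> > q / 8\<close>, and the shift by \<open>2 \<surd>\<Delta> / D\<close> is such that the
  only pairs \<open>(\<lambda>, \<mu>)\<close> with \<open>\<mu> \<in> P\<close> whose disc could contain \<open>z\<^sub>0\<close> have \<open>\<lambda> \<in> P\<close> as well, so are not
  coprime. The case \<open>p = 2\<close>, \<open>\<Delta> = -4 d\<close>, is similar.
\<close>

section \<open>Coprime pairs in a quadratic order\<close>

text \<open>For \<open>q > 12 * p\<close> the prime P is not principal, because 4 p is not of the
  form x^2 + p q y^2. So s = k \<surd>\<Delta> / p is a cusp inequivalent to infinity and lies
  inside no disc. Still, s cannot serve as the point: the discs of radius 1 / p about s + 1 / p and
  s - 1 / p touch it from both sides. The shift leaves them in the imaginary direction. With 2 \<mu>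
  = x + y \<surd>\<Delta>, it changes 2 (\<mu> z - \<lambda>) by -2 y + (2 x / D) \<surd>\<Delta>.
  Hence for \<mu> in P the real part remains an even integer, and coprimality keeps it nonzero, so
  \<mu> z - \<lambda> has modulus at least 1. Equality remains possible for x = 0 only; those
  circles pass through the point in the real direction, and a small real shift leaves their discs.
  The congruence on k cancels p from the denominator of k / p + 2 / D, which is how p dividing
  \<lambda> becomes visible. An integer N between q / 8 and \<surd>(p q) / 2 can exist only if q <
  16 p, apart from N = 1. The threshold 12 leaves room for rounding, and is just what q^2 / 4 > 3 p
  q requires at the shifted point.\<close>

locale quadratic_order =
  fixes R :: "complex set" and w :: complex
  assumes R_eq: "R = {of_int a + of_int b * w | a b. True}"
    and Im_w: "Im w \<noteq> 0"
    and w_sq: "w * w \<in> R"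
    and norm_ge_1: "\<And>x. x \<in> R \<Longrightarrow> x \<noteq> 0 \<Longrightarrow> cmod x \<ge> 1"
begin

section \<open>The ring \<open>R\<close> as a lattice in the plane\<close>

lemma R_I: "of_int a + of_int b * w \<in> R"
  by (auto simp: R_eq)

lemma R_E:
  assumes "x \<in> R"
  obtains a b where "x = of_int a + of_int b * w"
  using assms by (auto simp: R_eq)

lemma R_of_int [simp, intro]: "of_int a \<in> R"
  using R_I[of a 0] by simp

lemma R_0 [simp, intro]: "0 \<in> R" and R_1 [simp, intro]: "1 \<in> R"
  using R_of_int[of 0] R_of_int[of 1] by simp_all

lemma R_numeral [simp, intro]: "numeral n \<in> R"
  using R_of_int[of "numeral n"] by simp

lemma R_w [simp, intro]: "w \<in> R"
  using R_I[of 0 1] by simp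

lemma R_add [simp, intro]: "x \<in> R \<Longrightarrow> y \<in> R \<Longrightarrow> x + y \<in> R"
proof (elim R_E)
  fix a b c d assume "x = of_int a + of_int b * w" "y = of_int c + of_int d * w"
  then have "x + y = of_int (a + c) + of_int (b + d) * w" by (simp add: algebra_simps)
  then show "x + y \<in> R" using R_I by metis
qed

lemma R_uminus [simp, intro]: "x \<in> R \<Longrightarrow> - x \<in> R"
proof (elim R_E)
  fix a b assume "x = of_int a + of_int b * w"
  then have "- x = of_int (- a) + of_int (- b) * w" by (simp add: algebra_simps)
  then show "- x \<in> R" using R_I by metis
qed

lemma R_diff [simp, intro]: "x \<in> R \<Longrightarrow> y \<in> R \<Longrightarrow> x - y \<in> R"
  using R_add[of x "- y"] by simp

lemma R_of_int_mult: "x \<in> R \<Longrightarrow> of_int k * x \<in> R"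
proof (elim R_E)
  fix a b assume "x = of_int a + of_int b * w"
  then have "of_int k * x = of_int (k * a) + of_int (k * b) * w" by (simp add: algebra_simps)
  then show "of_int k * x \<in> R" using R_I by metis
qed

lemma R_mult [simp, intro]: "x \<in> R \<Longrightarrow> y \<in> R \<Longrightarrow> x * y \<in> R"
proof (elim R_E)
  fix a b c d assume "x = of_int a + of_int b * w" "y = of_int c + of_int d * w"
  then have "x * y = (of_int (a * c) + of_int (a * d + b * c) * w) + of_int (b * d) * (w * w)"
    by (simp add: algebra_simps)
  then show "x * y \<in> R" using R_I R_add R_of_int_mult[OF w_sq] by metis
qed

lemma R_power [simp, intro]: "x \<in> R \<Longrightarrow> x ^ n \<in> R"
  by (induction n) auto

lemma R_sum [intro]: "(\<And>i. i \<in> A \<Longrightarrow> f i \<in> R) \<Longrightarrow> sum f A \<in> R"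
  by (induction A rule: infinite_finite_induct) auto

lemma R_prod [intro]: "(\<And>i. i \<in> A \<Longrightarrow> f i \<in> R) \<Longrightarrow> prod f A \<in> R"
  by (induction A rule: infinite_finite_induct) auto

lemma real_coords: "z = of_real (Re z - Im z / Im w * Re w) + of_real (Im z / Im w) * w"
  using Im_w by (simp add: complex_eq_iff)

text \<open>A crude covering radius of the lattice. What is built on it needs some uniform constant,
  not a good one.\<close>

lemma R_approx: "\<exists>\<beta>\<in>R. cmod (z - \<beta>) \<le> 1 + cmod w"
proof -
  define x y where "x = Re z - Im z / Im w * Re w" and "y = Im z / Im w"
  have z: "z = of_real x + of_real y * w"
    unfolding x_def y_def by (rule real_coords)
  have "z - (of_int \<lfloor>x\<rfloor> + of_int \<lfloor>y\<rfloor> * w) = of_real (frac x) + of_real (frac y) * w"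
    by (simp add: z frac_def algebra_simps)
  also have "cmod \<dots> \<le> frac x + frac y * cmod w"
    by (rule order_trans[OF norm_triangle_ineq]) (simp add: norm_mult)
  also have "\<dots> \<le> 1 + 1 * cmod w"
    by (intro add_mono mult_right_mono) (auto intro: less_imp_le frac_lt_1)
  finally show ?thesis using R_I by auto
qed

lemma finite_R_ball: "finite {x \<in> R. cmod x \<le> B}"
proof -
  define N where "N = \<lceil>B / \<bar>Im w\<bar>\<rceil>"
  define M where "M = \<lceil>B + of_int N * cmod w\<rceil>"
  have "{x \<in> R. cmod x \<le> B} \<subseteq> (\<lambda>(a, b). of_int a + of_int b * w) ` ({-M..M} \<times> {-N..N})"
  proof
    fix x assume "x \<in> {x \<in> R. cmod x \<le> B}"
    then have "x \<in> R" and xB: "cmod x \<le> B" by auto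
    then obtain a b where x: "x = of_int a + of_int b * w" by (elim R_E)
    have "\<bar>of_int b\<bar> * \<bar>Im w\<bar> \<le> B"
      using abs_Im_le_cmod[of x] xB by (simp add: x abs_mult)
    then have "\<bar>of_int b\<bar> \<le> B / \<bar>Im w\<bar>"
      using Im_w by (simp add: field_simps)
    then have b: "\<bar>b\<bar> \<le> N" unfolding N_def by linarith
    have "\<bar>of_int a\<bar> = cmod (x - of_int b * w)" by (simp add: x)
    also have "\<dots> \<le> cmod x + cmod (of_int b * w)" by (rule norm_triangle_ineq4)
    also have "\<dots> \<le> B + of_int N * cmod w"
      using xB b by (intro add_mono) (auto simp: norm_mult intro!: mult_right_mono)
    finally have "\<bar>a\<bar> \<le> M" unfolding M_def by linarith
    with b show "x \<in> (\<lambda>(a, b). of_int a + of_int b * w) ` ({-M..M} \<times> {-N..N})"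
      by (intro image_eqI[of _ _ "(a, b)"]) (auto simp: x)
  qed
  then show ?thesis by (rule finite_subset) auto
qed

section \<open>Coprime pairs and the maps that preserve them\<close>

definition cop :: "complex \<Rightarrow> complex \<Rightarrow> bool" where
  "cop l m \<longleftrightarrow> l \<in> R \<and> m \<in> R \<and> (\<exists>a\<in>R. \<exists>b\<in>R. a * l + b * m = 1)"

lemma cop_1_0: "cop 1 0"
  by (auto simp: cop_def intro!: bexI[of _ 1])

lemma cop_iff_coprime_in: "cop l m \<longleftrightarrow> l \<in> R \<and> m \<in> R \<and> coprime_in R l m"
proof -
  have "coprime_in R l m \<longleftrightarrow> (\<exists>a\<in>R. \<exists>b\<in>R. a * l + b * m = 1)" if lm: "l \<in> R" "m \<in> R"
  proof
    assume "coprime_in R l m"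
    then have "1 \<in> {a * l + b * m | a b. a \<in> R \<and> b \<in> R}"
      by (simp add: coprime_in_def)
    then show "\<exists>a\<in>R. \<exists>b\<in>R. a * l + b * m = 1" by force
  next
    assume "\<exists>a\<in>R. \<exists>b\<in>R. a * l + b * m = 1"
    then obtain a b where ab: "a \<in> R" "b \<in> R" "a * l + b * m = 1" by auto
    have "x \<in> {a * l + b * m | a b. a \<in> R \<and> b \<in> R}" if "x \<in> R" for x
    proof -
      have "x = (x * a) * l + (x * b) * m"
        using ab(3) by (metis mult.assoc mult.right_neutral distrib_left)
      then show ?thesis using ab that by blast
    qed
    then show "coprime_in R l m" using lm by (auto simp: coprime_in_def)
  qed
  then show ?thesis by (auto simp: cop_def)
qed

text \<open>As det (v, v) = 0, the transvection y \<mapsto> y + \<beta> det (v, y) v has determinant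
  1 for every v, coprime or not. So even a vector v that is not coprime produces new coprime pairs
  from old ones.\<close>

lemma cop_transvection:
  assumes "cop l m" "v1 \<in> R" "v2 \<in> R" "\<beta> \<in> R"
  shows "cop (l + \<beta> * (v1 * m - v2 * l) * v1) (m + \<beta> * (v1 * m - v2 * l) * v2)"
proof -
  from assms(1) obtain a b where ab: "l \<in> R" "m \<in> R" "a \<in> R" "b \<in> R" "a * l + b * m = 1"
    by (auto simp: cop_def)
  have "(a + \<beta> * v2 * (a * v1 + b * v2)) * (l + \<beta> * (v1 * m - v2 * l) * v1) +
        (b - \<beta> * v1 * (a * v1 + b * v2)) * (m + \<beta> * (v1 * m - v2 * l) * v2) = a * l + b * m"
    by (simp add: algebra_simps)
  with ab assms show ?thesis
    unfolding cop_def by (intro conjI bexI[of _ "a + \<beta> * v2 * (a * v1 + b * v2)"]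
        bexI[of _ "b - \<beta> * v1 * (a * v1 + b * v2)"]) auto
qed

lemma cop_shift:
  assumes "cop l m" "\<tau> \<in> R"
  shows "cop (l - m * \<tau>) m"
proof -
  from assms(1) obtain a b where ab: "l \<in> R" "m \<in> R" "a \<in> R" "b \<in> R" "a * l + b * m = 1"
    by (auto simp: cop_def)
  have "a * (l - m * \<tau>) + (b + a * \<tau>) * m = a * l + b * m"
    by (simp add: algebra_simps)
  with ab assms show ?thesis
    unfolding cop_def by (intro conjI bexI[of _ a] bexI[of _ "b + a * \<tau>"]) auto
qed

text \<open>Modulo \<open>2 ^ k\<close> the element \<open>2 * \<beta>\<close> is nilpotent, so the
  geometric series inverts \<open>1 + 2 * \<beta>\<close>. This makes fractions of coprime pairs
  dense in the plane, whatever the class group.\<close>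

lemma cop_power_2:
  assumes "\<beta> \<in> R"
  shows "cop (1 + 2 * \<beta>) (2 ^ k)"
proof -
  have "(\<Sum>i<k. (- 2 * \<beta>) ^ i) * (1 + 2 * \<beta>) + (- \<beta>) ^ k * 2 ^ k = 1"
  proof -
    have "1 - (- 2 * \<beta>) ^ k = (1 - (- 2 * \<beta>)) * (\<Sum>i<k. (- 2 * \<beta>) ^ i)"
      by (rule one_diff_power_eq)
    moreover have "(- 2 * \<beta>) ^ k = (- \<beta>) ^ k * 2 ^ k"
    proof -
      have "- 2 * \<beta> = - \<beta> * 2" by simp
      then show ?thesis by (simp only: power_mult_distrib)
    qed
    ultimately show ?thesis by (simp add: algebra_simps)
  qed
  moreover have "(\<Sum>i<k. (- 2 * \<beta>) ^ i) \<in> R"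
    using assms by (intro R_sum R_power R_mult) auto
  ultimately show ?thesis
    using assms unfolding cop_def by (intro conjI bexI[of _ "\<Sum>i<k. (- 2 * \<beta>) ^ i"] bexI[of _ "(- \<beta>) ^ k"]) auto
qed

text \<open>The hermitian form attached to the point \<open>(z, t)\<close>: a matrix with bottom row
  (m, -l) moves the point to height \<open>t / ht z t l m\<close>, and \<open>ht z t l m = 1\<close>
  is the equation of the hemisphere of the pair.\<close>

definition ht :: "complex \<Rightarrow> real \<Rightarrow> complex \<Rightarrow> complex \<Rightarrow> real" where
  "ht z t l m = (cmod (m * z - l))\<^sup>2 + t\<^sup>2 * (cmod m)\<^sup>2"

definition uncovered :: "complex \<Rightarrow> real \<Rightarrow> bool" where
  "uncovered z t \<longleftrightarrow> t > 0 \<and> (\<forall>l m. cop l m \<longrightarrow> 1 \<le> ht z t l m)"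

lemma lagrange_identity:
  fixes p q p' q' :: complex
  shows "((cmod p')\<^sup>2 + (cmod q')\<^sup>2) * ((cmod p)\<^sup>2 + (cmod q)\<^sup>2) =
         (cmod (p' * cnj p + q' * cnj q))\<^sup>2 + (cmod (q' * p - p' * q))\<^sup>2"
proof -
  have "complex_of_real (((cmod p')\<^sup>2 + (cmod q')\<^sup>2) * ((cmod p)\<^sup>2 + (cmod q)\<^sup>2)) =
        complex_of_real ((cmod (p' * cnj p + q' * cnj q))\<^sup>2 + (cmod (q' * p - p' * q))\<^sup>2)"
    by (simp only: of_real_add of_real_mult complex_norm_square complex_cnj_add complex_cnj_mult
        complex_cnj_diff complex_cnj_cnj) (simp add: algebra_simps)
  then show ?thesis by (simp only: of_real_eq_iff)
qed

text \<open>Coefficient of the orthogonal projection of (l, m) to the line of v, with respect to the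
  form \<open>ht z t\<close>.\<close>

definition proj_coeff :: "complex \<Rightarrow> real \<Rightarrow> complex \<Rightarrow> complex \<Rightarrow> complex \<Rightarrow> complex \<Rightarrow> complex" where
  "proj_coeff z t v1 v2 l m =
     ((m * z - l) * cnj (v2 * z - v1) + of_real (t\<^sup>2) * m * cnj v2) / of_real (ht z t v1 v2)"

text \<open>Pythagoras for \<open>ht z t\<close>. The form has determinant \<open>t\<^sup>2\<close>,
  so the part orthogonal to v is measured by the determinant with v; adding a multiple of v changes
  only the other part.\<close>

lemma ht_decomp:
  assumes "ht z t v1 v2 > 0"
  shows "ht z t (l + \<beta> * v1) (m + \<beta> * v2) =
           (cmod (proj_coeff z t v1 v2 l m + \<beta>))\<^sup>2 * ht z t v1 v2 +
           t\<^sup>2 * (cmod (v1 * m - v2 * l))\<^sup>2 / ht z t v1 v2"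
proof -
  define Y where "Y = ht z t v1 v2"
  have assms: "ht z t v1 v2 = Y" "Y > 0" using assms by (simp_all add: Y_def)
  define p q where "p = v2 * z - v1" and "q = of_real t * v2"
  define p' q' where "p' = m * z - l" and "q' = of_real t * m"
  define \<xi> where "\<xi> = proj_coeff z t v1 v2 l m"
  have Y: "(cmod p)\<^sup>2 + (cmod q)\<^sup>2 = Y"
    using assms(1) by (simp add: ht_def p_def q_def norm_mult power_mult_distrib)
  have Yc: "p * cnj p + q * cnj q = of_real Y"
    by (simp only: Y[symmetric] of_real_add complex_norm_square)
  have \<xi>: "\<xi> * of_real Y = p' * cnj p + q' * cnj q"
  proof -
    have "\<xi> * of_real Y = (m * z - l) * cnj (v2 * z - v1) + of_real (t\<^sup>2) * m * cnj v2"
      using assms(2) by (simp add: \<xi>_def proj_coeff_def assms(1))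
    then show ?thesis by (simp add: p_def q_def p'_def q'_def power2_eq_square algebra_simps)
  qed
  define P Q where "P = p' + \<beta> * p" and "Q = q' + \<beta> * q"
  have 1: "ht z t (l + \<beta> * v1) (m + \<beta> * v2) = (cmod P)\<^sup>2 + (cmod Q)\<^sup>2"
  proof -
    have "P = (m + \<beta> * v2) * z - (l + \<beta> * v1)" "Q = of_real t * (m + \<beta> * v2)"
      by (simp_all add: P_def Q_def p_def q_def p'_def q'_def algebra_simps)
    then show ?thesis by (simp add: ht_def norm_mult power_mult_distrib)
  qed
  have "P * cnj p + Q * cnj q = (\<xi> + \<beta>) * of_real Y"
  proof -
    have "P * cnj p + Q * cnj q = (p' * cnj p + q' * cnj q) + \<beta> * (p * cnj p + q * cnj q)"
      by (simp add: P_def Q_def algebra_simps)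
    then show ?thesis by (simp only: \<xi>[symmetric] Yc distrib_right)
  qed
  moreover have "Q * p - P * q = of_real t * - (v1 * m - v2 * l)"
    by (simp add: P_def Q_def p_def q_def p'_def q'_def algebra_simps)
  ultimately have "((cmod P)\<^sup>2 + (cmod Q)\<^sup>2) * Y = (cmod ((\<xi> + \<beta>) * of_real Y))\<^sup>2 + (cmod (of_real t * - (v1 * m - v2 * l)))\<^sup>2"
    using lagrange_identity[of P Q p q] Y by simp
  also have "\<dots> = (cmod (\<xi> + \<beta>))\<^sup>2 * Y\<^sup>2 + t\<^sup>2 * (cmod (v1 * m - v2 * l))\<^sup>2"
    by (simp add: norm_mult power_mult_distrib norm_minus_commute)
  finally have "ht z t (l + \<beta> * v1) (m + \<beta> * v2) = (cmod (\<xi> + \<beta>))\<^sup>2 * Y + t\<^sup>2 * (cmod (v1 * m - v2 * l))\<^sup>2 / Y"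
    using assms(2) by (simp add: 1 field_simps power2_eq_square)
  then show ?thesis by (simp only: \<xi>_def Y_def)
qed

end

section \<open>Finiteness of the set of contributing denominators\<close>

text \<open>
  \<open>ht z t\<close> is a positive hermitian form on pairs, and it is at least 1 on coprime pairs if \<open>(z, t)\<close>
  lies in the polyhedron. By pigeonhole it has a short vector \<open>v\<close>, in general not coprime, which can be
  normalised so that its ideal contains a fixed number; such vectors form finitely many orbits, so
  some coprime pair has a bounded nonzero determinant with \<open>v\<close>. Comparing coprime pairs with their
  translates along \<open>v\<close> then bounds the denominators of all hemispheres through the point.
\<close>

context quadratic_order begin

section \<open>From short vectors to bounded denominators\<close>

lemma ht_nonneg: "ht z t l m \<ge> 0"
  by (simp add: ht_def)

lemma ht_pos:
  assumes "t > 0" "l \<noteq> 0 \<or> m \<noteq> 0"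
  shows "ht z t l m > 0"
proof (cases "m = 0")
  case False
  then have "t\<^sup>2 * (cmod m)\<^sup>2 > 0" using assms(1) by simp
  then show ?thesis unfolding ht_def by (smt (verit) zero_le_power2)
qed (use assms in \<open>auto simp: ht_def\<close>)

lemma ht_scale: "ht z t (c * l) (c * m) = (cmod c)\<^sup>2 * ht z t l m"
proof -
  have "c * m * z - c * l = c * (m * z - l)" by (simp add: algebra_simps)
  then have "ht z t (c * l) (c * m) = (cmod (c * (m * z - l)))\<^sup>2 + t\<^sup>2 * (cmod (c * m))\<^sup>2"
    by (simp only: ht_def)
  then show ?thesis by (simp add: ht_def norm_mult power_mult_distrib distrib_left)
qed

text \<open>A transvection along v keeps the determinant \<alpha> with v and adds \<beta> \<alpha>
  to the projection coefficient. The new pair is coprime, so its \<open>ht\<close> is at least 1,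
  the value at (l, m); hence the coefficient is smallest in its class modulo \<alpha>
  \<open>R\<close>. If \<alpha> = 0, then v is a multiple c (l, m) with c in \<open>R\<close>, and
  \<open>cmod c \<ge> 1\<close> gives the bound.\<close>

lemma proj_coeff_bound:
  assumes unc: "uncovered z t" and cop: "cop l m" and one: "ht z t l m = 1"
    and v: "v1 \<in> R" "v2 \<in> R" "v1 \<noteq> 0 \<or> v2 \<noteq> 0"
  shows "cmod (proj_coeff z t v1 v2 l m) \<le> (1 + cmod w) * cmod (v1 * m - v2 * l) + 1"
proof -
  define \<alpha> where "\<alpha> = v1 * m - v2 * l"
  define Y where "Y = ht z t v1 v2"
  define \<xi> where "\<xi> = proj_coeff z t v1 v2 l m"
  have t: "t > 0" using unc by (simp add: uncovered_def)
  have Y: "Y > 0" unfolding Y_def using t v by (intro ht_pos)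
  have dec: "ht z t (l + \<beta> * v1) (m + \<beta> * v2) = (cmod (\<xi> + \<beta>))\<^sup>2 * Y + t\<^sup>2 * (cmod \<alpha>)\<^sup>2 / Y" for \<beta>
    using ht_decomp[of z t v1 v2 l \<beta> m] Y by (simp add: Y_def \<xi>_def \<alpha>_def)
  have dec0: "1 = (cmod \<xi>)\<^sup>2 * Y + t\<^sup>2 * (cmod \<alpha>)\<^sup>2 / Y"
    using dec[of 0] one by simp
  show ?thesis
  proof (cases "\<alpha> = 0")
    case True
    from cop obtain a b where ab: "l \<in> R" "m \<in> R" "a \<in> R" "b \<in> R" "a * l + b * m = 1"
      by (auto simp: cop_def)
    define c where "c = a * v1 + b * v2"
    have vl: "v1 * m = v2 * l" using True by (simp add: \<alpha>_def)
    have "c * l = v1 * (a * l + b * m)" "c * m = v2 * (a * l + b * m)"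
      using vl by (simp_all add: c_def algebra_simps)
    then have cv: "c * l = v1" "c * m = v2" using ab by simp_all
    then have "Y = (cmod c)\<^sup>2"
      unfolding Y_def using ht_scale[of z t c l m] one by simp
    moreover have "cmod c \<ge> 1"
      using cv v ab by (intro norm_ge_1) (auto simp: c_def)
    ultimately have "Y \<ge> 1" by (simp add: one_le_power)
    then have "(cmod \<xi>)\<^sup>2 * 1 \<le> (cmod \<xi>)\<^sup>2 * Y" by (intro mult_left_mono) auto
    also have "\<dots> = 1" using dec0 True by simp
    finally have "(cmod \<xi>)\<^sup>2 \<le> 1" by simp
    then have "cmod \<xi> \<le> 1" by (simp add: power_le_one_iff)
    then show ?thesis using True by (simp add: \<xi>_def \<alpha>_def)
  next
    case False
    obtain \<beta> where \<beta>: "\<beta> \<in> R" "cmod (- \<xi> / \<alpha> - \<beta>) \<le> 1 + cmod w"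
      using R_approx by blast
    have "cop (l + \<beta> * \<alpha> * v1) (m + \<beta> * \<alpha> * v2)"
      unfolding \<alpha>_def using cop_transvection[OF cop v(1,2) \<beta>(1)] .
    then have "1 \<le> ht z t (l + \<beta> * \<alpha> * v1) (m + \<beta> * \<alpha> * v2)"
      using unc by (simp add: uncovered_def)
    then have "(cmod \<xi>)\<^sup>2 * Y \<le> (cmod (\<xi> + \<beta> * \<alpha>))\<^sup>2 * Y"
      using dec0 dec[of "\<beta> * \<alpha>"] by linarith
    then have "cmod \<xi> \<le> cmod (\<xi> + \<beta> * \<alpha>)"
      using Y by (simp add: abs_le_square_iff[symmetric])
    also have "\<xi> + \<beta> * \<alpha> = - \<alpha> * (- \<xi> / \<alpha> - \<beta>)"
      using False by (simp add: field_simps)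
    also have "cmod \<dots> \<le> cmod \<alpha> * (1 + cmod w)"
      unfolding norm_mult using \<beta>(2) by (simp add: mult_left_mono)
    finally show ?thesis by (simp add: \<xi>_def \<alpha>_def mult.commute)
  qed
qed

text \<open>The denominator m is the determinant of (1, 0) and (l, m), two pairs on which the form
  is 1. Both have a bounded determinant with v and, by the preceding lemma, a bounded projection
  coefficient; these four numbers express m.\<close>

lemma denominator_bound_aux:
  assumes unc: "uncovered z t" and cop: "cop l m" and one: "ht z t l m = 1"
    and v: "v1 \<in> R" "v2 \<in> R" "v1 \<noteq> 0 \<or> v2 \<noteq> 0"
    and Yv: "ht z t v1 v2 \<le> B\<^sup>2 * t\<^sup>2" and one': "ht z t 1 0 = 1" and B: "B \<ge> 0"
  shows "cmod m \<le> 2 * B * ((1 + cmod w) * B + 1)"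
proof -
  define Y where "Y = ht z t v1 v2"
  have t: "t > 0" using unc by (simp add: uncovered_def)
  have Y: "Y > 0" unfolding Y_def using t v by (intro ht_pos)
  have det: "cmod (v1 * m' - v2 * l') \<le> B" if "ht z t l' m' = 1" for l' m'
  proof -
    have "1 = (cmod (proj_coeff z t v1 v2 l' m'))\<^sup>2 * Y + t\<^sup>2 * (cmod (v1 * m' - v2 * l'))\<^sup>2 / Y"
      using ht_decomp[of z t v1 v2 l' 0 m'] Y that by (simp add: Y_def)
    then have "t\<^sup>2 * (cmod (v1 * m' - v2 * l'))\<^sup>2 / Y \<le> 1"
      using Y by (smt (verit) mult_nonneg_nonneg zero_le_power2)
    then have "t\<^sup>2 * (cmod (v1 * m' - v2 * l'))\<^sup>2 \<le> B\<^sup>2 * t\<^sup>2"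
      using Y Yv by (simp add: field_simps Y_def)
    then have "(cmod (v1 * m' - v2 * l'))\<^sup>2 \<le> B\<^sup>2" using t by simp
    then show ?thesis using B by (rule power2_le_imp_le)
  qed
  define \<xi> \<xi>' where "\<xi> = proj_coeff z t v1 v2 l m" and "\<xi>' = proj_coeff z t v1 v2 1 0"
  define \<alpha> \<alpha>' where "\<alpha> = v1 * m - v2 * l" and "\<alpha>' = v1 * 0 - v2 * 1"
  have \<alpha>: "cmod \<alpha> \<le> B" "cmod \<alpha>' \<le> B"
    unfolding \<alpha>_def \<alpha>'_def using det one one' by blast+
  have "cmod \<xi> \<le> (1 + cmod w) * cmod \<alpha> + 1" "cmod \<xi>' \<le> (1 + cmod w) * cmod \<alpha>' + 1"
    unfolding \<xi>_def \<alpha>_def \<xi>'_def \<alpha>'_def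
    using proj_coeff_bound[OF unc cop one v] proj_coeff_bound[OF unc cop_1_0 one' v] by blast+
  moreover have "(1 + cmod w) * cmod \<alpha> \<le> (1 + cmod w) * B" "(1 + cmod w) * cmod \<alpha>' \<le> (1 + cmod w) * B"
    using \<alpha> by (auto intro!: mult_left_mono)
  ultimately have \<xi>: "cmod \<xi> \<le> (1 + cmod w) * B + 1" "cmod \<xi>' \<le> (1 + cmod w) * B + 1"
    by linarith+
  have "m * of_real Y = (\<alpha> * \<xi>' - \<alpha>' * \<xi>) * of_real Y"
  proof -
    define P N where "P = cnj (v2 * z - v1)" and "N = of_real (t\<^sup>2) * cnj v2"
    have 1: "\<xi> * of_real Y = (m * z - l) * P + m * N" and 2: "\<xi>' * of_real Y = - P"
      using Y by (simp_all add: \<xi>_def \<xi>'_def proj_coeff_def Y_def P_def N_def)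
    have "complex_of_real Y = (v2 * z - v1) * cnj (v2 * z - v1) + of_real (t\<^sup>2) * (v2 * cnj v2)"
      unfolding Y_def ht_def of_real_add of_real_mult complex_norm_square ..
    then have 3: "of_real Y = (v2 * z - v1) * P + v2 * N"
      by (simp add: P_def N_def)
    have "(\<alpha> * \<xi>' - \<alpha>' * \<xi>) * of_real Y = \<alpha> * (\<xi>' * of_real Y) - \<alpha>' * (\<xi> * of_real Y)"
      by (simp add: algebra_simps)
    also have "\<dots> = m * ((v2 * z - v1) * P + v2 * N)"
      unfolding 1 2 \<alpha>_def \<alpha>'_def by (simp add: algebra_simps)
    finally show ?thesis by (simp only: 3)
  qed
  then have "m = \<alpha> * \<xi>' - \<alpha>' * \<xi>" using Y by simp
  then have "cmod m \<le> cmod \<alpha> * cmod \<xi>' + cmod \<alpha>' * cmod \<xi>"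
    by (metis norm_mult norm_triangle_ineq4)
  also have "\<dots> \<le> B * ((1 + cmod w) * B + 1) + B * ((1 + cmod w) * B + 1)"
    using \<alpha> \<xi> B by (intro add_mono mult_mono) auto
  finally show ?thesis by (simp add: algebra_simps)
qed

text \<open>A bound of order t improves to order \<open>t\<^sup>2\<close>: moving the coprime pair
  along v until its projection coefficient is bounded gives 1 \<le> K Y + \<open>t\<^sup>2\<close>
  D^2 / Y with Y = \<open>ht z t v1 v2\<close>, and it remains to multiply by Y and use Y \<le> C
  t.\<close>

lemma short_vector_bound:
  assumes unc: "uncovered z t" and cop: "cop l m"
    and v: "v1 \<in> R" "v2 \<in> R" "v1 \<noteq> 0 \<or> v2 \<noteq> 0"
    and \<alpha>: "v1 * m - v2 * l \<noteq> 0" "cmod (v1 * m - v2 * l) \<le> D"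
    and short: "ht z t v1 v2 \<le> C * t"
  shows "ht z t v1 v2 \<le> (D\<^sup>2 * ((1 + cmod w)\<^sup>2 * C\<^sup>2 + 1)) * t\<^sup>2"
proof -
  define \<alpha> where "\<alpha> = v1 * m - v2 * l"
  define Y where "Y = ht z t v1 v2"
  define \<xi> where "\<xi> = proj_coeff z t v1 v2 l m"
  have t: "t > 0" using unc by (simp add: uncovered_def)
  have Y: "Y > 0" unfolding Y_def using t v by (intro ht_pos)
  have a0: "\<alpha> \<noteq> 0" and aD: "cmod \<alpha> \<le> D" using \<alpha> by (simp_all add: \<alpha>_def)
  obtain \<beta> where \<beta>: "\<beta> \<in> R" "cmod (- \<xi> / \<alpha> - \<beta>) \<le> 1 + cmod w"
    using R_approx by blast
  have "\<xi> + \<beta> * \<alpha> = - \<alpha> * (- \<xi> / \<alpha> - \<beta>)"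
    using a0 by (simp add: field_simps)
  then have "cmod (\<xi> + \<beta> * \<alpha>) = cmod \<alpha> * cmod (- \<xi> / \<alpha> - \<beta>)"
    by (simp add: norm_mult)
  also have "\<dots> \<le> D * (1 + cmod w)"
    using aD \<beta>(2) by (intro mult_mono) (auto intro: order_trans[OF norm_ge_zero])
  finally have 1: "(cmod (\<xi> + \<beta> * \<alpha>))\<^sup>2 \<le> (D * (1 + cmod w))\<^sup>2" by (intro power_mono) auto
  have "cop (l + \<beta> * \<alpha> * v1) (m + \<beta> * \<alpha> * v2)"
    unfolding \<alpha>_def using cop_transvection[OF cop v(1,2) \<beta>(1)] .
  then have "1 \<le> ht z t (l + \<beta> * \<alpha> * v1) (m + \<beta> * \<alpha> * v2)"
    using unc by (simp add: uncovered_def)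
  also have "\<dots> = (cmod (\<xi> + \<beta> * \<alpha>))\<^sup>2 * Y + t\<^sup>2 * (cmod \<alpha>)\<^sup>2 / Y"
    using ht_decomp[of z t v1 v2 l "\<beta> * \<alpha>" m] Y by (simp add: Y_def \<xi>_def \<alpha>_def)
  finally have "1 * Y \<le> ((cmod (\<xi> + \<beta> * \<alpha>))\<^sup>2 * Y + t\<^sup>2 * (cmod \<alpha>)\<^sup>2 / Y) * Y"
    using Y by (intro mult_right_mono) auto
  also have "((cmod (\<xi> + \<beta> * \<alpha>))\<^sup>2 * Y + t\<^sup>2 * (cmod \<alpha>)\<^sup>2 / Y) * Y =
      (cmod (\<xi> + \<beta> * \<alpha>))\<^sup>2 * Y\<^sup>2 + t\<^sup>2 * (cmod \<alpha>)\<^sup>2"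
    using Y by (simp add: distrib_right power2_eq_square)
  finally have "Y \<le> (cmod (\<xi> + \<beta> * \<alpha>))\<^sup>2 * Y\<^sup>2 + t\<^sup>2 * (cmod \<alpha>)\<^sup>2"
    by simp
  also have "\<dots> \<le> (D * (1 + cmod w))\<^sup>2 * (C * t)\<^sup>2 + t\<^sup>2 * D\<^sup>2"
  proof (rule add_mono)
    have "Y\<^sup>2 \<le> (C * t)\<^sup>2" using Y short by (intro power_mono) (auto simp: Y_def)
    with 1 show "(cmod (\<xi> + \<beta> * \<alpha>))\<^sup>2 * Y\<^sup>2 \<le> (D * (1 + cmod w))\<^sup>2 * (C * t)\<^sup>2"
      by (intro mult_mono) auto
    show "t\<^sup>2 * (cmod \<alpha>)\<^sup>2 \<le> t\<^sup>2 * D\<^sup>2"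
      using aD by (intro mult_left_mono power_mono) auto
  qed
  also have "\<dots> = (D\<^sup>2 * ((1 + cmod w)\<^sup>2 * C\<^sup>2 + 1)) * t\<^sup>2"
    unfolding power_mult_distrib by (simp add: algebra_simps)
  finally show ?thesis by (simp add: Y_def)
qed


section \<open>Short vectors and their finitely many orbits\<close>

lemma R_coords_eq_0: "of_int a + of_int b * w = 0 \<longleftrightarrow> a = 0 \<and> b = 0"
  using Im_w by (auto simp: complex_eq_iff)

text \<open>Dirichlet approximation over \<open>R\<close>: (N + 1)^2 multipliers compete for N^2
  boxes.\<close>

lemma R_pigeonhole:
  assumes "N > 0"
  shows "\<exists>a b. (a \<noteq> 0 \<or> b \<noteq> 0) \<and> \<bar>a\<bar> \<le> int N \<and> \<bar>b\<bar> \<le> int N \<and>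
           (\<exists>l\<in>R. cmod ((of_int a + of_int b * w) * z - l) \<le> (1 + cmod w) / N)"
proof -
  define y where "y = (\<lambda>(a, b). Im ((of_int a + of_int b * w) * z) / Im w)"
  define x where "x = (\<lambda>(a, b). Re ((of_int a + of_int b * w) * z) - Im ((of_int a + of_int b * w) * z) / Im w * Re w)"
  have z: "(of_int a + of_int b * w) * z = of_real (x (a, b)) + of_real (y (a, b)) * w" for a b
    unfolding x_def y_def using real_coords[of "(of_int a + of_int b * w) * z"] by simp
  define D where "D = {0..int N} \<times> {0..int N}"
  define f where "f = (\<lambda>u. (\<lfloor>N * frac (x u)\<rfloor>, \<lfloor>N * frac (y u)\<rfloor>))"
  have fl: "\<lfloor>N * frac r\<rfloor> \<in> {0..<int N}" for r
  proof -
    have "real N * frac r < real N * 1" using assms by (intro mult_strict_left_mono frac_lt_1) auto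
    then show ?thesis by (simp add: floor_less_iff)
  qed
  have "f ` D \<subseteq> {0..<int N} \<times> {0..<int N}"
    using fl by (auto simp: f_def)
  then have "card (f ` D) \<le> card ({0..<int N} \<times> {0..<int N})"
    by (intro card_mono) auto
  also have "\<dots> < card D"
    by (simp add: D_def card_cartesian_product nat_add_distrib)
  finally have "\<not> inj_on f D" by (rule pigeonhole)
  then obtain a b a' b' where
    ab: "(a, b) \<in> D" "(a', b') \<in> D" "f (a, b) = f (a', b')" "(a, b) \<noteq> (a', b')"
    by (auto simp: inj_on_def)
  have close: "\<bar>frac r - frac r'\<bar> \<le> 1 / N" if "\<lfloor>N * frac r\<rfloor> = \<lfloor>N * frac r'\<rfloor>" for r r'
  proof -
    have "\<bar>N * frac r - N * frac r'\<bar> \<le> 1" using that by linarith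
    then have "N * \<bar>frac r - frac r'\<bar> \<le> 1"
      by (simp add: right_diff_distrib[symmetric] abs_mult)
    then show ?thesis using assms by (simp add: field_simps)
  qed
  define l where "l = of_int (\<lfloor>x (a, b)\<rfloor> - \<lfloor>x (a', b')\<rfloor>) + of_int (\<lfloor>y (a, b)\<rfloor> - \<lfloor>y (a', b')\<rfloor>) * w"
  have "(of_int (a - a') + of_int (b - b') * w) * z - l =
        of_real (frac (x (a, b)) - frac (x (a', b'))) + of_real (frac (y (a, b)) - frac (y (a', b'))) * w"
  proof -
    have "(of_int (a - a') + of_int (b - b') * w) * z - l =
          (of_int a + of_int b * w) * z - (of_int a' + of_int b' * w) * z - l"
      by (simp add: algebra_simps)
    then show ?thesis unfolding z by (simp add: l_def frac_def algebra_simps)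
  qed
  also have "cmod \<dots> \<le> \<bar>frac (x (a, b)) - frac (x (a', b'))\<bar> + \<bar>frac (y (a, b)) - frac (y (a', b'))\<bar> * cmod w"
    by (rule order_trans[OF norm_triangle_ineq]) (simp only: norm_mult norm_of_real order_refl)
  also have "\<dots> \<le> 1 / N + 1 / N * cmod w"
    using ab(3) by (intro add_mono mult_right_mono close) (auto simp: f_def)
  finally have "cmod ((of_int (a - a') + of_int (b - b') * w) * z - l) \<le> (1 + cmod w) / N"
    by (simp add: add_divide_distrib)
  moreover have "l \<in> R" unfolding l_def by (rule R_I)
  ultimately show ?thesis
    using ab by (intro exI[of _ "a - a'"] exI[of _ "b - b'"]) (auto simp: D_def)
qed

lemma R_coords_norm_le:
  assumes "\<bar>a\<bar> \<le> int N" "\<bar>b\<bar> \<le> int N"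
  shows "cmod (of_int a + of_int b * w) \<le> (1 + cmod w) * N"
proof -
  have "cmod (of_int a + of_int b * w) \<le> \<bar>of_int a\<bar> + \<bar>of_int b\<bar> * cmod w"
    by (rule order_trans[OF norm_triangle_ineq]) (simp add: norm_mult)
  also have "\<dots> \<le> real N + real N * cmod w"
    using assms by (intro add_mono mult_right_mono) auto
  finally show ?thesis by (simp add: algebra_simps)
qed

text \<open>Taking N of size 1 / \<surd>t balances the two summands of \<open>ht\<close>, which then
  are both of order t.\<close>

lemma short_vector:
  assumes "0 < t" "t \<le> 1"
  shows "\<exists>v1\<in>R. \<exists>v2\<in>R. (v1 \<noteq> 0 \<or> v2 \<noteq> 0) \<and> ht z t v1 v2 \<le> 5 * (1 + cmod w)\<^sup>2 * t"
proof -
  define s where "s = 1 / sqrt t"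
  define N where "N = nat \<lceil>s\<rceil>"
  have s: "s \<ge> 1" using assms by (simp add: s_def)
  have s2: "s\<^sup>2 * t = 1" using assms by (simp add: s_def power_divide)
  have N: "s \<le> N" "N \<le> 2 * s" "N > 0" using s unfolding N_def by linarith+
  from R_pigeonhole[OF N(3), of z] obtain a b l where
    ab: "a \<noteq> 0 \<or> b \<noteq> 0" "\<bar>a\<bar> \<le> int N" "\<bar>b\<bar> \<le> int N" "l \<in> R"
      "cmod ((of_int a + of_int b * w) * z - l) \<le> (1 + cmod w) / N" by blast
  define m where "m = of_int a + of_int b * w"
  have "cmod m \<le> (1 + cmod w) * (2 * s)"
    unfolding m_def using R_coords_norm_le[OF ab(2,3)] N(2)
    by (rule order_trans[OF _ mult_left_mono]) auto
  then have "t\<^sup>2 * (cmod m)\<^sup>2 \<le> t\<^sup>2 * ((1 + cmod w) * (2 * s))\<^sup>2"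
    by (intro mult_left_mono power_mono) auto
  also have "\<dots> = 4 * (1 + cmod w)\<^sup>2 * t * (s\<^sup>2 * t)"
    by (simp add: power_mult_distrib power2_eq_square)
  finally have 1: "t\<^sup>2 * (cmod m)\<^sup>2 \<le> 4 * (1 + cmod w)\<^sup>2 * t" by (simp add: s2)
  have "(1 + cmod w) / N \<le> (1 + cmod w) / s"
    using s N by (intro divide_left_mono) auto
  then have "cmod (m * z - l) \<le> (1 + cmod w) / s" using ab(5) by (simp add: m_def)
  then have "(cmod (m * z - l))\<^sup>2 \<le> ((1 + cmod w) / s)\<^sup>2" by (intro power_mono) auto
  also have "\<dots> = (1 + cmod w)\<^sup>2 * t"
    using s2 s by (simp add: power_divide field_simps)
  finally have "ht z t l m \<le> 5 * (1 + cmod w)\<^sup>2 * t"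
    using 1 by (simp add: ht_def)
  moreover have "m \<noteq> 0" using ab(1) R_coords_eq_0 by (simp add: m_def)
  ultimately show ?thesis using ab(4) R_I[of a b] m_def by blast
qed

text \<open>The classical argument for finiteness of the class number. Let g be a shortest nonzero
  element of the ideal (v1, v2). By pigeonhole each h in the ideal has a multiplier m in the finite
  set \<open>S\<close> with m h in g \<open>R\<close>, so the product n of \<open>S\<close> carries
  the whole ideal into g \<open>R\<close>. The factor k is n / g, and the image of g is n.\<close>

lemma normalise_vector:
  "\<exists>n\<in>R. n \<noteq> 0 \<and> (\<forall>v1\<in>R. \<forall>v2\<in>R. v1 \<noteq> 0 \<or> v2 \<noteq> 0 \<longrightarrow>
     (\<exists>k. k \<noteq> 0 \<and> k * v1 \<in> R \<and> k * v2 \<in> R \<and> cmod k \<le> cmod n \<and>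
       (\<exists>a\<in>R. \<exists>b\<in>R. a * (k * v1) + b * (k * v2) = n)))"
proof -
  define N where "N = nat \<lceil>1 + cmod w\<rceil> + 1"
  have N: "(1 + cmod w) / N < 1" "N > 0"
  proof -
    have "1 + cmod w < N" unfolding N_def by (simp add: add.commute) linarith
    then show "(1 + cmod w) / N < 1" by (simp add: divide_simps)
    show "N > 0" by (simp add: N_def)
  qed
  define S where "S = (\<lambda>(a, b). of_int a + of_int b * w) ` ({- int N..int N} \<times> {- int N..int N}) - {0}"
  define n where "n = \<Prod>S"
  have S: "finite S" "S \<subseteq> R" "0 \<notin> S" by (auto simp: S_def intro: R_I)
  have n: "n \<in> R" "n \<noteq> 0" using S by (auto simp: n_def)
  show ?thesis
  proof (intro bexI[of _ n] conjI ballI impI n)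
    fix v1 v2 assume v: "v1 \<in> R" "v2 \<in> R" "v1 \<noteq> 0 \<or> v2 \<noteq> 0"
    define A where "A = {a * v1 + b * v2 | a b. a \<in> R \<and> b \<in> R}"
    have AR: "A \<subseteq> R" using v by (auto simp: A_def)
    have v1A: "v1 \<in> A" unfolding A_def by (rule CollectI, rule exI[of _ 1], rule exI[of _ 0]) auto
    have v2A: "v2 \<in> A" unfolding A_def by (rule CollectI, rule exI[of _ 0], rule exI[of _ 1]) auto
    have A_comb: "c * h - d * h' \<in> A" if "h \<in> A" "h' \<in> A" "c \<in> R" "d \<in> R" for c d h h'
    proof -
      from that obtain a b a' b' where "a \<in> R" "b \<in> R" "a' \<in> R" "b' \<in> R" "h = a * v1 + b * v2" "h' = a' * v1 + b' * v2"
        by (auto simp: A_def)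
      moreover from this have "c * h - d * h' = (c * a - d * a') * v1 + (c * b - d * b') * v2"
        by (simp add: algebra_simps)
      ultimately show ?thesis unfolding A_def using that(3,4) by blast
    qed
    obtain g0 where g0: "g0 \<in> A" "g0 \<noteq> 0" using v(3) v1A v2A by blast
    define G where "G = {h \<in> A. h \<noteq> 0 \<and> cmod h \<le> cmod g0}"
    have "finite G" by (rule finite_subset[OF _ finite_R_ball[of "cmod g0"]]) (use AR in \<open>auto simp: G_def\<close>)
    moreover have "G \<noteq> {}" using g0 by (auto simp: G_def)
    ultimately obtain g where g: "g \<in> G" "\<And>h. h \<in> G \<Longrightarrow> cmod g \<le> cmod h"
      using ex_is_arg_min_if_finite[of G cmod] by (auto simp: is_arg_min_linorder)
    have gA: "g \<in> A" "g \<noteq> 0" using g by (auto simp: G_def)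
    have gmin: "h = 0" if "h \<in> A" "cmod h < cmod g" for h
      using g that unfolding G_def by force
    have key: "\<exists>c\<in>R. n * h = c * g" if h: "h \<in> A" for h
    proof -
      from R_pigeonhole[OF N(2), of "h / g"] obtain a b l where
        ab: "a \<noteq> 0 \<or> b \<noteq> 0" "\<bar>a\<bar> \<le> int N" "\<bar>b\<bar> \<le> int N" "l \<in> R"
          "cmod ((of_int a + of_int b * w) * (h / g) - l) \<le> (1 + cmod w) / N" by blast
      define m where "m = of_int a + of_int b * w"
      have mS: "m \<in> S" using ab R_coords_eq_0[of a b] by (auto simp: S_def m_def abs_le_iff)
      have "cmod (m * h - l * g) = cmod (m * (h / g) - l) * cmod g"
        using gA by (simp add: norm_mult[symmetric] left_diff_distrib)
      also have "\<dots> < 1 * cmod g"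
        using ab(5) N(1) gA by (intro mult_strict_right_mono) (auto simp: m_def)
      finally have "m * h = l * g"
        using gmin[of "m * h - l * g"] A_comb[OF h gA(1), of m l] mS S ab(4) by auto
      moreover have "n = (\<Prod>(S - {m})) * m"
        unfolding n_def using S mS by (simp add: prod.remove mult.commute)
      ultimately have "n * h = (\<Prod>(S - {m})) * l * g" by simp
      moreover have "\<Prod>(S - {m}) \<in> R" using S by (intro R_prod) auto
      ultimately show ?thesis using ab(4) by blast
    qed
    have quo: "n / g * h \<in> R" if "h \<in> A" for h
    proof -
      from key[OF that] obtain c where "c \<in> R" "n * h = c * g" by blast
      then show ?thesis using gA by simp
    qed
    have "cmod g \<ge> 1" using gA AR by (intro norm_ge_1) auto
    then have "cmod (n / g) \<le> cmod n"
      by (simp add: norm_divide divide_le_eq mult_le_cancel_left1 order_less_le_trans[of 0 1])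
    moreover have "\<exists>a\<in>R. \<exists>b\<in>R. a * (n / g * v1) + b * (n / g * v2) = n"
    proof -
      obtain a b where ab: "a \<in> R" "b \<in> R" "g = a * v1 + b * v2"
        using gA(1) by (auto simp: A_def)
      have "a * (c * v1) + b * (c * v2) = c * (a * v1 + b * v2)" for c
        by (simp add: algebra_simps)
      also have "n / g * (a * v1 + b * v2) = n" using gA(2) unfolding ab(3)[symmetric] by simp
      finally show ?thesis using ab(1,2) by blast
    qed
    ultimately show "\<exists>k. k \<noteq> 0 \<and> k * v1 \<in> R \<and> k * v2 \<in> R \<and> cmod k \<le> cmod n \<and>
       (\<exists>a\<in>R. \<exists>b\<in>R. a * (k * v1) + b * (k * v2) = n)"
      using n gA quo[OF v1A] quo[OF v2A] by (intro exI[of _ "n / g"]) simp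
  qed
qed

text \<open>
  The matrix \<open>((p, q), (r, s))\<close> of the proof is the rank one perturbation of the identity that maps
  \<open>v\<close> to \<open>v'\<close>, corrected by a multiple of \<open>y \<mapsto> det (v, y)\<close> to have determinant 1.
\<close>

lemma congruent_orbit:
  assumes "a \<in> R" "b \<in> R" "v1 \<in> R" "v2 \<in> R" "a' \<in> R" "b' \<in> R" "v1' \<in> R" "v2' \<in> R"
    and "n \<in> R" "x1 \<in> R" "x2 \<in> R"
    and n: "a * v1 + b * v2 = n" "a' * v1' + b' * v2' = n"
    and cong: "v1' = v1 + n\<^sup>2 * x1" "v2' = v2 + n\<^sup>2 * x2"
  shows "\<exists>l m. cop l m \<and> v1' * m - v2' * l = - v2" and "\<exists>l m. cop l m \<and> v1' * m - v2' * l = v1"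
proof -
  define c where "c = a * x1 + b * x2"
  define p q where "p = 1 + n * x1 * a - c * b' * v2" and "q = n * x1 * b + c * b' * v1"
  define r s where "r = n * x2 * a + c * a' * v2" and "s = 1 + n * x2 * b - c * a' * v1"
  have pqrs: "p \<in> R" "q \<in> R" "r \<in> R" "s \<in> R"
    using assms by (auto simp: p_def q_def r_def s_def c_def)
  have det: "p * s - q * r = 1"
  proof -
    have "p * s - q * r = 1 + n * (a * x1 + b * x2) - c * (a' * v1 + b' * v2)
        - n * c * ((a * v1 + b * v2) * (x1 * a' + x2 * b'))"
      unfolding p_def q_def r_def s_def by (simp add: algebra_simps)
    also have "\<dots> = 1 + n * c - c * (a' * v1' + b' * v2')"
      unfolding n(1) cong c_def by (simp add: algebra_simps power2_eq_square)
    also have "\<dots> = 1" unfolding n(2) by simp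
    finally show ?thesis .
  qed
  have T: "p * v1 + q * v2 = v1'" "r * v1 + s * v2 = v2'"
  proof -
    have "p * v1 + q * v2 = v1 + n * x1 * (a * v1 + b * v2)"
      "r * v1 + s * v2 = v2 + n * x2 * (a * v1 + b * v2)"
      unfolding p_def q_def r_def s_def by (simp_all add: algebra_simps)
    then show "p * v1 + q * v2 = v1'" "r * v1 + s * v2 = v2'"
      unfolding n(1) cong by (simp_all add: power2_eq_square)
  qed
  have "cop p r" unfolding cop_def using pqrs det
    by (intro conjI bexI[of _ s] bexI[of _ "- q"]) (auto simp: algebra_simps)
  moreover have "v1' * r - v2' * p = - v2" using det T by algebra
  ultimately show "\<exists>l m. cop l m \<and> v1' * m - v2' * l = - v2" by blast
  have "cop q s" unfolding cop_def using pqrs det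
    by (intro conjI bexI[of _ "- r"] bexI[of _ p]) (auto simp: algebra_simps)
  moreover have "v1' * s - v2' * q = v1" using det T by algebra
  ultimately show "\<exists>l m. cop l m \<and> v1' * m - v2' * l = v1" by blast
qed


text \<open>Vectors whose ideal contains n fall into finitely many classes modulo
  \<open>n\<^sup>2\<close>. Within a class, \<open>congruent_orbit\<close> yields coprime pairs
  whose determinants with v are, up to sign, the coordinates of one fixed representative, and these
  are not both zero.\<close>

lemma uniform_coprime_partner:
  assumes n: "n \<in> R" "n \<noteq> 0"
  shows "\<exists>D. \<forall>v1\<in>R. \<forall>v2\<in>R. (\<exists>a\<in>R. \<exists>b\<in>R. a * v1 + b * v2 = n) \<longrightarrow>
           (\<exists>l m. cop l m \<and> v1 * m - v2 * l \<noteq> 0 \<and> cmod (v1 * m - v2 * l) \<le> D)"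
proof -
  define Q where "Q = {r \<in> R. cmod r \<le> (1 + cmod w) * cmod (n\<^sup>2)}"
  have Q: "finite Q" unfolding Q_def by (rule finite_R_ball)
  define rep where "rep = (\<lambda>q u. fst u \<in> R \<and> snd u \<in> R \<and> (\<exists>a\<in>R. \<exists>b\<in>R. a * fst u + b * snd u = n) \<and>
    (\<exists>x\<in>R. fst u = fst q + n\<^sup>2 * x) \<and> (\<exists>x\<in>R. snd u = snd q + n\<^sup>2 * x))"
  \<comment> \<open>In a class without admissible vectors \<open>f\<close> takes an arbitrary value,
    which can only enlarge \<open>D\<close>.\<close>
  define f where "f = (\<lambda>q. SOME u. rep q u)"
  define D where "D = (\<Sum>q\<in>Q \<times> Q. cmod (fst (f q)) + cmod (snd (f q)))"
  have residue: "\<exists>q\<in>Q. \<exists>x\<in>R. v = q + n\<^sup>2 * x" if "v \<in> R" for v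
  proof -
    obtain x where x: "x \<in> R" "cmod (v / n\<^sup>2 - x) \<le> 1 + cmod w" using R_approx by blast
    have "v - n\<^sup>2 * x = (v / n\<^sup>2 - x) * n\<^sup>2"
      using n by (simp add: field_simps)
    then have "cmod (v - n\<^sup>2 * x) = cmod (v / n\<^sup>2 - x) * cmod (n\<^sup>2)"
      by (simp only: norm_mult)
    also have "\<dots> \<le> (1 + cmod w) * cmod (n\<^sup>2)" using x by (intro mult_right_mono) auto
    finally have "v - n\<^sup>2 * x \<in> Q" using that x n by (simp add: Q_def)
    then show ?thesis using x by (intro bexI[of _ "v - n\<^sup>2 * x"] bexI[of _ x]) auto
  qed
  show ?thesis
  proof (intro exI[of _ D] ballI impI)
    fix v1 v2 assume v: "v1 \<in> R" "v2 \<in> R" and "\<exists>a\<in>R. \<exists>b\<in>R. a * v1 + b * v2 = n"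
    then obtain a' b' where ab': "a' \<in> R" "b' \<in> R" "a' * v1 + b' * v2 = n" by blast
    obtain q1 y1 where q1: "q1 \<in> Q" "y1 \<in> R" "v1 = q1 + n\<^sup>2 * y1"
      using residue[OF v(1)] by blast
    obtain q2 y2 where q2: "q2 \<in> Q" "y2 \<in> R" "v2 = q2 + n\<^sup>2 * y2"
      using residue[OF v(2)] by blast
    note q = q1(1) q2(1) q1(2) q2(2) q1(3) q2(3)
    have "rep (q1, q2) (v1, v2)" using v ab' q by (auto simp: rep_def)
    then have "rep (q1, q2) (f (q1, q2))" unfolding f_def by (rule someI)
    moreover define u1 u2 where "u1 = fst (f (q1, q2))" and "u2 = snd (f (q1, q2))"
    ultimately obtain a b x1 x2 where
      u: "f (q1, q2) = (u1, u2)" "u1 \<in> R" "u2 \<in> R" "a \<in> R" "b \<in> R" "a * u1 + b * u2 = n"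
        "x1 \<in> R" "x2 \<in> R" "u1 = q1 + n\<^sup>2 * x1" "u2 = q2 + n\<^sup>2 * x2"
      unfolding rep_def by auto
    have "cmod (fst (f (q1, q2))) + cmod (snd (f (q1, q2))) \<le> D"
      unfolding D_def using Q q by (intro member_le_sum) auto
    then have uD: "cmod u1 + cmod u2 \<le> D" by (simp add: u)
    then have uD': "cmod u1 \<le> D" "cmod u2 \<le> D"
      using norm_ge_zero[of u1] norm_ge_zero[of u2] by linarith+
    have cong: "v1 = u1 + n\<^sup>2 * (y1 - x1)" "v2 = u2 + n\<^sup>2 * (y2 - x2)"
      using q u by (simp_all add: algebra_simps)
    have "\<exists>l m. cop l m \<and> v1 * m - v2 * l = - u2" "\<exists>l m. cop l m \<and> v1 * m - v2 * l = u1"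
      using congruent_orbit[OF u(4,5,2,3) ab'(1,2) v n(1) _ _ u(6) ab'(3) cong] q u by auto
    moreover have "u1 \<noteq> 0 \<or> u2 \<noteq> 0" using u n by auto
    ultimately show "\<exists>l m. cop l m \<and> v1 * m - v2 * l \<noteq> 0 \<and> cmod (v1 * m - v2 * l) \<le> D"
      using uD' by fastforce
  qed
qed

theorem denominator_bound:
  "\<exists>C. \<forall>z t l m. uncovered z t \<longrightarrow> cop l m \<longrightarrow> ht z t l m = 1 \<longrightarrow> cmod m \<le> C"
proof -
  obtain n where n: "n \<in> R" "n \<noteq> 0" and norm: "\<forall>v1\<in>R. \<forall>v2\<in>R. v1 \<noteq> 0 \<or> v2 \<noteq> 0 \<longrightarrow>
     (\<exists>k. k \<noteq> 0 \<and> k * v1 \<in> R \<and> k * v2 \<in> R \<and> cmod k \<le> cmod n \<and>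
       (\<exists>a\<in>R. \<exists>b\<in>R. a * (k * v1) + b * (k * v2) = n))"
    using normalise_vector by (elim bexE conjE)
  obtain D where D: "\<forall>v1\<in>R. \<forall>v2\<in>R. (\<exists>a\<in>R. \<exists>b\<in>R. a * v1 + b * v2 = n) \<longrightarrow>
           (\<exists>l m. cop l m \<and> v1 * m - v2 * l \<noteq> 0 \<and> cmod (v1 * m - v2 * l) \<le> D)"
    using uniform_coprime_partner[OF n] by (elim exE)
  define C where "C = (cmod n)\<^sup>2 * (5 * (1 + cmod w)\<^sup>2)"
  define B where "B = sqrt (D\<^sup>2 * ((1 + cmod w)\<^sup>2 * C\<^sup>2 + 1))"
  have B: "B \<ge> 0" "B\<^sup>2 = D\<^sup>2 * ((1 + cmod w)\<^sup>2 * C\<^sup>2 + 1)"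
    by (simp_all add: B_def)
  show ?thesis
  proof (intro exI allI impI)
    fix z t l m assume unc: "uncovered z t" and cop: "cop l m" and one: "ht z t l m = 1"
    have t: "t > 0" using unc by (simp add: uncovered_def)
    show "cmod m \<le> max 1 (2 * B * ((1 + cmod w) * B + 1))"
    proof (cases "t \<le> 1")
      case False
      have "t\<^sup>2 * (cmod m)\<^sup>2 \<le> 1" using one unfolding ht_def by (smt (verit) zero_le_power2)
      moreover have "1 * (cmod m)\<^sup>2 \<le> t\<^sup>2 * (cmod m)\<^sup>2"
        using False by (intro mult_right_mono one_le_power) auto
      ultimately have "(cmod m)\<^sup>2 \<le> 1" by linarith
      then show ?thesis by (simp add: power_le_one_iff)
    next
      case True
      obtain v1 v2 where v: "v1 \<in> R" "v2 \<in> R" "v1 \<noteq> 0 \<or> v2 \<noteq> 0"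
        "ht z t v1 v2 \<le> 5 * (1 + cmod w)\<^sup>2 * t"
        using short_vector[OF t True, of z] by blast
      obtain k where k: "k \<noteq> 0" "k * v1 \<in> R" "k * v2 \<in> R" "cmod k \<le> cmod n"
        "\<exists>a\<in>R. \<exists>b\<in>R. a * (k * v1) + b * (k * v2) = n"
        using norm[rule_format, OF v(1-3)] by (elim exE conjE)
      have nz: "k * v1 \<noteq> 0 \<or> k * v2 \<noteq> 0" using k v by auto
      have "ht z t (k * v1) (k * v2) = (cmod k)\<^sup>2 * ht z t v1 v2" by (rule ht_scale)
      also have "\<dots> \<le> (cmod n)\<^sup>2 * (5 * (1 + cmod w)\<^sup>2 * t)"
        using k(4) v(4) by (intro mult_mono power_mono ht_nonneg) auto
      finally have short: "ht z t (k * v1) (k * v2) \<le> C * t" by (simp add: C_def mult.assoc)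
      obtain l' m' where "cop l' m'" "k * v1 * m' - k * v2 * l' \<noteq> 0" "cmod (k * v1 * m' - k * v2 * l') \<le> D"
        using D[rule_format, OF k(2,3,5)] by (elim exE conjE)
      from short_vector_bound[OF unc this(1) k(2,3) nz this(2,3) short]
      have "ht z t (k * v1) (k * v2) \<le> B\<^sup>2 * t\<^sup>2" by (simp only: B)
      from denominator_bound_aux[OF unc cop one k(2,3) nz this _ B(1)]
      show ?thesis by (simp add: ht_def)
    qed
  qed
qed

end

section \<open>Uncovered points and Swan's number\<close>

context quadratic_order begin

section \<open>The group action in terms of \<open>ht\<close>\<close>

lemma PSL2_coset_carrier:
  assumes "A \<in> carrier (SL2 S)"
  shows "{A, - A} \<in> carrier (PSL2 S)"
proof -
  have "{mat 1, - mat 1} #>\<^bsub>SL2 S\<^esub> A = {A, - A}"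
    by (auto simp: r_coset_def SL2_def minus_mat_1_mult)
  then show ?thesis
    using assms by (auto simp: PSL2_def FactGroup_def RCOSETS_def)
qed

lemma PSL2_carrier_cases:
  assumes "g \<in> carrier (PSL2 S)"
  obtains A where "A \<in> carrier (SL2 S)" "A \<in> g"
  using assms by (auto simp: PSL2_def SL2_def FactGroup_def RCOSETS_def r_coset_def minus_mat_1_mult)

lemma uncovered_iff_act:
  assumes t: "t > 0"
  shows "(\<forall>g \<in> carrier (PSL2 R). snd (act g (z, t)) \<le> t) \<longleftrightarrow> uncovered z t"
proof
  assume *: "\<forall>g \<in> carrier (PSL2 R). snd (act g (z, t)) \<le> t"
  show "uncovered z t" unfolding uncovered_def
  proof (intro conjI t allI impI)
    fix l m assume "cop l m"
    then obtain a b where ab: "l \<in> R" "m \<in> R" "a \<in> R" "b \<in> R" "a * l + b * m = 1"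
      by (auto simp: cop_def)
    \<comment> \<open>The bottom row (m, -l) makes \<open>ht z t l m\<close> the denominator of the
      action; the Bezout cofactors complete it to determinant 1.\<close>
    define A :: "complex^2^2" where "A = vector [vector [- a, - b], vector [m, - l]]"
    have A: "A $ 1 $ 1 = - a" "A $ 1 $ 2 = - b" "A $ 2 $ 1 = m" "A $ 2 $ 2 = - l"
      by (simp_all add: A_def)
    have "A \<in> carrier (SL2 R)"
      using ab by (auto simp: SL2_def forall_2 A det_2)
    then have g: "{A, - A} \<in> carrier (PSL2 R)" by (rule PSL2_coset_carrier)
    have "act {A, - A} (z, t) = mat_act A (z, t)" by (rule act_eq[OF g]) simp
    then have "t / ht z t l m \<le> t"
      using * g by (auto simp: mat_act_def Let_def A ht_def algebra_simps)
    moreover have "ht z t l m > 0" using t ab by (intro ht_pos) auto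
    ultimately show "1 \<le> ht z t l m" using t by (simp add: field_simps)
  qed
next
  assume unc: "uncovered z t"
  show "\<forall>g \<in> carrier (PSL2 R). snd (act g (z, t)) \<le> t"
  proof
    fix g assume g: "g \<in> carrier (PSL2 R)"
    then obtain A where A: "A \<in> carrier (SL2 R)" "A \<in> g" by (rule PSL2_carrier_cases)
    have "cop (- A $ 2 $ 2) (A $ 2 $ 1)"
      using A(1) unfolding cop_def
      by (intro conjI bexI[of _ "- A $ 1 $ 1"] bexI[of _ "- A $ 1 $ 2"]) (auto simp: SL2_def det_2)
    then have "1 \<le> ht z t (- A $ 2 $ 2) (A $ 2 $ 1)" using unc by (simp add: uncovered_def)
    then have "t / ht z t (- A $ 2 $ 2) (A $ 2 $ 1) \<le> t" using t by (simp add: divide_le_eq)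
    then show "snd (act g (z, t)) \<le> t"
      by (simp add: act_eq[OF g A(2)] mat_act_def Let_def ht_def algebra_simps)
  qed
qed

lemma bianchi_iff: "(z, t) \<in> bianchi_polyhedron R F \<longleftrightarrow> z \<in> closure F \<and> uncovered z t"
  using uncovered_iff_act[of t z] by (auto simp: bianchi_polyhedron_def hyp_space_def uncovered_def)

lemma hemisphere_iff:
  assumes "m \<noteq> 0"
  shows "(z, t) \<in> hemisphere l m \<longleftrightarrow> t > 0 \<and> ht z t l m = 1"
proof -
  have "dist (l / m, 0) (z, t) = 1 / cmod m \<longleftrightarrow> sqrt ((cmod (l / m - z))\<^sup>2 + t\<^sup>2) = 1 / cmod m"
    by (simp add: dist_prod_def dist_norm)
  also have "\<dots> \<longleftrightarrow> (cmod (l / m - z))\<^sup>2 + t\<^sup>2 = (1 / cmod m)\<^sup>2"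
    by (subst real_sqrt_eq_iff[symmetric]) simp
  also have "\<dots> \<longleftrightarrow> (cmod m * cmod (l / m - z))\<^sup>2 + (cmod m)\<^sup>2 * t\<^sup>2 = 1"
    using assms by (simp add: field_simps power_divide)
  also have "cmod m * cmod (l / m - z) = cmod (m * z - l)"
  proof -
    have "m * (l / m - z) = - (m * z - l)" using assms by (simp add: field_simps)
    then show ?thesis by (metis norm_mult norm_minus_cancel)
  qed
  finally show ?thesis
    by (auto simp: hemisphere_def hyp_space_def ht_def mult.commute)
qed

text \<open>\<open>Max\<close> dominates the members of a set only when the set is finite. This is
  what the denominator bound is for.\<close>

lemma finite_swan_set:
  "finite {cmod m | m. m \<in> R \<and> m \<noteq> 0 \<and> (\<exists>l\<in>R. coprime_in R l m \<and> contributes R F l m)}"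
proof -
  obtain C where C: "\<And>z t l m. uncovered z t \<Longrightarrow> cop l m \<Longrightarrow> ht z t l m = 1 \<Longrightarrow> cmod m \<le> C"
    using denominator_bound by blast
  have "cmod m \<le> C" if m: "m \<in> R" "m \<noteq> 0" "l \<in> R" "coprime_in R l m" "contributes R F l m" for l m
  proof -
    from m(5) obtain z t where "(z, t) \<in> hemisphere l m" "(z, t) \<in> bianchi_polyhedron R F"
      unfolding contributes_def by fast
    then show ?thesis
      using C[of z t l m] m cop_iff_coprime_in[of l m] hemisphere_iff[OF m(2)] bianchi_iff by blast
  qed
  then have "{cmod m | m. m \<in> R \<and> m \<noteq> 0 \<and> (\<exists>l\<in>R. coprime_in R l m \<and> contributes R F l m)}
      \<subseteq> cmod ` {m \<in> R. cmod m \<le> C}" by blast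
  then show ?thesis by (rule finite_subset) (intro finite_imageI finite_R_ball)
qed

lemma swan_number_gt:
  assumes "cop l m" "m \<noteq> 0" "contributes R F l m" "cmod m > M"
  shows "swan_number R F > M"
proof -
  have "cmod m \<le> swan_number R F"
    unfolding swan_number_def
    using assms cop_iff_coprime_in[of l m] by (intro Max_ge[OF finite_swan_set]) blast
  then show ?thesis using assms by simp
qed

text \<open>Squared height of the hemisphere above z, negative outside its disc. The floor of the
  polyhedron is the upper envelope of these functions.\<close>

definition gap :: "complex \<Rightarrow> complex \<Rightarrow> complex \<Rightarrow> real" where
  "gap l m z = (1 - (cmod (m * z - l))\<^sup>2) / (cmod m)\<^sup>2"

lemma ht_gap: "m \<noteq> 0 \<Longrightarrow> ht z t l m = 1 + (cmod m)\<^sup>2 * (t\<^sup>2 - gap l m z)"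
  by (simp add: ht_def gap_def field_simps)

lemma continuous_gap [continuous_intros]: "continuous_on A (gap l m)"
  unfolding gap_def divide_inverse by (intro continuous_intros)

lemma finite_near: "finite {(l, m). l \<in> R \<and> m \<in> R \<and> cmod m \<le> B \<and> cmod (m * z - l) \<le> C}"
proof (rule finite_subset)
  show "{(l, m). l \<in> R \<and> m \<in> R \<and> cmod m \<le> B \<and> cmod (m * z - l) \<le> C} \<subseteq>
     {l \<in> R. cmod l \<le> B * cmod z + C} \<times> {m \<in> R. cmod m \<le> B}"
  proof clarsimp
    fix l m assume *: "cmod m \<le> B" "cmod (m * z - l) \<le> C"
    have "cmod l \<le> cmod (m * z) + cmod (m * z - l)" by (metis norm_triangle_sub norm_minus_commute)
    also have "cmod (m * z) \<le> B * cmod z" unfolding norm_mult using * by (intro mult_right_mono) auto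
    finally show "cmod l \<le> B * cmod z + C" using * by simp
  qed
qed (intro finite_cartesian_product finite_R_ball)

text \<open>Pairs with \<open>cmod (m * z0 - l) > 3\<close> satisfy the conclusion near \<open>z0\<close>; the others are finitely many.\<close>

lemma eventually_coprime_pairs:
  assumes lim: "(f \<longlongrightarrow> z0) G"
    and ev: "\<And>l m. cop l m \<Longrightarrow> m \<noteq> 0 \<Longrightarrow> cmod m \<le> M \<Longrightarrow> eventually (\<lambda>x. cmod (m * f x - l) > 1) G"
  shows "eventually (\<lambda>x. \<forall>l m. cop l m \<longrightarrow> m \<noteq> 0 \<longrightarrow> cmod m \<le> M \<longrightarrow> cmod (m * f x - l) > 1) G"
proof -
  define S where "S = {(l, m). l \<in> R \<and> m \<in> R \<and> cmod m \<le> M \<and> cmod (m * z0 - l) \<le> 3}"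
  define S' where "S' = {(l, m) \<in> S. cop l m \<and> m \<noteq> 0 \<and> cmod m \<le> M}"
  have "finite S'" by (rule finite_subset[OF _ finite_near]) (auto simp: S'_def S_def)
  then have "eventually (\<lambda>x. \<forall>(l, m)\<in>S'. cmod (m * f x - l) > 1) G"
    by (intro eventually_ball_finite) (auto simp: S'_def intro: ev)
  moreover have "eventually (\<lambda>x. dist (f x) z0 < 1 / (\<bar>M\<bar> + 1)) G"
    using lim by (intro tendstoD) auto
  ultimately show ?thesis
  proof eventually_elim
    case (elim x)
    show ?case
    proof (intro allI impI)
      fix l m assume lm: "cop l m" "m \<noteq> 0" "cmod m \<le> M"
      show "cmod (m * f x - l) > 1"
      proof (cases "(l, m) \<in> S'")
        case False
        then have "cmod (m * z0 - l) > 3" using lm by (auto simp: S'_def S_def cop_def)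
        moreover have "cmod (m * f x - m * z0) \<le> 1"
        proof -
          have "cmod (m * f x - m * z0) = cmod m * dist (f x) z0"
            by (simp add: dist_norm norm_mult[symmetric] right_diff_distrib)
          also have "\<dots> \<le> (\<bar>M\<bar> + 1) * (1 / (\<bar>M\<bar> + 1))"
            using lm elim by (intro mult_mono) auto
          also have "\<dots> = 1" by (simp add: abs_add_one_gt_zero less_imp_neq[symmetric])
          finally show ?thesis .
        qed
        moreover have "cmod (m * z0 - l) \<le> cmod (m * f x - l) + cmod (m * f x - m * z0)"
          by (metis norm_triangle_ineq4 diff_diff_eq2 add_diff_cancel_left' add.commute diff_add_cancel)
        ultimately show ?thesis by linarith
      qed (use elim in auto)
    qed
  qed
qed

text \<open>Baire's theorem for finitely many sets. It will single out one hemisphere that is on top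
  over a whole open set.\<close>

lemma finite_closed_cover_interior:
  assumes "finite I" "open W" "W \<noteq> {}" "W \<subseteq> (\<Union>i\<in>I. C i)" "\<And>i. i \<in> I \<Longrightarrow> closed (C i)"
  shows "\<exists>i\<in>I. \<exists>V. open V \<and> V \<noteq> {} \<and> V \<subseteq> W \<and> V \<subseteq> C i"
  using assms
proof (induction I arbitrary: W rule: finite_induct)
  case (insert i I)
  show ?case
  proof (cases "W \<subseteq> C i")
    case False
    have "open (W - C i)" using insert.prems by (intro open_Diff) auto
    then have "\<exists>j\<in>I. \<exists>V. open V \<and> V \<noteq> {} \<and> V \<subseteq> W - C i \<and> V \<subseteq> C j"
      using insert.prems False by (intro insert.IH) auto
    then show ?thesis by blast
  qed (use insert.prems in blast)
qed auto

end

section \<open>Signed areas, lattice coordinates, and the criterion for a large Swan number\<close>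

definition cross :: "complex \<Rightarrow> complex \<Rightarrow> real" where
  "cross x y = Im (cnj x * y)"

lemma cross_int_comb:
  "cross (of_int a * x + of_int b * y) (of_int c * x + of_int d * y) = of_int (a * d - b * c) * cross x y"
  by (simp add: cross_def algebra_simps)

lemma cross_coords:
  assumes "cross x y \<noteq> 0"
  shows "z = of_real (cross z y / cross x y) * x + of_real (cross x z / cross x y) * y"
proof -
  have "of_real (cross x y) * z = of_real (cross z y) * x + of_real (cross x z) * y"
    by (simp add: cross_def complex_eq_iff algebra_simps)
  then show ?thesis using assms by (simp add: field_simps)
qed

context quadratic_order begin

lemma int_basis_cross:
  assumes "int_basis R w1 w2"
  shows "cross w1 w2 \<noteq> 0"
proof -
  have R: "R = range (\<lambda>(m::int, n::int). of_int m * w1 + of_int n * w2)"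
    using assms by (simp add: int_basis_def bij_betw_def)
  have "1 \<in> R" "w \<in> R" by auto
  then obtain a b c d where "1 = of_int a * w1 + of_int b * w2" "w = of_int c * w1 + of_int d * w2"
    unfolding R by auto
  then have "cross 1 w = of_int (a * d - b * c) * cross w1 w2"
    by (metis cross_int_comb)
  moreover have "cross 1 w \<noteq> 0" using Im_w by (simp add: cross_def)
  ultimately show ?thesis by auto
qed

text \<open>A hemisphere whose gap is maximal over an open part of W contributes. Its gap is
  positive there, whereas every pair with \<open>cmod m \<le> M\<close> has negative gap on
  W.\<close>

lemma exists_contributing:
  assumes W: "open W" "W \<noteq> {}" "W \<subseteq> closure F"
    and unc: "\<And>z l m. z \<in> W \<Longrightarrow> cop l m \<Longrightarrow> m \<noteq> 0 \<Longrightarrow> cmod m \<le> M \<Longrightarrow> cmod (m * z - l) > 1"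
  shows "swan_number R F > M"
proof -
  obtain z3 e where z3: "e > 0" "ball z3 e \<subseteq> W" using W by (metis all_not_in_conv openE)
  \<comment> \<open>A coprime fraction with denominator \<open>2 ^ k\<close> inside W provides a
    hemisphere over it, hence a positive lower bound for the floor nearby.\<close>
  obtain k where k: "2 * (1 + cmod w) / e < 2 ^ k"
    using real_arch_pow[of 2] by auto
  obtain \<beta> where \<beta>: "\<beta> \<in> R" "cmod ((2 ^ k * z3 - 1) / 2 - \<beta>) \<le> 1 + cmod w"
    using R_approx by blast
  define l1 m1 where "l1 = 1 + 2 * \<beta>" and "m1 = (2 ^ k :: complex)"
  define z4 where "z4 = l1 / m1"
  have m1: "m1 \<noteq> 0" "cmod m1 = 2 ^ k" by (auto simp: m1_def norm_power)
  have cop1: "cop l1 m1" unfolding l1_def m1_def using \<beta>(1) by (rule cop_power_2)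
  have "cmod (2 ^ k * z3 - l1) = 2 * cmod ((2 ^ k * z3 - 1) / 2 - \<beta>)"
  proof -
    have "2 ^ k * z3 - l1 = 2 * ((2 ^ k * z3 - 1) / 2 - \<beta>)" by (simp add: l1_def field_simps)
    then show ?thesis by (simp only: norm_mult norm_numeral)
  qed
  also have "\<dots> < e * 2 ^ k" using \<beta>(2) k z3(1) by (simp add: field_simps)
  finally have "cmod (m1 * (z3 - z4)) < e * 2 ^ k"
    using m1 by (simp add: right_diff_distrib z4_def) (simp add: m1_def)
  then have "dist z3 z4 < e" by (simp add: norm_mult m1 dist_norm)
  then have z4W: "z4 \<in> W" using z3 by auto
  define H where "H = 1 / (cmod m1)\<^sup>2"
  have H: "H > 0" using m1 by (simp add: H_def)
  have gap1: "gap l1 m1 z4 = H" using m1 by (simp add: gap_def z4_def H_def)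
  \<comment> \<open>On \<open>W3\<close> the floor lies above \<open>H / 2\<close>. Pairs reaching
    that height have bounded denominator and bounded distance from \<open>z4\<close>, so only the
    finite set \<open>T\<close> competes.\<close>
  define W3 where "W3 = {z. gap l1 m1 z > H / 2} \<inter> W \<inter> ball z4 1"
  have W3: "open W3" "z4 \<in> W3"
    unfolding W3_def using W(1) z4W gap1 H
    by (auto intro!: open_Int open_Collect_less continuous_intros)
  define B where "B = sqrt (2 / H)"
  have bound: "cmod m \<le> B \<and> cmod (m * z4 - l) \<le> B + 1"
    if "z \<in> W3" "m \<noteq> 0" "gap l m z > H / 2" for z l m
  proof -
    have 1: "H / 2 * (cmod m)\<^sup>2 < 1 - (cmod (m * z - l))\<^sup>2"
      using that by (simp add: gap_def field_simps)
    then have "(cmod m)\<^sup>2 \<le> 2 / H" using H by (simp add: field_simps) (smt (verit) zero_le_power2)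
    then have mB: "cmod m \<le> B" unfolding B_def by (rule real_le_rsqrt)
    have "(cmod (m * z - l))\<^sup>2 \<le> 1" using 1 H by (smt (verit) mult_nonneg_nonneg zero_le_power2 half_gt_zero)
    then have "cmod (m * z - l) \<le> 1" by (simp add: power_le_one_iff)
    moreover have "cmod (m * z4 - m * z) \<le> B * 1"
      using that(1) mB unfolding right_diff_distrib[symmetric] norm_mult
      by (intro mult_mono) (auto simp: W3_def dist_norm intro: order_trans[OF norm_ge_zero])
    moreover have "m * z4 - l = (m * z4 - m * z) + (m * z - l)" by simp
    ultimately show ?thesis using mB by (metis add_mono mult.right_neutral norm_triangle_le)
  qed
  define T where "T = {(l, m). cop l m \<and> m \<noteq> 0 \<and> cmod m \<le> B \<and> cmod (m * z4 - l) \<le> B + 1}"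
  have finT: "finite T"
    by (rule finite_subset[OF _ finite_near[of B z4 "B + 1"]]) (auto simp: T_def cop_def)
  have T1: "(l1, m1) \<in> T" using bound[OF W3(2), of m1 l1] cop1 m1 gap1 H by (auto simp: T_def)
  define g where "g = (\<lambda>i z. gap (fst i) (snd i) z)"
  define C where "C = (\<lambda>i. {z. \<forall>j\<in>T. g j z \<le> g i z})"
  have "closed (C i)" for i
  proof -
    have "C i = (\<Inter>j\<in>T. {z. g j z \<le> g i z})" by (auto simp: C_def)
    then show ?thesis
      unfolding g_def by (auto intro!: closed_INT closed_Collect_le continuous_intros)
  qed
  moreover have "W3 \<subseteq> (\<Union>i\<in>T. C i)"
  proof
    fix z
    have "finite ((\<lambda>i. g i z) ` T)" "(\<lambda>i. g i z) ` T \<noteq> {}" using finT T1 by auto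
    from Max_in[OF this] obtain i where i: "i \<in> T" "g i z = Max ((\<lambda>i. g i z) ` T)" by auto
    then have "z \<in> C i" unfolding C_def using finT by auto
    with i show "z \<in> (\<Union>i\<in>T. C i)" by auto
  qed
  ultimately have "\<exists>i\<in>T. \<exists>V. open V \<and> V \<noteq> {} \<and> V \<subseteq> W3 \<and> V \<subseteq> C i"
    using W3 finT by (intro finite_closed_cover_interior) auto
  then obtain i V where iV: "i \<in> T" "open V" "V \<noteq> {}" "V \<subseteq> W3" "V \<subseteq> C i" by blast
  obtain l m where i: "i = (l, m)" by force
  have lm: "cop l m" "m \<noteq> 0" using iV(1) by (auto simp: T_def i)
  have VW: "V \<subseteq> W" using iV(4) by (auto simp: W3_def)
  have big: "gap l m z > H / 2" if "z \<in> V" for z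
  proof -
    have "gap l1 m1 z \<le> gap l m z" using that iV(5) T1 by (force simp: C_def g_def i)
    then show ?thesis using that iV(4) by (force simp: W3_def)
  qed
  have max: "gap l' m' z \<le> gap l m z" if "z \<in> V" "cop l' m'" "m' \<noteq> 0" for z l' m'
  proof (cases "gap l' m' z > H / 2")
    case True
    then have "(l', m') \<in> T" using bound[of z m' l'] that iV(4) by (auto simp: T_def)
    then show ?thesis using that iV(5) by (force simp: C_def g_def i)
  qed (use big[OF that(1)] in linarith)
  have unc_V: "uncovered z t" if z: "z \<in> V" "t > 0" "t\<^sup>2 = gap l m z" for z t
    unfolding uncovered_def
  proof (intro conjI allI impI z)
    fix l' m' assume c: "cop l' m'"
    show "1 \<le> ht z t l' m'"
    proof (cases "m' = 0")
      case True
      then have "l' \<in> R" "l' \<noteq> 0" using c by (auto simp: cop_def)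
      then have "cmod l' \<ge> 1" by (rule norm_ge_1)
      then show ?thesis using True by (simp add: ht_def one_le_power)
    next
      case False
      then show ?thesis using max[OF z(1) c False] z(3) by (simp add: ht_gap)
    qed
  qed
  have "contributes R F l m"
    unfolding contributes_def
  proof (intro exI conjI)
    show "openin (top_of_set (hemisphere l m)) (hemisphere l m \<inter> (V \<times> UNIV))"
      using iV(2) by (intro openin_open_Int open_Times) auto
    obtain z where z: "z \<in> V" using iV(3) by blast
    have g0: "gap l m z > 0" using big[OF z] H by linarith
    then have "(z, sqrt (gap l m z)) \<in> hemisphere l m"
      using lm(2) by (simp add: hemisphere_iff ht_gap)
    then show "hemisphere l m \<inter> (V \<times> UNIV) \<noteq> {}" using z by blast
    show "hemisphere l m \<inter> (V \<times> UNIV) \<subseteq> hemisphere l m \<inter> bianchi_polyhedron R F"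
    proof clarsimp
      fix z t assume zt: "(z, t) \<in> hemisphere l m" "z \<in> V"
      then have "t > 0" "ht z t l m = 1" using lm(2) by (auto simp: hemisphere_iff)
      then have "t\<^sup>2 = gap l m z" using lm(2) by (simp add: ht_gap)
      then show "(z, t) \<in> bianchi_polyhedron R F"
        using unc_V zt(2) \<open>t > 0\<close> VW W(3) by (auto simp: bianchi_iff)
    qed
  qed
  moreover have "cmod m > M"
  proof (rule ccontr)
    assume "\<not> cmod m > M"
    obtain z where z: "z \<in> V" using iV(3) by blast
    have "cmod (m * z - l) > 1" using unc[of z l m] z VW lm \<open>\<not> cmod m > M\<close> by auto
    then have "1 - (cmod (m * z - l))\<^sup>2 < 0" by (simp add: one_less_power)
    then have "gap l m z < 0" using lm(2) by (simp add: gap_def divide_neg_pos)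
    with big[OF z] H show False by linarith
  qed
  ultimately show ?thesis using lm by (intro swan_number_gt)
qed

lemma swan_number_gt_strict:
  assumes F: "fundamental_parallelogram R F"
    and unc: "\<And>l m. cop l m \<Longrightarrow> m \<noteq> 0 \<Longrightarrow> cmod m \<le> M \<Longrightarrow> cmod (m * z1 - l) > 1"
  shows "swan_number R F > M"
proof -
  obtain z0 w1 w2 where basis: "int_basis R w1 w2" and
    F_eq: "F = {z0 + of_real r * w1 + of_real s * w2 | r s. 0 \<le> r \<and> r < 1 \<and> 0 \<le> s \<and> s < 1}"
    using F by (auto simp: fundamental_parallelogram_def)
  have cr: "cross w1 w2 \<noteq> 0" using basis by (rule int_basis_cross)
  define c1 c2 where "c1 = (\<lambda>z. cross (z - z0) w2 / cross w1 w2)" and "c2 = (\<lambda>z. cross w1 (z - z0) / cross w1 w2)"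
  have coords: "z = z0 + of_real (c1 z) * w1 + of_real (c2 z) * w2" for z
    using cross_coords[OF cr, of "z - z0"] by (simp add: c1_def c2_def algebra_simps)
  have cont: "continuous_on UNIV c1" "continuous_on UNIV c2"
    unfolding c1_def c2_def cross_def divide_inverse by (intro continuous_intros)+
  have eval: "c1 (z0 + of_real r * w1 + of_real s * w2) = r" "c2 (z0 + of_real r * w1 + of_real s * w2) = s" for r s
  proof -
    have "cross (of_real r * w1 + of_real s * w2) w2 = r * cross w1 w2"
      "cross w1 (of_real r * w1 + of_real s * w2) = s * cross w1 w2"
      by (simp_all add: cross_def algebra_simps)
    then show "c1 (z0 + of_real r * w1 + of_real s * w2) = r" "c2 (z0 + of_real r * w1 + of_real s * w2) = s"
      using cr by (simp_all add: c1_def c2_def add.assoc)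
  qed
  define \<tau> where "\<tau> = of_int (- \<lfloor>c1 z1\<rfloor>) * w1 + of_int (- \<lfloor>c2 z1\<rfloor>) * w2"
  have "R = range (\<lambda>(m::int, n::int). of_int m * w1 + of_int n * w2)"
    using basis by (simp add: int_basis_def bij_betw_def)
  then have "\<tau> \<in> R"
    unfolding \<tau>_def by (auto intro!: image_eqI[of _ _ "(- \<lfloor>c1 z1\<rfloor>, - \<lfloor>c2 z1\<rfloor>)"])
  define z2 where "z2 = z1 + \<tau>"
  have z2: "z2 = z0 + of_real (frac (c1 z1)) * w1 + of_real (frac (c2 z1)) * w2"
  proof -
    have "z1 + \<tau> = (z0 + of_real (c1 z1) * w1 + of_real (c2 z1) * w2) + \<tau>"
      using arg_cong[OF coords[of z1], of "\<lambda>z. z + \<tau>"] .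
    then show ?thesis unfolding z2_def \<tau>_def frac_def by (simp add: algebra_simps)
  qed
  have unc2: "cmod (m * z2 - l) > 1" if "cop l m" "m \<noteq> 0" "cmod m \<le> M" for l m
  proof -
    have eq: "m * z2 - l = m * z1 - (l - m * \<tau>)" by (simp add: z2_def algebra_simps)
    show ?thesis unfolding eq using unc[OF cop_shift[OF that(1) \<open>\<tau> \<in> R\<close>] that(2,3)] .
  qed
  have "eventually (\<lambda>z. \<forall>l m. cop l m \<longrightarrow> m \<noteq> 0 \<longrightarrow> cmod m \<le> M \<longrightarrow> cmod (m * z - l) > 1) (nhds z2)"
  proof (rule eventually_coprime_pairs)
    show "((\<lambda>z. z) \<longlongrightarrow> z2) (nhds z2)" by (rule filterlim_ident)
    fix l m assume "cop l m" "m \<noteq> 0" "cmod m \<le> M"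
    then have "1 < cmod (m * z2 - l)" by (rule unc2)
    moreover have "((\<lambda>z. cmod (m * z - l)) \<longlongrightarrow> cmod (m * z2 - l)) (nhds z2)"
      by (intro tendsto_intros filterlim_ident)
    ultimately show "eventually (\<lambda>z. cmod (m * z - l) > 1) (nhds z2)"
      by (auto dest: order_tendstoD(1))
  qed
  then obtain N where N: "open N" "z2 \<in> N"
    "\<And>z l m. z \<in> N \<Longrightarrow> cop l m \<Longrightarrow> m \<noteq> 0 \<Longrightarrow> cmod m \<le> M \<Longrightarrow> cmod (m * z - l) > 1"
    unfolding eventually_nhds by blast
  define W where "W = N \<inter> ({z. 0 < c1 z} \<inter> {z. c1 z < 1} \<inter> {z. 0 < c2 z} \<inter> {z. c2 z < 1})"
  have "open W" unfolding W_def using N(1) cont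
    by (intro open_Int open_Collect_less continuous_intros) auto
  moreover have "W \<noteq> {}"
  proof -
    \<comment> \<open>\<open>z2\<close> may lie on an edge of the parallelogram, so it is moved
      slightly towards the centre, where both coordinates are 1/2.\<close>
    define h where "h = (\<lambda>\<eta>::real. z0 + of_real (frac (c1 z1) + \<eta> * (1/2 - frac (c1 z1))) * w1 + of_real (frac (c2 z1) + \<eta> * (1/2 - frac (c2 z1))) * w2)"
    have "(h \<longlongrightarrow> h 0) (at_right 0)" unfolding h_def by (intro tendsto_eq_intros) auto
    then have "eventually (\<lambda>\<eta>. h \<eta> \<in> N) (at_right 0)"
      using N(1,2) by (intro topological_tendstoD) (auto simp: h_def z2)
    moreover have "eventually (\<lambda>\<eta>::real. 0 < \<eta> \<and> \<eta> < 1) (at_right 0)"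
      using eventually_at_right_less[of "0::real"] eventually_at_right[of 0 1] by (auto simp: eventually_at_right_field intro: exI[of _ 1])
    ultimately have "eventually (\<lambda>\<eta>. h \<eta> \<in> N \<and> 0 < \<eta> \<and> \<eta> < 1) (at_right 0)"
      by eventually_elim auto
    then obtain \<eta> where \<eta>: "h \<eta> \<in> N" "0 < \<eta>" "\<eta> < 1"
      using eventually_happens'[OF trivial_limit_at_right_real] by blast
    have in01: "0 < r + \<eta> * (1/2 - r) \<and> r + \<eta> * (1/2 - r) < 1" if "0 \<le> r" "r < 1" for r :: real
    proof -
      have "r + \<eta> * (1/2 - r) = (1 - \<eta>) * r + \<eta> / 2" by (simp add: algebra_simps)
      moreover have "0 \<le> (1 - \<eta>) * r" "(1 - \<eta>) * r \<le> 1 - \<eta>"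
        using \<eta> that mult_left_mono[of r 1 "1 - \<eta>"] by auto
      moreover have "0 < \<eta> / 2" "1 - \<eta> + \<eta> / 2 < 1" using \<eta> by auto
      ultimately have "0 < r + \<eta> * (1/2 - r)" "r + \<eta> * (1/2 - r) < 1"
        by simp_all
      then show ?thesis by blast
    qed
    have "c1 (h \<eta>) = frac (c1 z1) + \<eta> * (1/2 - frac (c1 z1))"
      "c2 (h \<eta>) = frac (c2 z1) + \<eta> * (1/2 - frac (c2 z1))"
      unfolding h_def by (rule eval)+
    then have "h \<eta> \<in> W" unfolding W_def using \<eta>(1)
      by (simp add: in01 frac_ge_0 frac_lt_1)
    then show ?thesis by blast
  qed
  moreover have "W \<subseteq> closure F"
  proof
    fix z assume "z \<in> W"
    then have "z \<in> F" unfolding F_eq using coords[of z] by (force simp: W_def)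
    then show "z \<in> closure F" using closure_subset by blast
  qed
  moreover have "cmod (m * z - l) > 1" if "z \<in> W" "cop l m" "m \<noteq> 0" "cmod m \<le> M" for z l m
    using that N(3) by (auto simp: W_def)
  ultimately show ?thesis by (rule exists_contributing)
qed

text \<open>
  Hemispheres whose boundary circle passes through \<open>z0\<close> are harmless as long as they are tangent
  there to the horizontal direction: a small horizontal shift of \<open>z0\<close> leaves them.
\<close>

lemma swan_number_gt_tangent:
  assumes F: "fundamental_parallelogram R F"
    and ge: "\<And>l m. cop l m \<Longrightarrow> m \<noteq> 0 \<Longrightarrow> cmod m \<le> M \<Longrightarrow>
      cmod (m * z0 - l) > 1 \<or> cmod (m * z0 - l) = 1 \<and> Re ((m * z0 - l) * cnj m) = 0"
  shows "swan_number R F > M"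
proof -
  have "eventually (\<lambda>x. \<forall>l m. cop l m \<longrightarrow> m \<noteq> 0 \<longrightarrow> cmod m \<le> M \<longrightarrow> cmod (m * (z0 + of_real x) - l) > 1) (at_right 0)"
  proof (rule eventually_coprime_pairs)
    show lim: "((\<lambda>x. z0 + complex_of_real x) \<longlongrightarrow> z0) (at_right 0)"
      by (intro tendsto_eq_intros) auto
    fix l m assume lm: "cop l m" "m \<noteq> 0" "cmod m \<le> M"
    show "eventually (\<lambda>x. cmod (m * (z0 + of_real x) - l) > 1) (at_right 0)"
    proof (cases "cmod (m * z0 - l) > 1")
      case True
      have "((\<lambda>x. cmod (m * (z0 + complex_of_real x) - l)) \<longlongrightarrow> cmod (m * z0 - l)) (at_right 0)"
        by (intro tendsto_intros lim)
      then show ?thesis using True by (auto dest: order_tendstoD(1))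
    next
      case False
      then have eq: "cmod (m * z0 - l) = 1" "Re ((m * z0 - l) * cnj m) = 0" using ge[OF lm] by auto
      have "cmod (m * (z0 + of_real x) - l) > 1" if "x > 0" for x
      proof -
        \<comment> \<open>Tangency removes the linear term; the quadratic term is positive.\<close>
        have "(cmod (m * (z0 + of_real x) - l))\<^sup>2 =
              (cmod (m * z0 - l))\<^sup>2 + 2 * x * Re ((m * z0 - l) * cnj m) + x\<^sup>2 * (cmod m)\<^sup>2"
          unfolding cmod_power2 by (simp add: power2_eq_square algebra_simps)
        also have "\<dots> > 1" using eq lm(2) that by simp
        finally show ?thesis by (smt (verit) power_le_one norm_ge_zero)
      qed
      then show ?thesis by (auto simp: eventually_at_right_field intro: exI[of _ 1])
    qed
  qed
  then obtain x where "\<forall>l m. cop l m \<longrightarrow> m \<noteq> 0 \<longrightarrow> cmod m \<le> M \<longrightarrow> cmod (m * (z0 + complex_of_real x) - l) > 1"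
    using eventually_happens'[OF trivial_limit_at_right_real] by blast
  then show ?thesis by (intro swan_number_gt_strict[OF F]) blast
qed

end

section \<open>Points that are not covered by small denominators\<close>

text \<open>
  In the next three lemmas \<open>A\<close> and \<open>B\<close> are the coordinates of \<open>\<mu> z\<^sub>0 - \<lambda>\<close>. Here \<open>\<Delta> = - p q\<close>,
  \<open>2 \<mu> = x + y \<surd>\<Delta>\<close>, \<open>2 \<lambda> = u + v \<surd>\<Delta>\<close>, \<open>z\<^sub>0 = (m / q) \<surd>\<Delta>\<close> and \<open>2 (\<mu> z\<^sub>0 - \<lambda>) = - B + (A / q) \<surd>\<Delta>\<close>.
\<close>

lemma odd_discriminant_core:
  fixes p q m k x y u v :: int
  assumes p: "prime p" "odd p" and "odd q" "q > 12 * p" and m: "p * m = k * q + 2"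
    and par: "even (x - y)" "even (u - v)"
    and cop: "\<not> (p dvd x \<and> p dvd u)" and small: "16 * (x\<^sup>2 + p * q * y\<^sup>2) \<le> q\<^sup>2"
  defines "A \<equiv> m * x - q * v" and "B \<equiv> m * p * y + u"
  shows "p * A\<^sup>2 + q * B\<^sup>2 > 4 * q \<or> (x = 0 \<and> A = 0 \<and> B\<^sup>2 = 4)"
proof -
  \<comment> \<open>At the cusp s = k \<surd>\<Delta> / p the coefficient of \<surd>\<Delta> in 2
    (\<mu> s - \<lambda>) is j / p. The shift to the actual point contributes the term 2 x in
    \<open>pA\<close>.\<close>
  define j where "j = k * x - p * v"
  have p0: "p > 0" using p by (simp add: prime_gt_0_int)
  have q0: "q > 0" using assms p0 by linarith
  have "p * A = (p * m) * x - p * q * v" by (simp add: A_def algebra_simps)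
  also have "\<dots> = q * j + 2 * x" unfolding m by (simp add: j_def algebra_simps)
  finally have pA: "p * A = q * j + 2 * x" .
  have B': "B = (k * q + 2) * y + u" unfolding m[symmetric] B_def by (simp add: mult.commute)
  have pq0: "p * q * y\<^sup>2 \<ge> 0" using p0 q0 by simp
  have "(4 * x)\<^sup>2 \<le> q\<^sup>2" using small pq0 by (simp add: power_mult_distrib)
  then have xq: "4 * \<bar>x\<bar> \<le> q"
    using q0 abs_le_square_iff[of "4 * x" q] by (simp add: abs_mult)
  have suff: "p * A\<^sup>2 > c * q" if "c * (p * q) < (p * A)\<^sup>2" for c
  proof -
    have "p * (c * q) < p * (p * A\<^sup>2)" using that by (simp add: power2_eq_square algebra_simps)
    then show ?thesis using p0 by simp
  qed
  show ?thesis
  proof (cases "j = 0")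
    case True
    then have kx: "k * x = p * v" by (simp add: j_def)
    have "\<not> p dvd k"
    proof
      assume "p dvd k"
      then have "p dvd p * m - k * q" by simp
      then have "p dvd 2" using m by simp
      then have "p \<le> 2" by (rule zdvd_imp_le) simp
      then show False using p prime_ge_2_int[of p] by auto
    qed
    then have px: "p dvd x" using kx p(1) by (metis dvd_triv_left prime_dvd_multD)
    \<comment> \<open>As p and q are odd, k q y, k y, k x = p v, v and u all have the same
      parity.\<close>
    have "even B"
      using par p(2) \<open>odd q\<close> arg_cong[OF kx, of even] unfolding B' by auto
    moreover have "B \<noteq> 0"
    proof
      assume "B = 0"
      then have "u = p * (- m * y)" by (simp add: B_def algebra_simps)
      then show False using cop px by simp
    qed
    ultimately have "\<bar>B\<bar> \<ge> 2" by presburger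
    then have B2: "B\<^sup>2 \<ge> 4" using abs_le_square_iff[of 2 B] by simp
    then have qB: "q * B\<^sup>2 \<ge> q * 4" using q0 by (intro mult_left_mono) auto
    show ?thesis
    proof (cases "A = 0")
      case True
      then have "x = 0" using pA \<open>j = 0\<close> by simp
      moreover have "q * B\<^sup>2 > q * 4" if "B\<^sup>2 \<noteq> 4" using B2 that q0 by simp
      ultimately show ?thesis using True by auto
    next
      case False
      then have "p * A\<^sup>2 > 0" using p0 by simp
      then show ?thesis using qB by linarith
    qed
  next
    case False
    have low: "\<bar>p * A\<bar> \<ge> q * \<bar>j\<bar> - 2 * \<bar>x\<bar>"
      unfolding pA using q0 abs_triangle_ineq2_sym[of "q * j" "- 2 * x"] by (simp add: abs_mult)
    have "q * 1 \<le> q * \<bar>j\<bar>" using q0 False by (intro mult_left_mono) auto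
    then have low1: "\<bar>p * A\<bar> \<ge> q - 2 * \<bar>x\<bar>" using low by linarith
    have sq: "(p * A)\<^sup>2 \<ge> c\<^sup>2" if "\<bar>p * A\<bar> \<ge> c" "c \<ge> 0" for c
      using that abs_le_square_iff[of c "p * A"] by simp
    have q12: "q * q > 12 * (p * q)" using assms(4) q0 by (simp add: mult_strict_right_mono mult.assoc[symmetric])
    show ?thesis
    proof (cases "B = 0")
      case False
      then have "B\<^sup>2 > 0" by simp
      then have "B\<^sup>2 \<ge> 1" by linarith
      then have "q * B\<^sup>2 \<ge> q * 1" using q0 by (intro mult_left_mono) auto
      \<comment> \<open>From |p A| \<ge> q / 2 follows (p A)^2 \<ge> q^2 / 4 > 3 p q, the point
        where the factor 12 is spent; the fourth q comes from B^2 \<ge> 1.\<close>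
      moreover have "p * A\<^sup>2 > 3 * q"
      proof (rule suff)
        have "2 * \<bar>p * A\<bar> \<ge> q" using low1 xq by linarith
        then have "q\<^sup>2 \<le> (2 * (p * A))\<^sup>2" using q0 abs_le_square_iff[of q "2 * (p * A)"] by (simp add: abs_mult)
        then show "3 * (p * q) < (p * A)\<^sup>2" using q12 by (simp add: power2_eq_square)
      qed
      ultimately show ?thesis by linarith
    next
      case True
      have "p * A\<^sup>2 > 4 * q"
      proof (rule suff, cases "y = 0")
        case y: True
        then have u: "u = 0" using \<open>B = 0\<close> by (simp add: B_def)
        \<comment> \<open>With y = u = 0 the parity conditions make x and v even.\<close>
        then have "even j" using par y by (auto simp: j_def)
        then have "\<bar>j\<bar> \<ge> 2" using \<open>j \<noteq> 0\<close> by presburger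
        then have "q * 2 \<le> q * \<bar>j\<bar>" using q0 by (intro mult_left_mono) auto
        then have "\<bar>p * A\<bar> \<ge> q" using low xq by linarith
        then have "q\<^sup>2 \<le> (p * A)\<^sup>2" using q0 by (intro sq) auto
        then show "4 * (p * q) < (p * A)\<^sup>2" using q12 p0 q0 by (smt (verit) power2_eq_square mult_pos_pos)
      next
        case y: False
        define X where "X = 2 * \<bar>x\<bar>"
        have "y\<^sup>2 \<ge> 1" using y by (smt (verit) zero_less_power2)
        then have "p * q * 1 \<le> p * q * y\<^sup>2" using p0 q0 by (intro mult_left_mono) auto
        then have 1: "4 * X\<^sup>2 + 16 * (p * q) \<le> q\<^sup>2" using small by (simp add: X_def power_mult_distrib)
        \<comment> \<open>Since y is nonzero, \<open>small\<close> gives q^2 - 4 X^2 \<ge> 16 p q;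
          completing the square shows that 4 (q - X)^2 is larger still.\<close>
        have "4 * (q - X)\<^sup>2 - (q\<^sup>2 - 4 * X\<^sup>2) = 2 * (2 * X - q)\<^sup>2 + q\<^sup>2"
          by (simp add: power2_eq_square algebra_simps)
        moreover have "q\<^sup>2 > 0" "(2 * X - q)\<^sup>2 \<ge> 0" using q0 by auto
        ultimately have "4 * (p * q) < (q - X)\<^sup>2" using 1 by linarith
        also have "\<dots> \<le> (p * A)\<^sup>2" using low1 xq by (intro sq) (auto simp: X_def)
        finally show "4 * (p * q) < (p * A)\<^sup>2" .
      qed
      then show ?thesis using q0 by (smt (verit) zero_le_power2 mult_nonneg_nonneg)
    qed
  qed
qed

text \<open>
  Now \<open>\<mu> = x + y r\<close> and \<open>\<lambda> = u + v r\<close> with \<open>r = \<surd>-d\<close>. Here \<open>d = 2 h\<close>, \<open>z\<^sub>0 = (1 / 2 + 1 / d) r\<close> and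
  \<open>\<mu> z\<^sub>0 - \<lambda> = - B + (A / d) r\<close>.
\<close>

lemma even_discriminant_core:
  fixes h x y u v :: int
  assumes h: "odd h" "h \<ge> 7"
    and cop: "\<not> (even x \<and> even u)" and small: "4 * x\<^sup>2 + 8 * h * y\<^sup>2 \<le> h\<^sup>2"
  defines "A \<equiv> (h + 1) * x - 2 * h * v" and "B \<equiv> (h + 1) * y + u"
  shows "A\<^sup>2 + 2 * h * B\<^sup>2 > 2 * h \<or> (x = 0 \<and> A = 0 \<and> B\<^sup>2 = 1)"
proof -
  \<comment> \<open>s / 2 is the coefficient of r in \<mu> z - \<lambda> at the nearby point z = r /
    2, which belongs to the prime (2, r).\<close>
  define s where "s = x - 2 * v"
  have A: "A = h * s + x" by (simp add: A_def s_def algebra_simps)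
  have "8 * h * y\<^sup>2 \<ge> 0" using h by simp
  then have "(2 * x)\<^sup>2 \<le> h\<^sup>2" using small by (simp add: power_mult_distrib)
  then have xh: "2 * \<bar>x\<bar> \<le> h"
    using h abs_le_square_iff[of "2 * x" h] by (simp add: abs_mult)
  have low: "\<bar>A\<bar> \<ge> h * \<bar>s\<bar> - \<bar>x\<bar>"
    unfolding A using h abs_triangle_ineq2_sym[of "h * s" "- x"] by (simp add: abs_mult)
  have sq: "A\<^sup>2 \<ge> c\<^sup>2" if "\<bar>A\<bar> \<ge> c" "c \<ge> 0" for c
    using that abs_le_square_iff[of c A] by simp
  have hB: "2 * h * B\<^sup>2 \<ge> 2 * h" if "B \<noteq> 0"
  proof -
    have "B\<^sup>2 \<ge> 1" using that by (smt (verit) zero_less_power2)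
    then have "2 * h * 1 \<le> 2 * h * B\<^sup>2" using h by (intro mult_left_mono) auto
    then show ?thesis by simp
  qed
  show ?thesis
  proof (cases "s = 0")
    case True
    then have ev: "even x" "A = x" by (auto simp: s_def A)
    then have "odd B" using cop h(1) by (auto simp: B_def)
    then have B0: "B \<noteq> 0" by auto
    show ?thesis
    proof (cases "x = 0")
      case True
      have "2 * h * B\<^sup>2 > 2 * h" if "B\<^sup>2 \<noteq> 1"
      proof -
        have "B\<^sup>2 \<ge> 2" using B0 that by (smt (verit) zero_less_power2)
        then have "2 * h * 2 \<le> 2 * h * B\<^sup>2" using h by (intro mult_left_mono) auto
        then show ?thesis using h by linarith
      qed
      then show ?thesis using True ev by auto
    next
      case False
      then have "A\<^sup>2 > 0" using ev by simp
      then show ?thesis using hB[OF B0] by linarith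
    qed
  next
    case False
    then have "h * 1 \<le> h * \<bar>s\<bar>" using h by (intro mult_left_mono) auto
    then have low1: "\<bar>A\<bar> \<ge> h - \<bar>x\<bar>" using low by linarith
    have A2: "A\<^sup>2 > 0" using low1 xh h by (smt (verit) zero_less_power2)
    show ?thesis
    proof (cases "B = 0")
      case True
      have "A\<^sup>2 > 2 * h"
      proof (cases "y = 0")
        case y: True
        then have "odd x" using cop \<open>B = 0\<close> by (auto simp: B_def)
        \<comment> \<open>Oddness of h sharpens 2 |x| \<le> h to 2 |x| \<le> h - 1. The gain is
          essential at h = 7, where h^2 > 8 h fails.\<close>
        have "2 * \<bar>A\<bar> \<ge> h + 1" using low1 xh h by presburger
        then have "(h + 1)\<^sup>2 \<le> (2 * A)\<^sup>2" using h abs_le_square_iff[of "h + 1" "2 * A"] by (simp add: abs_mult)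
        moreover have "(h + 1)\<^sup>2 > 8 * h"
        proof -
          have "(h - 6) * h \<ge> 0" using h by simp
          then show ?thesis by (simp add: power2_eq_square algebra_simps)
        qed
        ultimately show ?thesis by (simp add: power_mult_distrib)
      next
        case y: False
        define X where "X = \<bar>x\<bar>"
        have "y\<^sup>2 \<ge> 1" using y by (smt (verit) zero_less_power2)
        then have "8 * h * 1 \<le> 8 * h * y\<^sup>2" using h by (intro mult_left_mono) auto
        then have 1: "4 * X\<^sup>2 + 8 * h \<le> h\<^sup>2" using small by (simp add: X_def)
        have "4 * (h - X)\<^sup>2 - (h\<^sup>2 - 4 * X\<^sup>2) = 2 * (2 * X - h)\<^sup>2 + h\<^sup>2"
          by (simp add: power2_eq_square algebra_simps)
        moreover have "h\<^sup>2 > 0" "(2 * X - h)\<^sup>2 \<ge> 0" using h by auto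
        ultimately have "2 * h < (h - X)\<^sup>2" using 1 by linarith
        also have "\<dots> \<le> A\<^sup>2" using low1 xh by (intro sq) (auto simp: X_def)
        finally show ?thesis .
      qed
      then show ?thesis using True by simp
    next
      case False
      then show ?thesis using hB A2 by linarith
    qed
  qed
qed

text \<open>Here \<open>z\<^sub>0 = 1 / 2 + (1 / 2 + 1 / d) r\<close> and \<open>2 (\<mu> z\<^sub>0 - \<lambda>) = B + (A / d) r\<close>.\<close>

lemma one_mod_four_core:
  fixes d x y u v :: int
  assumes d: "d mod 4 = 1" "d \<ge> 13"
    and cop: "\<not> (even (x + y) \<and> even (u + v))" and small: "16 * (x\<^sup>2 + d * y\<^sup>2) \<le> d\<^sup>2"
  defines "A \<equiv> (d + 2) * x + d * y - 2 * d * v" and "B \<equiv> x - (d + 2) * y - 2 * u"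
  shows "A\<^sup>2 + d * B\<^sup>2 > 4 * d \<or> (x = 0 \<and> A = 0 \<and> B\<^sup>2 = 4)"
proof -
  \<comment> \<open>Again s / 2 is a coefficient of r, now at z = (1 + r) / 2, the point belonging
    to the prime (2, 1 + r).\<close>
  define s where "s = x + y - 2 * v"
  have A: "A = d * s + 2 * x" by (simp add: A_def s_def algebra_simps)
  have "d * y\<^sup>2 \<ge> 0" using d by simp
  then have "(4 * x)\<^sup>2 \<le> d\<^sup>2" using small by (simp add: power_mult_distrib)
  then have xd: "4 * \<bar>x\<bar> \<le> d"
    using d abs_le_square_iff[of "4 * x" d] by (simp add: abs_mult)
  have low: "\<bar>A\<bar> \<ge> d * \<bar>s\<bar> - 2 * \<bar>x\<bar>"
    unfolding A using d abs_triangle_ineq2_sym[of "d * s" "- 2 * x"] by (simp add: abs_mult)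
  have odd_d: "odd d" using d by presburger
  have sq: "c\<^sup>2 \<le> (2 * A)\<^sup>2" if "2 * \<bar>A\<bar> \<ge> c" "c \<ge> 0" for c
    using that abs_le_square_iff[of c "2 * A"] by (simp add: abs_mult)
  show ?thesis
  proof (cases "s = 0")
    case True
    then have v: "x = 2 * v - y" by (simp add: s_def)
    obtain e where e: "d = 4 * e + 1" using d by (metis mult_div_mod_eq)
    have "even B" using odd_d by (simp add: B_def v)
    moreover have "B \<noteq> 0"
    proof
      assume "B = 0"
      \<comment> \<open>Here the residue of d matters: (d + 3) / 2 is even, so u and v have the same
        parity.\<close>
      then have "u = v - y * (2 * e + 2)" unfolding B_def v e by (simp add: algebra_simps)
      then show False using cop v by auto
    qed
    ultimately have "\<bar>B\<bar> \<ge> 2" by presburger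
    then have B2: "B\<^sup>2 \<ge> 4" using abs_le_square_iff[of 2 B] by simp
    then have dB: "d * B\<^sup>2 \<ge> d * 4" using d by (intro mult_left_mono) auto
    show ?thesis
    proof (cases "A = 0")
      case A0: True
      then have "x = 0" using A True by simp
      moreover have "d * B\<^sup>2 > d * 4" if "B\<^sup>2 \<noteq> 4" using B2 that d by simp
      ultimately show ?thesis using A0 by auto
    next
      case False
      then have "A\<^sup>2 > 0" by simp
      then show ?thesis using dB by linarith
    qed
  next
    case False
    show ?thesis
    proof (cases "even (x + y)")
      case True
      then have "even s" by (simp add: s_def)
      then have "\<bar>s\<bar> \<ge> 2" using False by presburger
      then have "d * 2 \<le> d * \<bar>s\<bar>" using d by (intro mult_left_mono) auto
      then have "2 * \<bar>A\<bar> \<ge> 3 * d" using low xd by linarith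
      then have "(3 * d)\<^sup>2 \<le> (2 * A)\<^sup>2" using d by (intro sq) auto
      then have "4 * A\<^sup>2 \<ge> 9 * (d * d)" by (simp add: power_mult_distrib power2_eq_square)
      moreover have "d * d > 12 * d" using d by (intro mult_strict_right_mono) auto
      moreover have "d * B\<^sup>2 \<ge> 0" using d by simp
      ultimately show ?thesis using d(2) by linarith
    next
      case odd: False
      have "d * 1 \<le> d * \<bar>s\<bar>" using d False by (intro mult_left_mono) auto
      then have "2 * \<bar>A\<bar> \<ge> d" using low xd by linarith
      then have "d\<^sup>2 \<le> (2 * A)\<^sup>2" using d by (intro sq) auto
      then have "4 * A\<^sup>2 \<ge> d * d" by (simp add: power_mult_distrib power2_eq_square)
      moreover have "d * d > 12 * d" using d by (intro mult_strict_right_mono) auto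
      moreover have "odd B" using odd odd_d by (auto simp: B_def)
      then have "B\<^sup>2 > 0" by (auto simp: zero_less_power2)
      then have "d * 1 \<le> d * B\<^sup>2" using d by (intro mult_left_mono) linarith+
      ultimately show ?thesis using d(2) by linarith
    qed
  qed
qed

context quadratic_order begin

section \<open>Range where all small denominators are rational integers\<close>

lemma int_norm_lt: 
  assumes "x \<in> R" "cmod x < \<bar>Im w\<bar>"
  obtains a where "x = of_int a"
proof -
  obtain a b where x: "x = of_int a + of_int b * w" using assms(1) by (rule R_E)
  have "of_int \<bar>b\<bar> * \<bar>Im w\<bar> \<le> cmod x" using abs_Im_le_cmod[of x] by (simp add: x abs_mult)
  also have "\<dots> < 1 * \<bar>Im w\<bar>" using assms(2) by simp
  finally have "b = 0" using Im_w by (simp add: mult_less_cancel_right)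
  then show ?thesis using that[of a] x by simp
qed

text \<open>Elements of \<open>R\<close> have imaginary parts in the multiples of
  \<open>Im w\<close>. For an integer a with 0 < |a| < M, the number a \<open>Im w\<close> / M
  misses all of them by at least |\<open>Im w\<close>| / M > 1. For M = 1 there is no nonzero
  denominator to consider.\<close>

lemma swan_number_gt_nat:
  assumes F: "fundamental_parallelogram R F"
    and M: "B < real M" "M = 1 \<or> real M < \<bar>Im w\<bar>"
  shows "swan_number R F > B"
proof (cases "M \<le> 1")
  case True
  then have "B < 1" using M by simp
  then show ?thesis
    by (intro swan_number_gt_strict[OF F, where ?z1.0 = 0]) (use norm_ge_1 in \<open>force simp: cop_def\<close>)
next
  case False
  then have M1: "real M < \<bar>Im w\<bar>" "M > 0" using M by auto
  show ?thesis
  proof (rule swan_number_gt_strict[OF F, where ?z1.0 = "\<i> * of_real (Im w / M)"])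
    fix l m assume c: "cop l m" and m0: "m \<noteq> 0" and mB: "cmod m \<le> B"
    then obtain a where a: "m = of_int a"
      using int_norm_lt[of m] M M1 by (auto simp: cop_def)
    have "l \<in> R" using c by (simp add: cop_def)
    then obtain e f where l: "l = of_int e + of_int f * w" by (rule R_E)
    have "of_int \<bar>a\<bar> < real M" using mB M(1) by (simp add: a)
    then have "\<bar>a\<bar> < int M" by linarith
    moreover have "a \<noteq> 0" using m0 a by simp
    ultimately have "\<not> int M dvd a" using dvd_imp_le_int[of a "int M"] by auto
    then have "a - f * int M \<noteq> 0" by (metis dvd_triv_right eq_iff_diff_eq_0)
    then have "1 \<le> \<bar>real_of_int (a - f * int M)\<bar>" by linarith
    then have "1 < \<bar>real_of_int (a - f * int M)\<bar> * (\<bar>Im w\<bar> / M)"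
      using M1 by (smt (verit) divide_pos_pos less_divide_eq_1_pos mult_le_cancel_right1 of_nat_0_less_iff)
    also have "\<dots> = \<bar>Im (m * (\<i> * of_real (Im w / M)) - l)\<bar>"
    proof -
      have "Im (m * (\<i> * of_real (Im w / M)) - l) = of_int (a - f * int M) * (Im w / M)"
        using M1 by (simp add: a l field_simps)
      then show ?thesis by (simp add: abs_mult)
    qed
    also have "\<dots> \<le> cmod (m * (\<i> * of_real (Im w / M)) - l)" by (rule abs_Im_le_cmod)
    finally show "cmod (m * (\<i> * of_real (Im w / M)) - l) > 1" .
  qed
qed

text \<open>An integer M strictly between \<open>Im w / 2\<close> and \<open>Im w\<close> is needed
  once \<open>Im w \<ge> 2\<close>, and 2 is the only value for which none exists.\<close>

lemma swan_number_gt_half_height: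
  assumes F: "fundamental_parallelogram R F" and "Im w > 0" "Im w \<noteq> 2"
  shows "swan_number R F > Im w / 2"
proof (cases "Im w < 2")
  case True
  then show ?thesis by (intro swan_number_gt_nat[OF F, where M = 1]) auto
next
  case False
  define M where "M = nat \<lfloor>Im w / 2\<rfloor> + 1"
  have "real M = of_int \<lfloor>Im w / 2\<rfloor> + 1" using assms(2) by (simp add: M_def)
  then have "Im w / 2 < real M" "real M < \<bar>Im w\<bar>"
    using False assms(3) by linarith+
  then show ?thesis by (intro swan_number_gt_nat[OF F, where M = M]) auto
qed

end

text \<open>
  For the order \<open>\<int>[(1 + \<surd>-d) / 2]\<close>: doubling makes all coordinates integral, at the price of a
  parity condition.
\<close>

locale odd_order = quadratic_order R w for R w +
  fixes d :: nat
  assumes d_mod: "d mod 4 = 3" and w_def: "w = (1 + \<i> * of_real (sqrt d)) / 2"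
begin

definition r :: complex where "r = \<i> * of_real (sqrt d)"

lemma r_sq: "r * r = - of_nat d"
proof -
  have "r * r = - complex_of_real (sqrt d * sqrt d)" by (simp only: of_real_mult) (simp add: r_def algebra_simps)
  then show ?thesis by simp
qed

lemma R_double:
  assumes "x \<in> R"
  obtains a b where "2 * x = of_int a + of_int b * r" "even (a - b)"
proof -
  obtain a b where "x = of_int a + of_int b * w" using assms by (rule R_E)
  then have "2 * x = of_int (2 * a + b) + of_int b * r" by (simp add: w_def r_def field_simps)
  then show ?thesis by (intro that[of "2 * a + b" b]) auto
qed

text \<open>As p divides d, the conditions p | x and p | u put both elements into the ramified prime
  above p. Concretely, the rational part of 4 (a l + b m) = 4 would be divisible by p.\<close>

lemma not_cop_common_divisor:
  fixes p :: int
  assumes p: "prime p" "odd p" "p dvd int d"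
    and l: "2 * l = of_int u + of_int v * r" "p dvd u"
    and m: "2 * m = of_int x + of_int y * r" "p dvd x"
  shows "\<not> cop l m"
proof
  assume "cop l m"
  then obtain a b where ab: "a \<in> R" "b \<in> R" "a * l + b * m = 1" by (auto simp: cop_def)
  obtain a1 a2 where a: "2 * a = of_int a1 + of_int a2 * r" using ab(1) by (rule R_double)
  obtain b1 b2 where b: "2 * b = of_int b1 + of_int b2 * r" using ab(2) by (rule R_double)
  have "4 = 4 * (a * l + b * m)" using ab(3) by simp
  also have "\<dots> = (2 * a) * (2 * l) + (2 * b) * (2 * m)" by (simp add: algebra_simps)
  also have "\<dots> = of_int (a1 * u + b1 * x) + of_int (a2 * v + b2 * y) * (r * r) + of_int (a1 * v + a2 * u + b1 * y + b2 * x) * r"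
    unfolding a b l m by (simp add: algebra_simps)
  finally have "Re 4 = Re (of_int (a1 * u + b1 * x) + of_int (a2 * v + b2 * y) * (r * r) + of_int (a1 * v + a2 * u + b1 * y + b2 * x) * r)"
    by simp
  then have "4 = real_of_int (a1 * u + b1 * x - (a2 * v + b2 * y) * int d)"
    unfolding r_sq by (simp add: r_def)
  then have "4 = a1 * u + b1 * x - (a2 * v + b2 * y) * int d" by linarith
  moreover have "p dvd a1 * u + b1 * x - (a2 * v + b2 * y) * int d"
    using p(3) l(2) m(2) by (intro dvd_diff dvd_add dvd_mult) auto
  ultimately have "p dvd 2 ^ 2" by simp
  then have "p dvd 2" using p(1) prime_dvd_power by blast
  then have "p \<le> 2" by (rule zdvd_imp_le) simp
  then show False using p prime_ge_2_int[of p] by auto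
qed

lemma cmod_sq_r: "(cmod (of_real a + of_real b * r))\<^sup>2 = a\<^sup>2 + b\<^sup>2 * d"
  by (simp add: cmod_power2 power_mult_distrib r_def)

lemma swan_number_gt_odd_large:
  fixes p q :: nat
  assumes F: "fundamental_parallelogram R F"
    and d: "d = p * q" and p: "prime p" "coprime p q" and q: "q > 12 * p"
  shows "swan_number R F > q / 8"
proof -
  have "odd d" using d_mod by presburger
  then have odd: "odd p" "odd q" "p > 0" "q > 0" using d q by (auto intro: Nat.gr0I)
  \<comment> \<open>With p m' = k' q + 2 the point k' / p + 2 / (p q) on the axis of r is m' /
    q.\<close>
  obtain m' k' where mk: "int p * m' = k' * int q + 2"
  proof -
    have "coprime (int p) (int q)" using p(2) by simp
    then obtain a b where "a * int p + b * int q = 1"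
      using bezout_int[of "int p" "int q"] by (auto simp: coprime_iff_gcd_eq_1)
    then have "int p * (2 * a) = (- 2 * b) * int q + 2" by (simp add: algebra_simps)
    then show ?thesis by (rule that)
  qed
  show ?thesis
  proof (rule swan_number_gt_tangent[OF F, where ?z0.0 = "of_real (m' / q) * r"])
    fix l m assume c: "cop l m" and m0: "m \<noteq> 0" and mq: "cmod m \<le> q / 8"
    have "l \<in> R" "m \<in> R" using c by (auto simp: cop_def)
    then obtain u v x y where l: "2 * l = of_int u + of_int v * r" "even (u - v)"
      and m: "2 * m = of_int x + of_int y * r" "even (x - y)" by (metis R_double)
    define A B where "A = m' * x - int q * v" and "B = m' * int p * y + u"
    \<comment> \<open>The bound q / 8 enters as |2 \<mu>| \<le> q / 4, hence |x| \<le> q /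
      4.\<close>
    have "(cmod (2 * m))\<^sup>2 \<le> (q / 4)\<^sup>2" using mq by (intro power_mono) (auto simp: norm_mult)
    moreover have "2 * m = of_real (of_int x) + of_real (of_int y) * r" using m by simp
    ultimately have "(of_int x)\<^sup>2 + (of_int y)\<^sup>2 * real d \<le> (q / 4)\<^sup>2" by (metis cmod_sq_r)
    then have "16 * ((of_int x)\<^sup>2 + (of_int y)\<^sup>2 * real d) \<le> (real q)\<^sup>2" by (simp add: power_divide)
    then have "real_of_int (16 * (x\<^sup>2 + int p * int q * y\<^sup>2)) \<le> real_of_int ((int q)\<^sup>2)"
      by (simp add: d algebra_simps)
    then have small: "16 * (x\<^sup>2 + int p * int q * y\<^sup>2) \<le> (int q)\<^sup>2" by (simp only: of_int_le_iff)
    have "\<not> (int p dvd x \<and> int p dvd u)"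
      using not_cop_common_divisor[of "int p" l u v m x y] c l m odd p d by auto
    then have core: "int p * A\<^sup>2 + int q * B\<^sup>2 > 4 * int q \<or> (x = 0 \<and> A = 0 \<and> B\<^sup>2 = 4)"
      unfolding A_def B_def using odd q p mk l m small
      by (intro odd_discriminant_core[where k = k']) auto
    have z: "2 * (m * (of_real (m' / q) * r) - l) = of_real (- of_int B) + of_real (A / q) * r"
    proof -
      define c where "c = complex_of_real (m' / q)"
      have "2 * (m * (c * r) - l) = (2 * m) * (c * r) - 2 * l" by (simp add: algebra_simps)
      also have "\<dots> = (of_int x * c - of_int v) * r + of_int y * c * (r * r) - of_int u"
        unfolding l m by (simp add: algebra_simps)
      also have "of_int x * c - of_int v = complex_of_real (of_int x * (m' / q) - of_int v)" by (simp add: c_def)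
      also have "of_int y * c = complex_of_real (of_int y * (m' / q))" by (simp add: c_def)
      finally have "2 * (m * (c * r) - l) =
          of_real (of_int x * (m' / q) - of_int v) * r + of_real (of_int y * (m' / q)) * (r * r) - of_int u" .
      also have "\<dots> = of_real (of_int x * (m' / q) - of_int v) * r + of_real (- (of_int y * (m' / q)) * real d - of_int u)"
        unfolding r_sq by simp
      also have "of_int x * (m' / q) - of_int v = A / q" using odd by (simp add: A_def field_simps)
      also have "- (of_int y * (m' / q)) * real d - of_int u = - real_of_int B"
        using odd by (simp add: B_def d field_simps)
      finally show ?thesis by (simp add: c_def)
    qed
    have "4 * (cmod X)\<^sup>2 = (cmod (2 * X))\<^sup>2" for X
      by (simp add: norm_mult power_mult_distrib)
    then have "4 * (cmod (m * (of_real (m' / q) * r) - l))\<^sup>2 = (cmod (2 * (m * (of_real (m' / q) * r) - l)))\<^sup>2" .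
    also have "\<dots> = B\<^sup>2 + (A / q)\<^sup>2 * d" unfolding z cmod_sq_r by simp
    also have "\<dots> = (int p * A\<^sup>2 + int q * B\<^sup>2) / q"
      using odd by (simp add: d field_simps power2_eq_square)
    finally have N: "4 * (cmod (m * (of_real (m' / q) * r) - l))\<^sup>2 = real_of_int (int p * A\<^sup>2 + int q * B\<^sup>2) / q" .
    from core show "cmod (m * (of_real (m' / q) * r) - l) > 1 \<or>
        cmod (m * (of_real (m' / q) * r) - l) = 1 \<and> Re ((m * (of_real (m' / q) * r) - l) * cnj m) = 0"
    proof
      assume "int p * A\<^sup>2 + int q * B\<^sup>2 > 4 * int q"
      then have "real_of_int (int p * A\<^sup>2 + int q * B\<^sup>2) > 4 * real q" by linarith
      then have "real_of_int (int p * A\<^sup>2 + int q * B\<^sup>2) / q > 4" using odd by (simp add: field_simps)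
      then have "1 < (cmod (m * (of_real (m' / q) * r) - l))\<^sup>2" using N by linarith
      then show ?thesis by (smt (verit) norm_ge_zero power_le_one)
    next
      assume *: "x = 0 \<and> A = 0 \<and> B\<^sup>2 = 4"
      then have "(cmod (m * (of_real (m' / q) * r) - l))\<^sup>2 = 1"
        using N odd by simp
      then have "cmod (m * (of_real (m' / q) * r) - l) = 1" using power2_eq_imp_eq[of "cmod (m * (of_real (m' / q) * r) - l)" 1] by simp
      \<comment> \<open>In the equality case \<mu> z - \<lambda> is real and \<mu> is purely
        imaginary.\<close>
      moreover have "Re ((m * (of_real (m' / q) * r) - l) * cnj m) = 0"
      proof -
        have 1: "2 * (m * (of_real (m' / q) * r) - l) = of_real (- of_int B)" unfolding z using * by simp
        have 2: "2 * m = of_int y * r" using m * by simp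
        have "4 * Re (X * cnj m) = Re ((2 * X) * cnj (2 * m))" for X by simp
        then have "4 * Re ((m * (of_real (m' / q) * r) - l) * cnj m) = Re (of_real (- of_int B) * cnj (of_int y * r))"
          unfolding 1[symmetric] 2[symmetric] .
        also have "\<dots> = 0" by (simp add: r_def)
        finally show ?thesis by simp
      qed
      ultimately show ?thesis by blast
    qed
  qed
qed

text \<open>For \<open>q \<le> 12 * p\<close> it suffices to find an integer M with q / 8 < M <
  \<surd>(p q) / 2, or M = 1 if q < 8.\<close>

lemma swan_number_gt_odd:
  fixes p q :: nat
  assumes F: "fundamental_parallelogram R F"
    and d: "d = p * q" and p: "prime p" "coprime p q"
  shows "swan_number R F > q / 8"
proof (cases "q > 12 * p")
  case True
  then show ?thesis using assms by (intro swan_number_gt_odd_large)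
next
  case False
  have "odd d" using d_mod by presburger
  then have odd: "odd p" "odd q" "q > 0" using d by (auto intro: Nat.gr0I)
  have p3: "p \<ge> 3" using p(1) odd prime_ge_2_nat[of p] by (cases "p = 2") auto
  have "\<exists>M. q < 8 * M \<and> (M = 1 \<or> 4 * M\<^sup>2 < p * q)"
  proof (cases "q < 8")
    case True
    then show ?thesis by (intro exI[of _ 1]) auto
  next
    case q8: False
    show ?thesis
    proof (cases "p = 3")
      \<comment> \<open>For p = 3 the estimate used in the other case breaks down at q = 30, before
        the limit 36 is reached; congruences leave four values of q to check.\<close>
      case True
      have "q mod 4 = 1" using d_mod unfolding d True by presburger
      moreover have "\<not> 3 dvd q" using p True by (metis coprime_absorb_left dvd_refl not_prime_unit)
      moreover have "q \<le> 36" using False True by simp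
      ultimately have "q = 13 \<or> q = 17 \<or> q = 25 \<or> q = 29" using q8 by presburger
      then have "\<exists>M\<in>{2,3,4}. q < 8 * M \<and> 4 * M\<^sup>2 < p * q" using True by auto
      then show ?thesis by blast
    next
      case False
      then have p5: "p \<ge> 5" using p3 odd by presburger
      \<comment> \<open>The choice M = \<open>q div 8 + 1\<close> is at most (q + 8) / 8, so this
        gives 4 M^2 < p q. For q up to 60 it follows from p \<ge> 5, beyond that from q \<le> 12
        p.\<close>
      have "(q + 8)\<^sup>2 < 16 * (p * q)"
      proof (cases "q \<le> 60")
        case True
        then have "(int q - 2) * (60 - int q) \<ge> 0" using q8 by simp
        then have "(int q + 8)\<^sup>2 < 80 * int q" using q8 by (simp add: power2_eq_square algebra_simps)
        then have "int ((q + 8)\<^sup>2) < int (80 * q)" by (simp add: add.commute)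
        then have "(q + 8)\<^sup>2 < 80 * q" by (simp only: of_nat_less_iff)
        also have "80 * q \<le> 16 * (p * q)" using p5 by simp
        finally show ?thesis .
      next
        case False
        then have "61 * int q \<le> int q * int q" by (intro mult_right_mono) auto
        moreover have "3 * (int q + 8)\<^sup>2 = 3 * (int q * int q) + 48 * int q + 192"
          by (simp add: power2_eq_square algebra_simps)
        ultimately have "3 * (int q + 8)\<^sup>2 < 4 * (int q * int q)" using False by linarith
        then have "int (3 * (q + 8)\<^sup>2) < int (4 * (q * q))" by (simp add: add.commute)
        then have "3 * (q + 8)\<^sup>2 < 4 * (q * q)" by (simp only: of_nat_less_iff)
        also have "4 * (q * q) \<le> 4 * (12 * p * q)" using \<open>\<not> q > 12 * p\<close> by (intro mult_left_mono mult_right_mono) auto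
        finally show ?thesis by simp
      qed
      moreover have "8 * (q div 8 + 1) \<le> q + 8" by simp
      then have "(8 * (q div 8 + 1))\<^sup>2 \<le> (q + 8)\<^sup>2" by (intro power_mono) auto
      then have "16 * (4 * (q div 8 + 1)\<^sup>2) \<le> (q + 8)\<^sup>2" unfolding power_mult_distrib by simp
      ultimately have "4 * (q div 8 + 1)\<^sup>2 < p * q" by linarith
      moreover have "q < 8 * (q div 8 + 1)" by simp
      ultimately show ?thesis by blast
    qed
  qed
  then obtain M where M: "q < 8 * M" "M = 1 \<or> 4 * M\<^sup>2 < p * q" by blast
  have "M = 1 \<or> real M < \<bar>Im w\<bar>"
  proof (rule disj_forward[OF M(2)])
    assume "4 * M\<^sup>2 < p * q"
    then have "real (4 * M\<^sup>2) < real d" unfolding d by (simp only: of_nat_less_iff)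
    then have "(2 * real M)\<^sup>2 < real d" by (simp add: power_mult_distrib)
    then have "2 * real M < sqrt d" by (rule real_less_rsqrt)
    then show "real M < \<bar>Im w\<bar>" by (simp add: w_def)
  qed
  then show ?thesis using M(1) by (intro swan_number_gt_nat[OF F, where M = M]) auto
qed

end

text \<open>
  The order \<open>\<int>[\<surd>-d]\<close>. The pairs of elements of the prime ideal above 2 are not coprime; that
  ideal is \<open>(2, \<surd>-d)\<close> or \<open>(2, 1 + \<surd>-d)\<close>, depending on the parity of \<open>d\<close>.
\<close>

locale even_order = quadratic_order R w for R w +
  fixes d :: nat
  assumes d_mod: "d mod 4 = 1 \<or> d mod 4 = 2" and d_sqf: "squarefree d"
    and w_def: "w = \<i> * of_real (sqrt d)"
begin

lemma w_mult_w: "w * w = - of_nat d"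
proof -
  have "w * w = - complex_of_real (sqrt d * sqrt d)"
    unfolding w_def by (simp only: of_real_mult) (simp add: algebra_simps)
  then show ?thesis by simp
qed

lemma cmod_sq_w: "(cmod (of_real a + of_real b * w))\<^sup>2 = a\<^sup>2 + b\<^sup>2 * d"
  by (simp add: cmod_power2 power_mult_distrib w_def)

lemma bezout_coords:
  assumes "cop (of_int u + of_int v * w) (of_int x + of_int y * w)"
  obtains a1 a2 b1 b2 where "a1 * u + b1 * x - int d * (a2 * v + b2 * y) = 1" "a1 * v + a2 * u + b1 * y + b2 * x = 0"
proof -
  from assms obtain a b where ab: "a \<in> R" "b \<in> R"
    "a * (of_int u + of_int v * w) + b * (of_int x + of_int y * w) = 1" by (auto simp: cop_def)
  obtain a1 a2 where a: "a = of_int a1 + of_int a2 * w" using ab(1) by (rule R_E)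
  obtain b1 b2 where b: "b = of_int b1 + of_int b2 * w" using ab(2) by (rule R_E)
  have "1 = of_int (a1 * u + b1 * x) + of_int (a2 * v + b2 * y) * (w * w) + of_int (a1 * v + a2 * u + b1 * y + b2 * x) * w"
    unfolding ab(3)[symmetric] a b by (simp add: algebra_simps)
  also have "\<dots> = of_int (a1 * u + b1 * x - int d * (a2 * v + b2 * y)) + of_int (a1 * v + a2 * u + b1 * y + b2 * x) * w"
    unfolding w_mult_w by (simp add: algebra_simps)
  finally have e: "1 = of_int (a1 * u + b1 * x - int d * (a2 * v + b2 * y)) + of_int (a1 * v + a2 * u + b1 * y + b2 * x) * w" .
  then have "Im (of_int (a1 * u + b1 * x - int d * (a2 * v + b2 * y)) + of_int (a1 * v + a2 * u + b1 * y + b2 * x) * w) = 0"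
    by (metis one_complex.sel(2))
  then have 0: "a1 * v + a2 * u + b1 * y + b2 * x = 0"
    using Im_w by (simp del: of_int_add of_int_mult of_int_diff)
  with e have "of_int (a1 * u + b1 * x - int d * (a2 * v + b2 * y)) = (1 :: complex)" by simp
  then have "a1 * u + b1 * x - int d * (a2 * v + b2 * y) = 1" by (simp only: of_int_eq_1_iff)
  with 0 show ?thesis using that by blast
qed

lemma swan_number_gt_two_mod_four:
  assumes F: "fundamental_parallelogram R F" and d2: "d = 2 * h" "odd h" "h \<ge> 7"
  shows "swan_number R F > d / 4"
proof (rule swan_number_gt_tangent[OF F, where ?z0.0 = "of_real ((h + 1) / d) * w"])
  have h0: "real h > 0" using d2 by simp
  fix l m assume c: "cop l m" and m0: "m \<noteq> 0" and mq: "cmod m \<le> d / 4"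
  have "l \<in> R" "m \<in> R" using c by (auto simp: cop_def)
  then obtain u v x y where l: "l = of_int u + of_int v * w" and m: "m = of_int x + of_int y * w"
    by (metis R_E)
  define A B where "A = (int h + 1) * x - 2 * int h * v" and "B = (int h + 1) * y + u"
  have "(cmod m)\<^sup>2 \<le> (d / 4)\<^sup>2" using mq by (intro power_mono) auto
  moreover have "m = of_real (of_int x) + of_real (of_int y) * w" using m by simp
  ultimately have "(of_int x)\<^sup>2 + (of_int y)\<^sup>2 * real d \<le> (d / 4)\<^sup>2" by (metis cmod_sq_w)
  then have "real_of_int (4 * x\<^sup>2 + 8 * int h * y\<^sup>2) \<le> real_of_int ((int h)\<^sup>2)"
    by (simp add: d2 power_divide power_mult_distrib algebra_simps)
  then have small: "4 * x\<^sup>2 + 8 * int h * y\<^sup>2 \<le> (int h)\<^sup>2" by (simp only: of_int_le_iff)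
  have "\<not> (even x \<and> even u)"
  proof
    assume ev: "even x \<and> even u"
    obtain a1 a2 b1 b2 where "a1 * u + b1 * x - int d * (a2 * v + b2 * y) = 1"
      using bezout_coords[of u v x y] c l m by metis
    moreover have "even (a1 * u + b1 * x - int d * (a2 * v + b2 * y))" using ev d2 by simp
    ultimately show False by simp
  qed
  then have core: "A\<^sup>2 + 2 * int h * B\<^sup>2 > 2 * int h \<or> (x = 0 \<and> A = 0 \<and> B\<^sup>2 = 1)"
    unfolding A_def B_def using d2 small by (intro even_discriminant_core) auto
  define E where "E = m * (of_real ((h + 1) / d) * w) - l"
  have z: "E = of_real (- of_int B) + of_real (A / d) * w"
  proof -
    define c where "c = complex_of_real ((h + 1) / d)"
    have "E = (of_int x * c - of_int v) * w + of_int y * c * (w * w) - of_int u"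
      unfolding E_def l m c_def[symmetric] by (simp add: algebra_simps)
    also have "of_int x * c - of_int v = complex_of_real (of_int x * ((h + 1) / d) - of_int v)" by (simp add: c_def)
    also have "of_int y * c = complex_of_real (of_int y * ((h + 1) / d))" by (simp add: c_def)
    finally have "E = complex_of_real (of_int x * ((h + 1) / d) - of_int v) * w + of_real (of_int y * ((h + 1) / d)) * (w * w) - of_int u" .
    also have "\<dots> = of_real (of_int x * ((h + 1) / d) - of_int v) * w + of_real (- (of_int y * ((h + 1) / d)) * real d - of_int u)"
      unfolding w_mult_w by simp
    also have "of_int x * ((h + 1) / d) - of_int v = A / d" using h0 by (simp add: A_def d2 field_simps)
    also have "- (of_int y * ((h + 1) / d)) * real d - of_int u = - real_of_int B"
      using h0 by (simp add: B_def d2 field_simps)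
    finally show ?thesis by simp
  qed
  have "(cmod E)\<^sup>2 = (of_int B)\<^sup>2 + (A / d)\<^sup>2 * d" unfolding z cmod_sq_w by simp
  also have "\<dots> = (A\<^sup>2 + 2 * int h * B\<^sup>2) / (2 * h)"
    using h0 by (simp add: d2 field_simps power2_eq_square)
  finally have N: "(cmod E)\<^sup>2 = real_of_int (A\<^sup>2 + 2 * int h * B\<^sup>2) / (2 * h)" .
  from core have "cmod E > 1 \<or> cmod E = 1 \<and> Re (E * cnj m) = 0"
  proof
    assume "A\<^sup>2 + 2 * int h * B\<^sup>2 > 2 * int h"
    then have "real_of_int (A\<^sup>2 + 2 * int h * B\<^sup>2) > 2 * real h" by linarith
    then have "real_of_int (A\<^sup>2 + 2 * int h * B\<^sup>2) / (2 * h) > 1" using h0 by (simp add: less_divide_eq)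
    then have "1 < (cmod E)\<^sup>2" using N by linarith
    then show ?thesis by (smt (verit) norm_ge_zero power_le_one)
  next
    assume *: "x = 0 \<and> A = 0 \<and> B\<^sup>2 = 1"
    then have "(cmod E)\<^sup>2 = 1" using N h0 by simp
    then have "cmod E = 1" using power2_eq_imp_eq[of "cmod E" 1] by simp
    moreover have "Re (E * cnj m) = 0" unfolding z m using * by (simp add: w_def)
    ultimately show ?thesis by blast
  qed
  then show "cmod (m * (of_real ((h + 1) / d) * w) - l) > 1 \<or>
      cmod (m * (of_real ((h + 1) / d) * w) - l) = 1 \<and> Re ((m * (of_real ((h + 1) / d) * w) - l) * cnj m) = 0"
    by (simp only: E_def)
qed

lemma swan_number_gt_one_mod_four:
  assumes F: "fundamental_parallelogram R F" and d1: "d mod 4 = 1" "d \<ge> 13"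
  shows "swan_number R F > d / 4"
proof (rule swan_number_gt_tangent[OF F, where ?z0.0 = "1 / 2 + of_real ((d + 2) / (2 * d)) * w"])
  have d0: "real d > 0" using d1 by simp
  fix l m assume c: "cop l m" and m0: "m \<noteq> 0" and mq: "cmod m \<le> d / 4"
  have "l \<in> R" "m \<in> R" using c by (auto simp: cop_def)
  then obtain u v x y where l: "l = of_int u + of_int v * w" and m: "m = of_int x + of_int y * w"
    by (metis R_E)
  define A B where "A = (int d + 2) * x + int d * y - 2 * int d * v" and "B = x - (int d + 2) * y - 2 * u"
  have "(cmod m)\<^sup>2 \<le> (d / 4)\<^sup>2" using mq by (intro power_mono) auto
  moreover have "m = of_real (of_int x) + of_real (of_int y) * w" using m by simp
  ultimately have "(of_int x)\<^sup>2 + (of_int y)\<^sup>2 * real d \<le> (d / 4)\<^sup>2" by (metis cmod_sq_w)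
  then have "real_of_int (16 * (x\<^sup>2 + int d * y\<^sup>2)) \<le> real_of_int ((int d)\<^sup>2)"
    by (simp add: power_divide algebra_simps)
  then have small: "16 * (x\<^sup>2 + int d * y\<^sup>2) \<le> (int d)\<^sup>2" by (simp only: of_int_le_iff)
  have "odd (int d)" using d1 by presburger
  have "\<not> (even (x + y) \<and> even (u + v))"
  proof
    assume ev: "even (x + y) \<and> even (u + v)"
    obtain a1 a2 b1 b2 where bz: "a1 * u + b1 * x - int d * (a2 * v + b2 * y) = 1" "a1 * v + a2 * u + b1 * y + b2 * x = 0"
      using bezout_coords[of u v x y] c l m by metis
    \<comment> \<open>Adding the two coordinates modulo 2 is the ring homomorphism \<open>w\<close>
      \<mapsto> 1, well defined as d is odd; its kernel is the prime (2, 1 +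
      \<open>w\<close>).\<close>
    then have "odd (a1 * u + b1 * x - int d * (a2 * v + b2 * y) + (a1 * v + a2 * u + b1 * y + b2 * x))" by simp
    moreover have "even (a1 * u + b1 * x - int d * (a2 * v + b2 * y) + (a1 * v + a2 * u + b1 * y + b2 * x))"
      using ev \<open>odd (int d)\<close> by auto
    ultimately show False by blast
  qed
  moreover have "int d mod 4 = 1" using d1 by presburger
  ultimately have core: "A\<^sup>2 + int d * B\<^sup>2 > 4 * int d \<or> (x = 0 \<and> A = 0 \<and> B\<^sup>2 = 4)"
    unfolding A_def B_def using d1 small by (intro one_mod_four_core) auto
  define E where "E = m * (1 / 2 + of_real ((d + 2) / (2 * d)) * w) - l"
  have z: "2 * E = of_real (of_int B) + of_real (A / d) * w"
  proof -
    define c where "c = complex_of_real ((d + 2) / d)"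
    have c: "of_real ((d + 2) / (2 * d)) = c / 2" using d0 by (simp add: c_def field_simps)
    have "2 * E = (of_int x * c + of_int y - 2 * of_int v) * w + of_int y * c * (w * w) + of_int (x - 2 * u)"
      unfolding E_def l m c by (simp add: field_simps)
    also have "of_int x * c + of_int y - 2 * of_int v = complex_of_real (of_int x * ((d + 2) / d) + of_int y - 2 * of_int v)"
      by (simp add: c_def)
    also have "of_int y * c = complex_of_real (of_int y * ((d + 2) / d))" by (simp add: c_def)
    finally have "2 * E = complex_of_real (of_int x * ((d + 2) / d) + of_int y - 2 * of_int v) * w + of_real (of_int y * ((d + 2) / d)) * (w * w) + of_int (x - 2 * u)" .
    also have "\<dots> = of_real (of_int x * ((d + 2) / d) + of_int y - 2 * of_int v) * w + of_real (- (of_int y * ((d + 2) / d)) * real d + of_int (x - 2 * u))"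
      unfolding w_mult_w by simp
    also have "of_int x * ((d + 2) / d) + of_int y - 2 * of_int v = A / d" using d0 by (simp add: A_def field_simps)
    also have "- (of_int y * ((d + 2) / d)) * real d + of_int (x - 2 * u) = real_of_int B"
      using d0 by (simp add: B_def field_simps)
    finally show ?thesis by simp
  qed
  have "4 * (cmod E)\<^sup>2 = (cmod (2 * E))\<^sup>2" by (simp add: norm_mult power_mult_distrib)
  also have "\<dots> = (of_int B)\<^sup>2 + (A / d)\<^sup>2 * d" unfolding z cmod_sq_w by simp
  also have "\<dots> = (A\<^sup>2 + int d * B\<^sup>2) / d"
    using d0 by (simp add: field_simps power2_eq_square)
  finally have N: "4 * (cmod E)\<^sup>2 = real_of_int (A\<^sup>2 + int d * B\<^sup>2) / d" .
  from core have "cmod E > 1 \<or> cmod E = 1 \<and> Re (E * cnj m) = 0"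
  proof
    assume "A\<^sup>2 + int d * B\<^sup>2 > 4 * int d"
    then have "real_of_int (A\<^sup>2 + int d * B\<^sup>2) > 4 * real d" by linarith
    then have "real_of_int (A\<^sup>2 + int d * B\<^sup>2) / d > 4" using d0 by (simp add: field_simps)
    then have "1 < (cmod E)\<^sup>2" using N by linarith
    then show ?thesis by (smt (verit) norm_ge_zero power_le_one)
  next
    assume *: "x = 0 \<and> A = 0 \<and> B\<^sup>2 = 4"
    then have "(cmod E)\<^sup>2 = 1" using N d0 by simp
    then have "cmod E = 1" using power2_eq_imp_eq[of "cmod E" 1] by simp
    moreover have "Re (2 * E * cnj m) = 0" unfolding z m using * by (simp add: w_def)
    then have "Re (E * cnj m) = 0" by simp
    ultimately show ?thesis by blast
  qed
  then show "cmod (m * (1 / 2 + of_real ((d + 2) / (2 * d)) * w) - l) > 1 \<or>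
      cmod (m * (1 / 2 + of_real ((d + 2) / (2 * d)) * w) - l) = 1 \<and>
      Re ((m * (1 / 2 + of_real ((d + 2) / (2 * d)) * w) - l) * cnj m) = 0"
    by (simp only: E_def)
qed

text \<open>An integer cofactor of modulus at least 2 leaves a divisor of modulus at most |\<Delta>|
  / 2 = 2 d, so d / 4 is the value needed. Below 13 the points of \<open>swan_number_gt_nat\<close>
  suffice.\<close>

lemma swan_number_gt_even:
  assumes F: "fundamental_parallelogram R F"
  shows "swan_number R F > d / 4"
proof -
  \<comment> \<open>d = 9 would require M = 3, whose square is not below d.\<close>
  have nsq: "d \<noteq> 9"
    using d_sqf not_squarefreeI[of 3 "9 :: nat"] by auto
  have small: "swan_number R F > d / 4" if "M = 1 \<or> M\<^sup>2 < d" "d < 4 * M" for M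
  proof (rule swan_number_gt_nat[OF F])
    show "M = 1 \<or> real M < \<bar>Im w\<bar>"
    proof (rule disj_forward[OF that(1)])
      assume "M\<^sup>2 < d"
      then have "(real M)\<^sup>2 < real d" by (metis of_nat_less_iff of_nat_power)
      then show "real M < \<bar>Im w\<bar>" by (simp add: w_def real_less_rsqrt)
    qed
    show "real d / 4 < real M" using that(2) by simp
  qed
  show ?thesis
  proof (cases "d \<ge> 13")
    case True
    show ?thesis
    proof (cases "d mod 4 = 1")
      case False
      then have "d mod 4 = 2" using d_mod by blast
      then have "d = 2 * (d div 2)" "odd (d div 2)" "d div 2 \<ge> 7" using True by presburger+
      then show ?thesis by (rule swan_number_gt_two_mod_four[OF F])
    qed (use True F in \<open>intro swan_number_gt_one_mod_four\<close>)
  next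
    case False
    then have "d = 1 \<or> d = 2 \<or> d = 5 \<or> d = 6 \<or> d = 10" using d_mod nsq by presburger
    then have "\<exists>M\<in>{1,2,3}. (M = 1 \<or> M\<^sup>2 < d) \<and> d < 4 * M" by auto
    then show ?thesis using small by blast
  qed
qed

end

section \<open>Rings of integers of imaginary quadratic fields\<close>

text \<open>Splitting a monic P into even and odd parts, P(x) = E(x^2) + x D(x^2), shows that x^2 is
  a root of E(y)^2 - y D(y)^2. The parity of the degree decides which summand leads, so the leading
  coefficient is 1 or -1.\<close>

lemma algebraic_int_square:
  fixes x :: "'a :: field_char_0"
  assumes "algebraic_int x"
  shows "algebraic_int (x\<^sup>2)"
proof -
  obtain P where P: "lead_coeff P = 1" "\<And>i. coeff P i \<in> \<int>" "poly P x = 0"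
    using assms by (auto elim: algebraic_int.cases)
  define n where "n = degree P"
  define E where "E = Poly (map (\<lambda>i. coeff P (2 * i)) [0..<Suc n])"
  define D where "D = Poly (map (\<lambda>i. coeff P (2 * i + 1)) [0..<Suc n])"
  have cE: "coeff E i = coeff P (2 * i)" for i
    by (auto simp: E_def coeff_Poly_eq nth_default_def n_def intro!: coeff_eq_0 simp del: upt_Suc)
  have cD: "coeff D i = coeff P (2 * i + 1)" for i
    by (auto simp: D_def coeff_Poly_eq nth_default_def n_def intro!: coeff_eq_0 simp del: upt_Suc)
  have degE: "degree E \<le> n" and degD: "degree D \<le> n"
    by (intro degree_le; auto simp: cE cD n_def intro!: coeff_eq_0)+
  have "poly P x = (\<Sum>i<2 * Suc n. coeff P i * x ^ i)"
    unfolding poly_altdef by (intro sum.mono_neutral_left) (auto simp: n_def intro!: coeff_eq_0)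
  also have "\<dots> = (\<Sum>i<Suc n. coeff P (2 * i) * x ^ (2 * i) + coeff P (2 * i + 1) * x ^ (2 * i + 1))"
    by (induction n) (simp_all add: algebra_simps)
  also have "\<dots> = (\<Sum>i<Suc n. coeff E i * (x\<^sup>2) ^ i) + x * (\<Sum>i<Suc n. coeff D i * (x\<^sup>2) ^ i)"
    unfolding sum_distrib_left sum.distrib[symmetric] cE cD
    unfolding power_add power_mult[of x 2] by (simp add: algebra_simps)
  also have "(\<Sum>i<Suc n. coeff E i * (x\<^sup>2) ^ i) = poly E (x\<^sup>2)"
    unfolding poly_altdef using degE by (intro sum.mono_neutral_right) (auto intro: coeff_eq_0)
  also have "(\<Sum>i<Suc n. coeff D i * (x\<^sup>2) ^ i) = poly D (x\<^sup>2)"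
    unfolding poly_altdef using degD by (intro sum.mono_neutral_right) (auto intro: coeff_eq_0)
  finally have eq: "poly E (x\<^sup>2) = - x * poly D (x\<^sup>2)" using P(3) by (simp add: add_eq_0_iff)
  define Q where "Q = E * E - pCons 0 (D * D)"
  have "poly Q (x\<^sup>2) = 0"
  proof -
    have "poly Q (x\<^sup>2) = poly E (x\<^sup>2) * poly E (x\<^sup>2) - x\<^sup>2 * (poly D (x\<^sup>2) * poly D (x\<^sup>2))"
      by (simp add: Q_def)
    then show ?thesis unfolding eq by (simp add: power2_eq_square)
  qed
  moreover have QZ: "coeff Q i \<in> \<int>" for i
    unfolding Q_def coeff_diff coeff_mult coeff_pCons
    by (auto split: nat.split intro!: Ints_diff Ints_sum Ints_mult simp: coeff_mult cE cD P(2))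
  moreover have "lead_coeff Q = 1 \<or> lead_coeff Q = - 1"
  proof (cases "even n")
    case True
    then obtain k where k: "n = 2 * k" by blast
    have dE: "degree E \<le> k" by (intro degree_le) (auto simp: cE n_def[symmetric] k intro!: coeff_eq_0)
    have D0: "coeff D i = 0" if "i \<ge> k" for i
      using that by (auto simp: cD n_def[symmetric] k intro!: coeff_eq_0)
    have lE: "coeff E k = 1" using P(1) by (simp add: cE n_def[symmetric] k[symmetric])
    then have "degree E = k" using dE le_degree[of E k] by simp
    then have EE: "degree (E * E) = 2 * k" "coeff (E * E) (2 * k) = 1"
      using lE degree_mult_eq[of E E] coeff_degree_mult[of E E] by (cases "E = 0"; auto simp: mult_2)+
    have DD: "coeff (pCons 0 (D * D)) i = 0" if "i \<ge> 2 * k" for i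
    proof (cases "k = 0")
      case True
      then have "D = 0" using D0 by (simp add: poly_eq_iff)
      then show ?thesis by simp
    next
      case False
      have "degree D \<le> k - 1" by (intro degree_le) (auto intro!: D0)
      then have "degree (D * D) < i - 1 + 1" using degree_mult_le[of D D] that False by linarith
      then have "degree (pCons 0 (D * D)) < i"
        using that False degree_mult_le[of D D] \<open>degree D \<le> k - 1\<close> degree_pCons_le[of 0 "D * D"] by linarith
      then show ?thesis by (rule coeff_eq_0)
    qed
    have "coeff Q (2 * k) = 1" using EE DD by (simp add: Q_def)
    moreover have "degree Q \<le> 2 * k" using EE DD by (intro degree_le) (auto simp: Q_def intro!: coeff_eq_0)
    ultimately show ?thesis using le_degree[of Q "2 * k"] by auto
  next
    case False
    then obtain k where k: "n = 2 * k + 1" by (elim oddE)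
    have dD: "degree D \<le> k" by (intro degree_le) (auto simp: cD n_def[symmetric] k intro!: coeff_eq_0)
    have dE: "degree E \<le> k" by (intro degree_le) (auto simp: cE n_def[symmetric] k intro!: coeff_eq_0)
    have "coeff P n = 1" using P(1) by (simp add: n_def)
    then have lD: "coeff D k = 1" by (simp only: cD k)
    then have "degree D = k" using dD le_degree[of D k] by simp
    then have DD: "degree (D * D) = 2 * k" "coeff (D * D) (2 * k) = 1"
      using lD degree_mult_eq[of D D] coeff_degree_mult[of D D] by (cases "D = 0"; auto simp: mult_2)+
    have EE: "coeff (E * E) i = 0" if "i > 2 * k" for i
      using degree_mult_le[of E E] dE that by (intro coeff_eq_0) linarith
    have "coeff Q (2 * k + 1) = - 1" using EE DD by (simp add: Q_def)
    moreover have "degree Q \<le> 2 * k + 1"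
      using EE DD by (intro degree_le) (auto simp: Q_def coeff_pCons split: nat.split intro!: coeff_eq_0)
    ultimately show ?thesis using le_degree[of Q "2 * k + 1"] by auto
  qed
  ultimately have "\<exists>Q. lead_coeff Q = 1 \<and> (\<forall>i. coeff Q i \<in> \<int>) \<and> poly Q (x\<^sup>2) = 0"
  proof (elim disjE)
    assume "lead_coeff Q = - 1" "poly Q (x\<^sup>2) = 0"
    then show ?thesis using QZ by (intro exI[of _ "- Q"]) auto
  qed (use QZ in blast)
  then show ?thesis by (auto intro: algebraic_int.intros)
qed

text \<open>A nonreal \<theta> in K and 1 form a basis. Completing the square gives a nonreal \<eta>
  with rational square; clearing its denominator and removing the square part leaves the squarefree
  d, and nonreality gives the sign.\<close>

lemma imaginary_quadratic_field_cases:
  assumes "imaginary_quadratic_field K"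
  obtains d :: nat where "squarefree d"
    "K = {of_rat a + of_rat b * (\<i> * of_real (sqrt (real d))) | a b. True}"
proof -
  interpret Q: vector_space "\<lambda>(q::rat) (z::complex). of_rat q * z"
    by (rule vector_space_rat_complex)
  have K1: "1 \<in> K" and Kdiff: "\<And>x y. x \<in> K \<Longrightarrow> y \<in> K \<Longrightarrow> x - y \<in> K"
    and Kmult: "\<And>x y. x \<in> K \<Longrightarrow> y \<in> K \<Longrightarrow> x * y \<in> K" and Kinv: "\<And>x. x \<in> K \<Longrightarrow> inverse x \<in> K"
    and dim: "Q.dim K = 2" and "\<not> K \<subseteq> \<real>"
    using assms unfolding imaginary_quadratic_field_def by auto
  have K0: "0 \<in> K" using Kdiff[OF K1 K1] by simp
  have Kneg: "- x \<in> K" if "x \<in> K" for x using Kdiff[OF K0 that] by simp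
  have Kadd: "x + y \<in> K" if "x \<in> K" "y \<in> K" for x y using Kdiff[OF that(1) Kneg[OF that(2)]] by simp
  have Knat: "of_nat n \<in> K" for n by (induction n) (auto intro: Kadd K0 K1)
  have Kint: "of_int n \<in> K" for n by (cases n) (use Knat Kneg in \<open>auto simp del: of_nat_Suc\<close>)
  have Krat: "of_rat q \<in> K" for q
  proof -
    obtain a b where q: "q = of_int a / of_int b" by (metis quotient_of_div surj_pair)
    have "of_int a * inverse (of_int b) \<in> K" by (intro Kmult Kinv Kint)
    then show ?thesis by (simp add: q of_rat_divide) (simp add: divide_inverse)
  qed
  obtain \<theta> where \<theta>: "\<theta> \<in> K" "\<theta> \<notin> \<real>" using \<open>\<not> K \<subseteq> \<real>\<close> by blast
  have rat_real: "of_rat q \<in> (\<real> :: complex set)" for q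
  proof -
    obtain a b where "q = of_int a / of_int b" by (metis quotient_of_div surj_pair)
    then have "complex_of_rat q = of_int a / of_int b" by (simp add: of_rat_divide)
    then show ?thesis by (simp only:) (intro Reals_divide Reals_of_int)
  qed
  have indep: "Q.independent {1, \<theta>}"
  proof -
    have "\<theta> \<notin> Q.span {1}"
    proof
      assume "\<theta> \<in> Q.span {1}"
      then obtain q where "\<theta> = of_rat q" by (auto simp: Q.span_singleton)
      then show False using \<theta>(2) rat_real by simp
    qed
    then have "Q.independent (insert \<theta> {1})"
      by (intro Q.independent_insertI) (auto simp: Q.independent_empty)
    then show ?thesis by (simp add: insert_commute)
  qed
  have ne: "\<theta> \<noteq> 1" using \<theta>(2) by auto
  have span: "x \<in> Q.span {1, \<theta>}" if "x \<in> K" for x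
  proof (rule ccontr)
    assume x: "x \<notin> Q.span {1, \<theta>}"
    then have "Q.independent (insert x {1, \<theta>})" using indep by (rule Q.independent_insertI)
    moreover obtain b where b: "b \<subseteq> K" "Q.independent b" "K \<subseteq> Q.span b" "card b = 2"
      using Q.basis_exists[of K] dim by auto
    moreover have "finite b" using b(4) by (intro card_ge_0_finite) simp
    moreover have "insert x {1, \<theta>} \<subseteq> Q.span b" using b(3) that \<theta>(1) K1 by auto
    ultimately have "card (insert x {1, \<theta>}) \<le> 2"
      using Q.independent_span_bound[of b "insert x {1, \<theta>}"] by auto
    moreover have "x \<notin> {1, \<theta>}" using x Q.span_superset by blast
    ultimately show False using ne by simp
  qed
  have rep: "\<exists>a b. x = of_rat a + of_rat b * \<theta>" if "x \<in> K" for x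
  proof -
    have "x \<in> Q.span (insert \<theta> {1})" using span[OF that] by (simp add: insert_commute)
    then obtain b where "x - of_rat b * \<theta> \<in> Q.span {1}" unfolding Q.span_insert by blast
    then obtain a where "x - of_rat b * \<theta> = of_rat a * 1" unfolding Q.span_singleton by blast
    then have "x = of_rat a + of_rat b * \<theta>" by (simp add: algebra_simps)
    then show ?thesis by blast
  qed
  obtain a b where ab: "\<theta> * \<theta> = of_rat a + of_rat b * \<theta>" using rep[OF Kmult[OF \<theta>(1) \<theta>(1)]] by blast
  define \<eta> where "\<eta> = \<theta> - of_rat (b / 2)"
  define c where "c = a + b * b / 4"
  have \<eta>K: "\<eta> \<in> K" unfolding \<eta>_def by (intro Kdiff \<theta> Krat)
  have \<eta>2: "\<eta> * \<eta> = of_rat c"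
  proof -
    have "\<eta> * \<eta> = \<theta> * \<theta> - of_rat b * \<theta> + of_rat (b * b / 4)"
      by (simp add: \<eta>_def algebra_simps of_rat_divide of_rat_mult)
    then show ?thesis by (simp add: ab c_def of_rat_add)
  qed
  have \<eta>R: "\<eta> \<notin> \<real>"
    unfolding \<eta>_def using \<theta>(2) rat_real[of "b / 2"] by (metis Reals_add diff_add_cancel)
  obtain m n where mn: "c = of_int m / of_int n" "n > 0" by (metis quotient_of_div quotient_of_denom_pos surj_pair)
  define N where "N = - (m * n)"
  have N: "(of_int n * \<eta>) * (of_int n * \<eta>) = - of_int N"
  proof -
    have "(of_int n * \<eta>) * (of_int n * \<eta>) = of_int n * of_int n * of_rat c"
      by (simp add: \<eta>2[symmetric] algebra_simps)
    then show ?thesis using mn by (simp add: N_def of_rat_divide)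
  qed
  have "N > 0"
  proof (rule ccontr)
    assume "\<not> N > 0"
    then have "of_int n * \<eta> = of_real (sqrt (- of_int N)) \<or> of_int n * \<eta> = - of_real (sqrt (- of_int N))"
      using N by (intro square_eq_iff[THEN iffD1]) (simp flip: of_real_mult)
    then have "of_int n * \<eta> \<in> \<real>" by auto
    moreover have "\<eta> = of_int n * \<eta> / of_int n" using mn(2) by simp
    ultimately show False using \<eta>R by (metis Reals_divide Reals_of_int)
  qed
  define M where "M = nat N"
  define d where "d = squarefree_part M"
  define f where "f = square_part M"
  have M: "M = d * f\<^sup>2" unfolding d_def f_def by (rule squarefree_decompose)
  have "M > 0" using \<open>N > 0\<close> by (simp add: M_def)
  then have f0: "f > 0" using M by (cases "f = 0") auto
  define r where "r = \<i> * complex_of_real (sqrt (real d))"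
  have sq: "(of_int n * \<eta>) * (of_int n * \<eta>) = (of_nat f * r) * (of_nat f * r)"
  proof -
    have "(of_nat f * r) * (of_nat f * r) = - of_nat f * of_nat f * complex_of_real (sqrt (real d) * sqrt (real d))"
      unfolding of_real_mult by (simp add: r_def algebra_simps)
    also have "\<dots> = - of_nat M" by (simp add: M power2_eq_square)
    also have "\<dots> = - of_int N" using \<open>N > 0\<close> by (simp add: M_def)
    finally show ?thesis using N by simp
  qed
  then have pm: "of_int n * \<eta> = of_nat f * r \<or> of_int n * \<eta> = - (of_nat f * r)"
    by (simp only: square_eq_iff)
  define g :: rat where "g = (if of_int n * \<eta> = of_nat f * r then of_nat f / of_int n else - (of_nat f / of_int n))"
  have g: "\<eta> = of_rat g * r"
    using pm mn(2) by (auto simp: g_def of_rat_divide of_rat_minus field_simps)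
  have g0: "g \<noteq> 0" using f0 mn(2) by (auto simp: g_def)
  have "r \<in> K"
  proof -
    have "r = inverse (of_rat g) * \<eta>" using g g0 by simp
    then show ?thesis by (metis Kmult Kinv Krat \<eta>K)
  qed
  have "K = {of_rat a + of_rat b * r | a b. True}"
  proof (intro subset_antisym subsetI)
    fix x assume "x \<in> K"
    then obtain a' b' where "x = of_rat a' + of_rat b' * \<theta>" using rep by blast
    moreover define h where "h = b / 2"
    have "\<theta> = of_rat h + of_rat g * r" using g by (simp add: \<eta>_def h_def algebra_simps)
    ultimately have "x = of_rat (a' + b' * h) + of_rat (b' * g) * r"
      by (simp add: of_rat_add of_rat_mult algebra_simps)
    then show "x \<in> {of_rat a + of_rat b * r | a b. True}" by blast
  next
    fix x assume "x \<in> {of_rat a + of_rat b * r | a b. True}"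
    then show "x \<in> K" using \<open>r \<in> K\<close> by (auto intro!: Kadd Kmult Krat)
  qed
  then show ?thesis using that[of d] by (simp add: r_def d_def)
qed

section \<open>Determination of the ring of integers\<close>

lemma complex_of_rat: "complex_of_rat q = of_real (of_rat q)"
proof -
  obtain a b where "q = of_int a / of_int b" by (metis quotient_of_div surj_pair)
  then show ?thesis by (simp add: of_rat_divide)
qed

lemma squarefree_rational_square:
  fixes q :: rat
  assumes "squarefree d" "q\<^sup>2 * of_nat d = of_int N"
  shows "q \<in> \<int>"
proof -
  obtain s t where st: "quotient_of q = (s, t)" by force
  then have q: "q = of_int s / of_int t" "t > 0" "coprime s t"
    using quotient_of_div quotient_of_denom_pos quotient_of_coprime by auto
  have "(of_int (s\<^sup>2 * int d) :: rat) = of_int (N * t\<^sup>2)"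
    using assms(2) q by (simp add: field_simps power_divide)
  then have "s\<^sup>2 * int d = N * t\<^sup>2" by (simp only: of_int_eq_iff)
  then have "t\<^sup>2 dvd s\<^sup>2 * int d" by simp
  moreover have "coprime (t\<^sup>2) (s\<^sup>2)" using q(3) by (simp add: coprime_commute)
  ultimately have "t\<^sup>2 dvd int d" by (simp add: coprime_dvd_mult_right_iff)
  moreover have "t = int (nat t)" using q(2) by simp
  ultimately have "int ((nat t)\<^sup>2) dvd int d" by (metis of_nat_power)
  then have "(nat t)\<^sup>2 dvd d" by (simp only: of_nat_dvd_iff)
  then have "nat t dvd 1" using assms(1) by (rule squarefreeD[rotated])
  then have "t = 1" using q(2) by simp
  then show ?thesis using q(1) by simp
qed

text \<open>The integral basis provides closure under addition, so traces and squares are the only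
  further operations needed: the trace bounds the denominator of a by 2, and the square then that of
  b.\<close>

lemma ring_of_integers_quadratic:
  fixes d :: nat
  assumes d: "squarefree d" and K: "K = {of_rat a + of_rat b * (\<i> * of_real (sqrt d)) | a b. True}"
    and basis: "int_basis (ring_of_integers K) w1 w2"
  defines "w \<equiv> (if d mod 4 = 3 then (1 + \<i> * of_real (sqrt d)) / 2 else \<i> * of_real (sqrt d))"
  shows "ring_of_integers K = {of_int a + of_int b * w | a b. True}"
proof -
  define r where "r = \<i> * complex_of_real (sqrt d)"
  define L where "L = ring_of_integers K"
  have r2: "r * r = - of_nat d"
  proof -
    have "r * r = - complex_of_real (sqrt d * sqrt d)"
      by (simp only: of_real_mult) (simp add: r_def algebra_simps)
    then show ?thesis by simp
  qed
  have cnj_r: "cnj r = - r" by (simp add: r_def)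
  have K': "K = {of_rat a + of_rat b * r | a b. True}" using K by (simp add: r_def)
  have L_iff: "x \<in> L \<longleftrightarrow> x \<in> K \<and> algebraic_int x" for x by (auto simp: L_def ring_of_integers_def)
  have L_range: "L = range (\<lambda>(m::int, n::int). of_int m * w1 + of_int n * w2)"
    using basis by (simp add: int_basis_def bij_betw_def L_def)
  have L_comb: "of_int j * x + of_int k * y \<in> L" if xy: "x \<in> L" "y \<in> L" for x y j k
  proof -
    obtain m n where x: "x = of_int m * w1 + of_int n * w2" using xy(1) unfolding L_range by auto
    obtain m' n' where y: "y = of_int m' * w1 + of_int n' * w2" using xy(2) unfolding L_range by auto
    have "of_int j * x + of_int k * y = of_int (j * m + k * m') * w1 + of_int (j * n + k * n') * w2"
      unfolding x y by (simp add: algebra_simps)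
    then show ?thesis unfolding L_range by (intro image_eqI[of _ _ "(j * m + k * m', j * n + k * n')"]) auto
  qed
  have L_add: "x + y \<in> L" if "x \<in> L" "y \<in> L" for x y using L_comb[OF that, of 1 1] by simp
  have L_sub: "x - of_int k * y \<in> L" if "x \<in> L" "y \<in> L" for x y k using L_comb[OF that, of 1 "- k"] by simp
  have K_I: "of_rat a + of_rat b * r \<in> K" for a b unfolding K' by blast
  have L_int: "of_int n \<in> L" for n
    using K_I[of "of_int n" 0] by (auto simp: L_iff intro: int_imp_algebraic_int)
  have L_rat: "q \<in> \<int>" if "complex_of_rat q \<in> L" for q
  proof -
    have "complex_of_rat q \<in> \<int>"
      using that by (intro rational_algebraic_int_is_int) (auto simp: L_iff)
    then obtain n where "complex_of_rat q = of_rat (of_int n)" by (auto elim: Ints_cases)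
    then show ?thesis by (simp only: of_rat_eq_iff) simp
  qed
  have trace: "2 * a \<in> \<int>" if x: "of_rat a + of_rat b * r \<in> L" for a b
  proof -
    have "cnj (of_rat a + of_rat b * r) = of_rat a + of_rat (- b) * r"
      by (simp add: complex_of_rat cnj_r of_rat_minus)
    then have "cnj (of_rat a + of_rat b * r) \<in> L" using x K_I[of a "- b"] by (metis L_iff algebraic_int_cnj)
    with x have "of_rat a + of_rat b * r + cnj (of_rat a + of_rat b * r) \<in> L" by (rule L_add)
    also have "of_rat a + of_rat b * r + cnj (of_rat a + of_rat b * r) = of_rat (2 * a)"
      by (simp add: complex_of_rat cnj_r of_rat_mult)
    finally show ?thesis by (rule L_rat)
  qed
  have square: "b\<^sup>2 * of_nat d \<in> \<int>" if "of_rat b * r \<in> L" for b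
  proof -
    have "(of_rat b * r)\<^sup>2 = of_rat (b * b) * (r * r)" by (simp add: power2_eq_square of_rat_mult)
    also have "\<dots> = of_rat (- (b\<^sup>2 * of_nat d))" unfolding r2 by (simp add: of_rat_mult of_rat_minus power2_eq_square)
    finally have "algebraic_int (complex_of_rat (- (b\<^sup>2 * of_nat d)))"
      using algebraic_int_square[of "of_rat b * r"] that by (simp add: L_iff)
    then have "complex_of_rat (- (b\<^sup>2 * of_nat d)) \<in> L"
      using K_I[of "- (b\<^sup>2 * of_nat d)" 0] by (simp add: L_iff)
    then have "- (b\<^sup>2 * of_nat d) \<in> \<int>" by (rule L_rat)
    then show ?thesis by simp
  qed
  have coeffs: "\<exists>A B. a = of_int A / 2 \<and> b = of_int B / 2" if x: "of_rat a + of_rat b * r \<in> L" for a b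
  proof -
    obtain A where A: "2 * a = of_int A" using trace[OF x] by (auto elim: Ints_cases)
    have "of_int 2 * (of_rat a + of_rat b * r) + of_int (- 1) * of_int A \<in> L" using x L_int by (rule L_comb)
    moreover have "(of_int A :: complex) = of_rat (2 * a)" by (simp add: A)
    ultimately have "of_rat (2 * b) * r \<in> L" by (simp add: of_rat_mult algebra_simps)
    then have "(2 * b)\<^sup>2 * of_nat d \<in> \<int>" by (rule square)
    then obtain N where "(2 * b)\<^sup>2 * of_nat d = of_int N" by (rule Ints_cases)
    then have "2 * b \<in> \<int>" using squarefree_rational_square[OF d] by blast
    then obtain B where "2 * b = of_int B" by (auto elim: Ints_cases)
    then show ?thesis using A by (intro exI[of _ A] exI[of _ B]) (auto simp: field_simps)
  qed
  have not4: "\<not> 4 dvd d"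
    using squarefreeD[OF d, of 2] by auto
  have no_half: "of_rat (1 / 2) * r \<notin> L"
  proof
    assume "of_rat (1 / 2) * r \<in> L"
    then obtain n where "(of_nat d / 4 :: rat) = of_int n"
      using square[of "1 / 2"] by (auto simp: power_divide elim: Ints_cases)
    then have "(of_int (int d) :: rat) = of_int (4 * n)" by simp
    then have "int d = 4 * n" by (simp only: of_int_eq_iff)
    then show False using not4 by presburger
  qed
  have wL: "w \<in> L"
  proof -
    have "algebraic_int w \<and> w \<in> K"
    proof (cases "d mod 4 = 3")
      case True
      then have "4 dvd d + 1" by presburger
      then obtain k where k: "d + 1 = 4 * k" by blast
      have w: "w = (1 + r) / 2" using True by (simp add: w_def r_def)
      have "4 * poly [:of_nat k, - 1, 1:] w = of_nat (4 * k) - 2 * (2 * w) + (2 * w) * (2 * w)"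
        by (simp add: algebra_simps)
      also have "2 * w = 1 + r" by (simp add: w)
      also have "of_nat (4 * k) - 2 * (1 + r) + (1 + r) * (1 + r) = of_nat (4 * k) - 1 + r * r"
        by (simp add: algebra_simps)
      also have "\<dots> = 0" unfolding r2 k[symmetric] by simp
      finally have "poly [:of_nat k, - 1, 1:] w = 0" by (metis mult_eq_0_iff zero_neq_numeral)
      then have "algebraic_int w"
        by (intro algebraic_int.intros[of "[:of_nat k, - 1, 1:]"]) (auto simp: coeff_pCons split: nat.split)
      moreover have "w = of_rat (1 / 2) + of_rat (1 / 2) * r" by (simp add: w of_rat_divide field_simps)
      ultimately show ?thesis using K_I by metis
    next
      case False
      then have w: "w = r" by (simp add: w_def r_def)
      have "poly [:of_nat d, 0, 1:] w = 0" using r2 by (simp add: w)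
      then have "algebraic_int w"
        by (intro algebraic_int.intros[of "[:of_nat d, 0, 1:]"]) (auto simp: coeff_pCons split: nat.split)
      then show ?thesis using K_I[of 0 1] w by simp
    qed
    then show ?thesis by (simp add: L_iff)
  qed
  have "L = {of_int a + of_int b * w | a b. True}"
  proof (intro subset_antisym subsetI)
    fix x assume "x \<in> {of_int a + of_int b * w | a b. True}"
    then obtain a b where "x = of_int a + of_int b * w" by auto
    then show "x \<in> L" using L_comb[OF L_int[of 1] wL, of a b] by simp
  next
    fix x assume x: "x \<in> L"
    then obtain a b where ab: "x = of_rat a + of_rat b * r" unfolding L_iff K' by auto
    obtain A B where AB: "a = of_int A / 2" "b = of_int B / 2" using coeffs x ab by metis
    have "\<exists>k. x - of_int k * w \<in> L \<and> (\<exists>q. x - of_int k * w = of_rat q)"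
    proof (cases "d mod 4 = 3")
      case True
      then have w: "w = (1 + r) / 2" by (simp add: w_def r_def)
      have "x - of_int B * w = of_rat ((of_int A - of_int B) / 2)"
        by (simp add: ab AB w of_rat_divide of_rat_diff field_simps)
      then show ?thesis using L_sub[OF x wL, of B] by metis
    next
      case False
      then have w: "w = r" by (simp add: w_def r_def)
      show ?thesis
      proof (cases "even B")
        case True
        then obtain k where k: "B = 2 * k" by blast
        have "x - of_int k * w = of_rat (of_int A / 2)"
          by (simp add: ab AB w k of_rat_divide field_simps)
        then show ?thesis using L_sub[OF x wL, of k] by metis
      next
        case oddB: False
        then obtain k where k: "B = 2 * k + 1" by (elim oddE)
        define y where "y = x - of_int k * w"
        have yL: "y \<in> L" unfolding y_def by (rule L_sub[OF x wL])
        have y: "y = of_int A / 2 + r / 2"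
          by (simp add: y_def ab AB w k of_rat_divide of_rat_add of_rat_mult field_simps)
        have half: "(of_rat (1 / 2) :: complex) * r = r / 2" by (simp add: of_rat_divide)
        have False
        proof (cases "even A")
          case True
          then obtain j where "A = 2 * j" by blast
          then have "y - of_int j * of_int 1 = r / 2" by (simp add: y)
          then show False using L_sub[OF yL L_int, of j 1] no_half half by metis
        next
          case oddA: False
          then obtain j where j: "A = 2 * j + 1" by (elim oddE)
          define z where "z = y - of_int j * of_int 1"
          have zL: "z \<in> L" unfolding z_def by (rule L_sub[OF yL L_int])
          have z: "z = (1 + r) / 2" by (simp add: z_def y j field_simps)
          \<comment> \<open>The trace of z^2 is 2 e = (1 - d) / 2, so d is odd, hence 1 modulo 4 in
            this case. Then e is an integer and z^2 - e = r / 2, which \<open>no_half\<close>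
            excludes.\<close>
          define e where "e = (1 - of_nat d :: rat) / 4"
          have "z\<^sup>2 = (1 + 2 * r + r * r) / 4" by (simp add: z power2_eq_square field_simps)
          also have "\<dots> = of_rat e + of_rat (1 / 2) * r"
            unfolding r2 by (simp add: e_def of_rat_divide of_rat_diff field_simps)
          finally have z2: "z\<^sup>2 = of_rat e + of_rat (1 / 2) * r" .
          then have z2L: "z\<^sup>2 \<in> L"
            using algebraic_int_square[of z] zL K_I[of e "1 / 2"] by (simp add: L_iff)
          then have "2 * e \<in> \<int>" using trace z2 by metis
          then obtain n where "2 * e = of_int n" by (auto elim: Ints_cases)
          then have "(of_int (1 - int d) :: rat) = of_int (2 * n)" by (simp add: e_def)
          then have "1 - int d = 2 * n" by (simp only: of_int_eq_iff)
          then have "d mod 4 = 1" using False by presburger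
          then have "4 dvd 1 - int d" by presburger
          then obtain i where i: "1 - int d = 4 * i" by blast
          have "(of_int (1 - int d) :: rat) = of_int (4 * i)" using i by simp
          then have "e = of_int i" by (simp add: e_def)
          then have "z\<^sup>2 - of_int i * of_int 1 = of_rat (1 / 2) * r" using z2 by simp
          then show False using L_sub[OF z2L L_int, of i 1] no_half by metis
        qed
        then show ?thesis ..
      qed
    qed
    then obtain k q where kq: "x - of_int k * w \<in> L" "x - of_int k * w = of_rat q" by blast
    then have "q \<in> \<int>" using L_rat by metis
    then obtain n where "q = of_int n" by (auto elim: Ints_cases)
    then have "x = of_int n + of_int k * w" using kq(2) by (simp add: algebra_simps)
    then show "x \<in> {of_int a + of_int b * w | a b. True}" by blast
  qed
  then show ?thesis by (simp add: L_def)
qed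

lemma quadratic_order_sqrt:
  assumes "d > 0" and R: "R = {of_int a + of_int b * w | a b. True}"
    and w: "w = (if d mod 4 = 3 then (1 + \<i> * of_real (sqrt (real d))) / 2 else \<i> * of_real (sqrt (real d)))"
  shows "quadratic_order R w"
proof
  show "R = {of_int a + of_int b * w | a b. True}" by (fact R)
  show "Im w \<noteq> 0" using assms(1) by (simp add: w)
  have "\<exists>m n :: int. w * w = of_int m + of_int n * w \<and> (\<forall>a b. \<exists>k :: int. (cmod (of_int a + of_int b * w))\<^sup>2 = of_int k)"
  proof (cases "d mod 4 = 3")
    case True
    then have "4 dvd d + 1" by presburger
    then obtain k where k: "d + 1 = 4 * k" by blast
    have w': "Re w = 1 / 2" "Im w = sqrt d / 2" using True by (simp_all add: w)
    have dk: "real d = 4 * real k - 1" using k by (metis add_diff_cancel_right' of_nat_1 of_nat_add of_nat_mult of_nat_numeral)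
    have k1: "real k \<ge> 1" using k by (cases k) auto
    have "sqrt d * sqrt d = 4 * real k - 1" unfolding dk using k1 by simp
    then have "w * w = of_int (- int k) + of_int 1 * w"
      unfolding complex_eq_iff by (simp add: w' field_simps)
    moreover have "(cmod (of_int a + of_int b * w))\<^sup>2 = of_int (a\<^sup>2 + a * b + int k * b\<^sup>2)" for a b
    proof -
      have "(cmod (of_int a + of_int b * w))\<^sup>2 = (of_int a + of_int b / 2)\<^sup>2 + (of_int b * (sqrt d / 2))\<^sup>2"
      proof -
        have "Re (of_int a + of_int b * w) = of_int a + of_int b / 2"
          "Im (of_int a + of_int b * w) = of_int b * (sqrt d / 2)" by (simp_all add: w')
        then show ?thesis by (simp only: cmod_power2)
      qed
      also have "(of_int b * (sqrt d / 2))\<^sup>2 = (of_int b)\<^sup>2 * (4 * real k - 1) / 4"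
        unfolding power_mult_distrib power_divide by (simp add: dk[symmetric])
      also have "(of_int a + of_int b / 2)\<^sup>2 + (of_int b)\<^sup>2 * (4 * real k - 1) / 4 = of_int (a\<^sup>2 + a * b + int k * b\<^sup>2)"
        by (simp add: power2_eq_square field_simps)
      finally show ?thesis .
    qed
    ultimately show ?thesis by metis
  next
    case False
    then have w': "Re w = 0" "Im w = sqrt d" by (simp_all add: w)
    have "w * w = of_int (- int d) + of_int 0 * w"
      by (simp add: complex_eq_iff w')
    moreover have "(cmod (of_int a + of_int b * w))\<^sup>2 = of_int (a\<^sup>2 + int d * b\<^sup>2)" for a b
      by (simp add: cmod_power2 w' power_mult_distrib)
    ultimately show ?thesis by metis
  qed
  then obtain m n :: int where mn: "w * w = of_int m + of_int n * w"
    and norm: "\<And>a b. \<exists>k :: int. (cmod (of_int a + of_int b * w))\<^sup>2 = of_int k" by blast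
  show "w * w \<in> R" unfolding R mn by blast
  fix x assume x: "x \<in> R" "x \<noteq> 0"
  then obtain k :: int where k: "(cmod x)\<^sup>2 = of_int k" using norm unfolding R by blast
  have "(cmod x)\<^sup>2 > 0" using x by simp
  then have "k \<ge> 1" using k by simp
  then have "1\<^sup>2 \<le> (cmod x)\<^sup>2" using k by simp
  then show "cmod x \<ge> 1" by (rule power2_le_imp_le) simp
qed

context quadratic_order begin

section \<open>The discriminant and its proper divisors\<close>

lemma int_basis_1_w: "int_basis R 1 w"
proof -
  have "inj (\<lambda>(m::int, n::int). of_int m * 1 + of_int n * w)"
    using Im_w by (auto simp: inj_def complex_eq_iff)
  moreover have "range (\<lambda>(m::int, n::int). of_int m * 1 + of_int n * w) = R"
    unfolding R_eq by (auto simp: image_def)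
  ultimately show ?thesis by (simp add: int_basis_def bij_betw_def)
qed

text \<open>The two base changes have integer determinants with product 1. This is the independence
  of the basis that the definite description in \<open>discriminant\<close> relies on.\<close>

lemma int_basis_cross_square:
  assumes "int_basis R w1 w2"
  shows "(cross w1 w2)\<^sup>2 = (Im w)\<^sup>2"
proof -
  have R: "R = range (\<lambda>(m::int, n::int). of_int m * w1 + of_int n * w2)"
    using assms by (simp add: int_basis_def bij_betw_def)
  have "w1 \<in> R" "w2 \<in> R"
    unfolding R by (auto intro: image_eqI[of _ _ "(1, 0)"] image_eqI[of _ _ "(0, 1)"])
  then obtain a b c e where "w1 = of_int a * 1 + of_int b * w" "w2 = of_int c * 1 + of_int e * w"
    by (metis R_E mult.right_neutral)
  then have 1: "cross w1 w2 = of_int (a * e - b * c) * cross 1 w" by (metis cross_int_comb)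
  have "1 \<in> R" "w \<in> R" by auto
  then obtain a' b' c' e' where "1 = of_int a' * w1 + of_int b' * w2" "w = of_int c' * w1 + of_int e' * w2"
    unfolding R by auto
  then have "cross 1 w = of_int (a' * e' - b' * c') * cross w1 w2" by (metis cross_int_comb)
  then have "cross 1 w * 1 = cross 1 w * of_int ((a' * e' - b' * c') * (a * e - b * c))"
    using 1 by (simp add: mult_ac)
  moreover have c1: "cross 1 w = Im w" by (simp add: cross_def)
  ultimately have "of_int ((a' * e' - b' * c') * (a * e - b * c)) = (1 :: real)"
    using Im_w by simp
  then have "(a' * e' - b' * c') * (a * e - b * c) = 1" by (simp only: of_int_eq_1_iff)
  then have "a * e - b * c = 1 \<or> a * e - b * c = - 1" unfolding zmult_eq_1_iff by blast
  then have "(real_of_int (a * e - b * c))\<^sup>2 = 1" by (elim disjE) (simp_all only:, simp_all)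
  then show ?thesis unfolding 1 power_mult_distrib c1 by simp
qed

lemma discriminant_eq:
  assumes "R = ring_of_integers K" and D: "of_int D = - 4 * (Im w)\<^sup>2"
  shows "discriminant K = D"
proof -
  have sq: "(w1 * cnj w2 - w2 * cnj w1)\<^sup>2 = of_real (- 4 * (cross w1 w2)\<^sup>2)" for w1 w2
  proof -
    have "w1 * cnj w2 - w2 * cnj w1 = - 2 * \<i> * of_real (cross w1 w2)"
      by (simp add: complex_eq_iff cross_def)
    then have "(w1 * cnj w2 - w2 * cnj w1)\<^sup>2 = (- 2 * \<i>)\<^sup>2 * (of_real (cross w1 w2))\<^sup>2"
      by (simp only: power_mult_distrib)
    then show ?thesis by (simp add: power_mult_distrib)
  qed
  show ?thesis unfolding discriminant_def
  proof (rule the_equality)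
    have "complex_of_int D = (1 * cnj w - w * cnj 1)\<^sup>2"
      unfolding sq int_basis_cross_square[OF int_basis_1_w] D[symmetric] by simp
    then show "\<exists>w1 w2. int_basis (ring_of_integers K) w1 w2 \<and> of_int D = (w1 * cnj w2 - w2 * cnj w1)\<^sup>2"
      using int_basis_1_w assms(1) by blast
  next
    fix D' assume "\<exists>w1 w2. int_basis (ring_of_integers K) w1 w2 \<and> of_int D' = (w1 * cnj w2 - w2 * cnj w1)\<^sup>2"
    then obtain w1 w2 where "int_basis R w1 w2" "of_int D' = (w1 * cnj w2 - w2 * cnj w1)\<^sup>2"
      using assms(1) by auto
    then have "complex_of_int D' = of_real (of_int D)"
      unfolding sq by (simp add: int_basis_cross_square D)
    then show "D' = D" by simp
  qed
qed

text \<open>By hypothesis \<open>Im w\<close> is half the root of |D|. A cofactor off the real axis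
  has modulus at least \<open>Im w\<close>; otherwise it is an integer a, and a = 1 or -1 would make
  \<delta> an associate of D.\<close>

lemma proper_divisor_norm:
  assumes \<delta>: "proper_divisor R \<delta> (of_int D)" and "D \<noteq> 0"
    and D: "\<bar>of_int D\<bar> = 4 * (Im w)\<^sup>2" and "Im w > 0"
  obtains "cmod \<delta> \<le> 4 * Im w" | a where "a \<ge> 2" "a dvd nat \<bar>D\<bar>" "cmod \<delta> = real (nat \<bar>D\<bar> div a)"
proof -
  obtain e where e: "e \<in> R" "of_int D = \<delta> * e" and no: "\<And>c. c \<in> R \<Longrightarrow> \<delta> \<noteq> of_int D * c" and "\<delta> \<in> R"
    using \<delta> by (auto simp: proper_divisor_def)
  have nz: "e \<noteq> 0" "\<delta> \<noteq> 0" using e(2) \<open>D \<noteq> 0\<close> by auto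
  obtain a b where ab: "e = of_int a + of_int b * w" using e(1) by (rule R_E)
  have norm: "cmod \<delta> * cmod e = 4 * (Im w)\<^sup>2"
    using arg_cong[OF e(2), of cmod] D by (simp add: norm_mult)
  show ?thesis
  proof (cases "b = 0")
    case False
    then have "1 * Im w \<le> \<bar>of_int b\<bar> * Im w" using assms(4) by (intro mult_right_mono) linarith+
    also have "\<dots> \<le> cmod e" using abs_Im_le_cmod[of e] assms(4) by (simp add: ab abs_mult)
    finally have "cmod \<delta> * Im w \<le> cmod \<delta> * cmod e" by (intro mult_left_mono) auto
    then have "cmod \<delta> * Im w \<le> 4 * Im w * Im w" using norm by (simp add: power2_eq_square)
    then have "cmod \<delta> \<le> 4 * Im w" using assms(4) by simp
    then show ?thesis by (rule that(1))
  next
    case True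
    then have ea: "e = of_int a" "a \<noteq> 0" using ab nz by auto
    obtain f g where fg: "\<delta> = of_int f + of_int g * w" using \<open>\<delta> \<in> R\<close> by (rule R_E)
    have "Im (\<delta> * e) = 0" unfolding e(2)[symmetric] by simp
    then have "g = 0" using ea assms(4) by (simp add: fg)
    then have \<delta>f: "\<delta> = of_int f" using fg by simp
    have "complex_of_int D = of_int (f * a)" using e(2) by (simp add: \<delta>f ea)
    then have Df: "D = f * a" by (simp only: of_int_eq_iff)
    have "\<bar>a\<bar> \<noteq> 1"
    proof
      assume "\<bar>a\<bar> = 1"
      then have "\<delta> = of_int D * of_int a" by (auto simp: Df \<delta>f abs_if split: if_splits)
      then show False using no by blast
    qed
    then have a2: "nat \<bar>a\<bar> \<ge> 2" using ea(2) by linarith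
    have "nat \<bar>D\<bar> = nat \<bar>f\<bar> * nat \<bar>a\<bar>" by (simp add: Df abs_mult nat_mult_distrib)
    then have "nat \<bar>a\<bar> dvd nat \<bar>D\<bar>" "nat \<bar>D\<bar> div nat \<bar>a\<bar> = nat \<bar>f\<bar>" using a2 by auto
    then show ?thesis using a2 by (intro that(2)[of "nat \<bar>a\<bar>"]) (auto simp: \<delta>f)
  qed
qed

end

section \<open>Assembly according to the residue of d modulo 4\<close>

theorem theorem2p5:
  fixes K F :: "complex set" and \<delta> :: complex
  assumes "imaginary_quadratic_field K"
    and "fundamental_parallelogram (ring_of_integers K) F"
    and "is_arg_max cmod (\<lambda>d. proper_divisor (ring_of_integers K) d (of_int (discriminant K))) \<delta>"
  shows "swan_number (ring_of_integers K) F > cmod \<delta> / 8"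
proof -
  obtain d :: nat where d: "squarefree d"
    and K: "K = {of_rat a + of_rat b * (\<i> * of_real (sqrt (real d))) | a b. True}"
    using imaginary_quadratic_field_cases[OF assms(1)] .
  define R where "R = ring_of_integers K"
  define w where "w = (if d mod 4 = 3 then (1 + \<i> * of_real (sqrt (real d))) / 2 else \<i> * of_real (sqrt (real d)))"
  \<comment> \<open>The parallelogram F already carries an integral basis, which is what determines
    the ring of integers below.\<close>
  obtain w1 w2 where "int_basis R w1 w2"
    using assms(2) by (auto simp: fundamental_parallelogram_def R_def)
  then have R: "R = {of_int a + of_int b * w | a b. True}"
    unfolding R_def w_def by (rule ring_of_integers_quadratic[OF d K])
  have d0: "d > 0" using d by (intro Nat.gr0I) auto
  interpret quadratic_order R w
    using quadratic_order_sqrt[OF d0 R w_def] .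
  have F: "fundamental_parallelogram R F" using assms(2) by (simp add: R_def)
  have Imw: "Im w > 0" using d0 by (simp add: w_def)
  have \<delta>: "proper_divisor R \<delta> (of_int (discriminant K))"
    using assms(3) by (simp add: is_arg_max_def R_def)
  have not4: "\<not> 4 dvd d" using squarefreeD[OF d, of 2] by auto
  have "swan_number R F > cmod \<delta> / 8"
  proof (cases "d mod 4 = 3")
    case True
    then have w: "w = (1 + \<i> * of_real (sqrt (real d))) / 2" by (simp add: w_def)
    interpret odd_order R w d by unfold_locales (use True w in auto)
    have D: "discriminant K = - int d"
      by (rule discriminant_eq[OF R_def]) (simp add: w power_divide)
    have "sqrt d \<noteq> 4"
    proof
      assume "sqrt d = 4"
      then have "(sqrt d)\<^sup>2 = 4\<^sup>2" by simp
      then have "d = 16" by simp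
      then show False using True by simp
    qed
    then have Im2: "Im w \<noteq> 2" by (simp add: w)
    show ?thesis
    proof (rule proper_divisor_norm[OF \<delta> _ _ Imw])
      show "discriminant K \<noteq> 0" using D d0 by simp
      show "\<bar>real_of_int (discriminant K)\<bar> = 4 * (Im w)\<^sup>2" by (simp add: D w power_divide)
      assume "cmod \<delta> \<le> 4 * Im w"
      then show ?thesis using swan_number_gt_half_height[OF F Imw Im2] by linarith
    next
      fix a assume a: "a \<ge> 2" "a dvd nat \<bar>discriminant K\<bar>" "cmod \<delta> = real (nat \<bar>discriminant K\<bar> div a)"
      then have ad: "a dvd d" "cmod \<delta> = real (d div a)" by (simp_all add: D)
      \<comment> \<open>Passing from a to a prime factor p only enlarges the quotient of d, and
        squarefreeness makes p coprime to q.\<close>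
      obtain p where p: "prime p" "p dvd a" using a(1) prime_factor_nat[of a] by auto
      then obtain q where q: "d = p * q" using ad(1) by (metis dvd_trans dvdE)
      have "coprime p q"
      proof (rule ccontr)
        assume "\<not> coprime p q"
        then have "p dvd q" using p(1) prime_imp_coprime by blast
        then have "p\<^sup>2 dvd d" unfolding q power2_eq_square by (intro mult_dvd_mono) auto
        then show False using squarefreeD[OF d] p(1) by (auto simp: prime_nat_iff)
      qed
      then have "swan_number R F > q / 8" by (rule swan_number_gt_odd[OF F q p(1)])
      moreover have "d div a \<le> q"
      proof -
        have "p \<le> a" using p(2) a(1) by (intro dvd_imp_le) auto
        then have "d div a \<le> d div p" using prime_gt_0_nat[OF p(1)] by (intro div_le_mono2)
        also have "d div p = q" using q prime_gt_0_nat[OF p(1)] by simp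
        finally show ?thesis .
      qed
      ultimately show ?thesis using ad(2) by simp
    qed
  next
    case False
    then have w: "w = \<i> * of_real (sqrt (real d))" by (simp add: w_def)
    have dm: "d mod 4 = 1 \<or> d mod 4 = 2" using False not4 by presburger
    interpret even_order R w d by unfold_locales (use dm d w in auto)
    have D: "discriminant K = - (4 * int d)"
      by (rule discriminant_eq[OF R_def]) (simp add: w)
    have "sqrt d \<noteq> 2"
    proof
      assume "sqrt d = 2"
      then have "(sqrt d)\<^sup>2 = 2\<^sup>2" by simp
      then have "d = 4" by simp
      then show False using not4 by simp
    qed
    then have Im2: "Im w \<noteq> 2" by (simp add: w)
    show ?thesis
    proof (rule proper_divisor_norm[OF \<delta> _ _ Imw])
      show "discriminant K \<noteq> 0" using D d0 by simp
      show "\<bar>real_of_int (discriminant K)\<bar> = 4 * (Im w)\<^sup>2" by (simp add: D w)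
      assume "cmod \<delta> \<le> 4 * Im w"
      then show ?thesis using swan_number_gt_half_height[OF F Imw Im2] by linarith
    next
      fix a assume a: "a \<ge> 2" "a dvd nat \<bar>discriminant K\<bar>" "cmod \<delta> = real (nat \<bar>discriminant K\<bar> div a)"
      have "nat \<bar>discriminant K\<bar> = 4 * d" by (simp add: D)
      moreover have "4 * d div a \<le> 4 * d div 2" using a(1) by (intro div_le_mono2) auto
      ultimately have "nat \<bar>discriminant K\<bar> div a \<le> 4 * d div 2" by simp
      then have "cmod \<delta> \<le> 2 * d" using a(3) by simp
      then show ?thesis using swan_number_gt_even[OF F] by linarith
    qed
  qed
  then show ?thesis by (simp add: R_def)
qed

end
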